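(* Let $D=\mathbb R^d$, let $P$ be a full-dimensional rational polytope in $D$, and let $b\ge1$. Let $\mathcal H$ be a linear hyperplane arrangement (a finite set of hyperplanes that all contain the origin) in $D^b=\mathbb R^{db}$. For each $q$, define a hyperplane arrangement $\mathcal H_q$ in $D^q$ as follows: for each hyperplane $H\in\mathcal H$ and each injection $\sigma$ from $[b]$ to $[q]$, there is a hyperplane $H_{\sigma,q}\in\mathcal H_q$ obtained by reindexing the copies of $D$ according to $\sigma$ (the coordinates of the $i$-th copy of $D$ in the equation of $H$ are replaced by the corresponding coordinates of the $\sigma(i)$-th copy of $D$ in $D^q$). Let $f_q(n)$ denote the number of lattice points in $(nP^q)^\circ$, the interior of the $n$-th dilate of the Cartesian product of $q$ copies of $P$, that avoid all of the hyperplanes in $\mathcal H_q$. Then $\frac{1}{\mathrm{Vol}(P)^q}f_q(n)$ is a two-level quasi-polynomial of infinite depth.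
   Context: $\mathbb N=\{0,1,2,\dots\}$, $[m]=\{1,\dots,m\}$; lattice points are points with integer coordinates; $\mathrm{Vol}$ is $d$-dimensional volume. A function $f:\mathbb N\to\mathbb Q$ is a quasi-polynomial of degree $d_0$ if $f(n)=\sum_{r=0}^{d_0} b_r(n)n^{d_0-r}$ with periodic $b_r:\mathbb N\to\mathbb Q$ and $b_0$ not identically zero. A numerical polynomial is $g\in\mathbb Q[x]$ with $g(q)\in\mathbb Z$ for all $q\in\mathbb Z$. Two-level quasi-polynomial: let $g$ be an eventually nonnegative numerical polynomial, $S=\{q\in\mathbb N: g(q)\ge 0\}$, $e:S\to\mathbb N\cup\{-1,\infty\}$, and $p:\mathbb N\to\mathbb Z_{>0}$ with $p(r)\mid p(r+1)$ for all $r$. A two-level quasi-polynomial of degree function $g$, depth function $e$ and period function $p$ is a sequence $\{f_q\}_{q\in S}$ of quasi-polynomials, $f_q$ of degree $g(q)$, such that, writing $f_q(n)=\sum_{r\ge0}c_r(q;n)n^{g(q)-r}$ with $c_r(q;n)$ periodic in $n$ and $c_r(q;n)=0$ for $r>g(q)$, there exist polynomials $\phi_r(q;i)$ in $q$ ($r\ge 0$, $0\le i<p(r)$) with $c_r(q;n)=\phi_r(q;\,n\bmod p(r))$ for every $n\in\mathbb N$, $q\in S$ and $r\le e(q)$. For $q\in\mathbb N\setminus S$ one defines $f_q(n)=0$ and $e(q)=-1$. Infinite depth means $e(q)=\infty$ for all $q\in S$. When the degree or period function is not specified, the assertion is that suitable ones exist.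
   Formalization: The count is identified with the two-level quasi-polynomial only for n≥1, and only for q≥b or when every hyperplane of H involves more than q copies of D; otherwise the claim can fail (P=[-1,1], b=2, H={x_1=0}, q=1). *)

theory Defs
  imports "HOL-Analysis.Analysis" "HOL-Computational_Algebra.Polynomial"
begin

section \<open>Quasi-polynomials and two-level quasi-polynomials\<close>

definition periodic :: "(nat \<Rightarrow> 'a) \<Rightarrow> bool" where
  "periodic b \<longleftrightarrow> (\<exists>k>0. \<forall>n. b (n + k) = b n)"

text \<open>\<open>f\<close> is a quasi-polynomial of degree \<open>D\<close> with coefficient functions \<open>b 0, \<dots>, b D\<close>,
  where \<open>b r\<close> is the coefficient of the power \<open>D - r\<close>.\<close>

definition quasi_poly_expansion :: "nat \<Rightarrow> (nat \<Rightarrow> nat \<Rightarrow> rat) \<Rightarrow> (nat \<Rightarrow> rat) \<Rightarrow> bool" where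
  "quasi_poly_expansion D b f \<longleftrightarrow>
     (\<forall>r\<le>D. periodic (b r)) \<and> (\<exists>n. b 0 n \<noteq> 0) \<and>
     (\<forall>n. f n = (\<Sum>r\<le>D. b r n * of_nat n ^ (D - r)))"

definition numerical_poly :: "rat poly \<Rightarrow> bool" where
  "numerical_poly g \<longleftrightarrow> (\<forall>k::int. poly g (of_int k) \<in> \<int>)"

definition nonneg_args :: "rat poly \<Rightarrow> nat set" where
  "nonneg_args g = {q. poly g (of_nat q) \<ge> 0}"

text \<open>For a numerical polynomial \<open>g\<close> and \<open>q \<in> nonneg_args g\<close> this is exactly the value of
  \<open>g\<close> at \<open>q\<close>, as a natural number.\<close>

definition nat_value :: "rat poly \<Rightarrow> nat \<Rightarrow> nat" where
  "nat_value g q = nat \<lfloor>poly g (of_nat q)\<rfloor>"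

text \<open>The sequence \<open>f\<close> is indexed by all natural numbers, with \<open>f q = 0\<close> and depth \<open>-1\<close>
  wherever \<open>g\<close> is negative.  The coefficients \<open>c r q n\<close> are uniquely determined by \<open>f\<close>
  and \<open>g\<close> for \<open>q \<in> nonneg_args g\<close>, so the existential quantifier over them merely names
  them.\<close>

definition two_level_quasi_polynomial ::
    "rat poly \<Rightarrow> (nat \<Rightarrow> ereal) \<Rightarrow> (nat \<Rightarrow> nat) \<Rightarrow> (nat \<Rightarrow> nat \<Rightarrow> rat) \<Rightarrow> bool" where
  "two_level_quasi_polynomial g e p f \<longleftrightarrow>
     numerical_poly g \<and>
     (\<forall>\<^sub>F q in sequentially. q \<in> nonneg_args g) \<and>
     (\<forall>q\<in>nonneg_args g. e q \<in> {-1, \<infinity>} \<union> range (\<lambda>k::nat. ereal (real k))) \<and>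
     (\<forall>r. p r > 0 \<and> p r dvd p (Suc r)) \<and>
     (\<forall>q. q \<notin> nonneg_args g \<longrightarrow> e q = -1 \<and> (\<forall>n. f q n = 0)) \<and>
     (\<exists>(c :: nat \<Rightarrow> nat \<Rightarrow> nat \<Rightarrow> rat) (\<phi> :: nat \<Rightarrow> nat \<Rightarrow> rat poly).
        \<forall>q\<in>nonneg_args g.
          quasi_poly_expansion (nat_value g q) (\<lambda>r. c r q) (f q) \<and>
          (\<forall>r n. r > nat_value g q \<longrightarrow> c r q n = 0) \<and>
          (\<forall>r n. ereal (real r) \<le> e q \<longrightarrow> c r q n = poly (\<phi> r (n mod p r)) (of_nat q)))"

definition infinite_depth :: "rat poly \<Rightarrow> (nat \<Rightarrow> ereal) \<Rightarrow> bool" where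
  "infinite_depth g e \<longleftrightarrow> (\<forall>q\<in>nonneg_args g. e q = \<infinity>)"


section \<open>Polytopes, powers of Euclidean space, and arrangements\<close>

definition rational_polytope :: "(real ^ 'd) set \<Rightarrow> bool" where
  "rational_polytope P \<longleftrightarrow> polytope P \<and> (\<forall>v. v extreme_point_of P \<longrightarrow> (\<forall>j. v $ j \<in> \<rat>))"

text \<open>The space \<open>D\<^sup>m\<close>, for \<open>D = real ^ 'd\<close>, consists of the extensional functions on
  \<open>{1..m}\<close>; \<open>x i\<close> is the component of \<open>x\<close> in the \<open>i\<close>-th copy of \<open>D\<close>.\<close>

definition copies :: "nat \<Rightarrow> (nat \<Rightarrow> real ^ 'd) set" where
  "copies m = PiE {1..m} (\<lambda>_. UNIV)"

definition copies_topology :: "nat \<Rightarrow> (nat \<Rightarrow> real ^ 'd) topology" where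
  "copies_topology m = product_topology (\<lambda>_. euclidean) {1..m}"

definition origin :: "nat \<Rightarrow> nat \<Rightarrow> real ^ 'd" where
  "origin m = (\<lambda>i\<in>{1..m}. 0)"

definition hyperplane :: "nat \<Rightarrow> (nat \<Rightarrow> real ^ 'd) set \<Rightarrow> bool" where
  "hyperplane m H \<longleftrightarrow>
     (\<exists>a c. (\<exists>i\<in>{1..m}. a i \<noteq> 0) \<and> H = {x \<in> copies m. (\<Sum>i\<in>{1..m}. a i \<bullet> x i) = c})"

definition linear_arrangement :: "nat \<Rightarrow> (nat \<Rightarrow> real ^ 'd) set set \<Rightarrow> bool" where
  "linear_arrangement m \<H> \<longleftrightarrow> finite \<H> \<and> (\<forall>H\<in>\<H>. hyperplane m H \<and> origin m \<in> H)"

text \<open>The hyperplane of \<open>D\<^sup>q\<close> obtained from an equation of \<open>H\<close> in \<open>D\<^sup>b\<close> by replacing the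
  coordinates of copy \<open>i\<close> by those of copy \<open>\<sigma> i\<close>, written without reference to the choice
  of the equation; compare \<open>reindex_equation\<close> below.\<close>

definition reindex ::
    "nat \<Rightarrow> nat \<Rightarrow> (nat \<Rightarrow> nat) \<Rightarrow> (nat \<Rightarrow> real ^ 'd) set \<Rightarrow> (nat \<Rightarrow> real ^ 'd) set" where
  "reindex b q \<sigma> H = {x \<in> copies q. (\<lambda>i\<in>{1..b}. x (\<sigma> i)) \<in> H}"

lemma reindex_equation:
  "reindex b q \<sigma> {x \<in> copies b. (\<Sum>i\<in>{1..b}. a i \<bullet> x i) = c} =
     {x \<in> copies q. (\<Sum>i\<in>{1..b}. a i \<bullet> x (\<sigma> i)) = c}"
  by (simp add: reindex_def copies_def)

definition arrangement_power ::
    "nat \<Rightarrow> (nat \<Rightarrow> real ^ 'd) set set \<Rightarrow> nat \<Rightarrow> (nat \<Rightarrow> real ^ 'd) set set" where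
  "arrangement_power b \<H> q =
     {reindex b q \<sigma> H |\<sigma> H. H \<in> \<H> \<and> inj_on \<sigma> {1..b} \<and> \<sigma> ` {1..b} \<subseteq> {1..q}}"

text \<open>The indices of the copies of \<open>D\<close> whose coordinates actually occur in an equation of
  \<open>H\<close>; compare \<open>involved_copies_equation\<close> below.  For \<open>q < b\<close> there is no injection
  from \<open>{1..b}\<close> to \<open>{1..q}\<close>, so \<open>arrangement_power b \<H> q\<close> is empty; if some \<open>H\<close>
  involves at most \<open>q\<close> copies, the count at such \<open>q\<close> need not fit the sequence of counts
  for \<open>q \<ge> b\<close>, for example if \<open>b = 2\<close> and \<open>H\<close> has the equation \<open>x\<^sub>1 = 0\<close> in \<open>\<real>\<^sup>2\<close>.\<close>

definition involved_copies :: "nat \<Rightarrow> (nat \<Rightarrow> real ^ 'd) set \<Rightarrow> nat set" where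
  "involved_copies b H = {i \<in> {1..b}. \<exists>x\<in>H. \<exists>v. x(i := v) \<notin> H}"

lemma involved_copies_equation:
  fixes a :: "nat \<Rightarrow> real ^ 'd"
  shows "involved_copies b {x \<in> copies b. (\<Sum>i\<in>{1..b}. a i \<bullet> x i) = c} = {i \<in> {1..b}. a i \<noteq> 0}"
    (is "involved_copies b ?H = _")
proof -
  have upd: "(\<Sum>k\<in>{1..b}. a k \<bullet> (x(i := v)) k) = (\<Sum>k\<in>{1..b}. a k \<bullet> x k) + a i \<bullet> (v - x i)"
    if "i \<in> {1..b}" for x v i
  proof -
    have "(\<Sum>k\<in>{1..b} - {i}. a k \<bullet> (x(i := v)) k) = (\<Sum>k\<in>{1..b} - {i}. a k \<bullet> x k)"
      by (rule sum.cong) auto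
    then show ?thesis
      using sum.remove[OF finite_atLeastAtMost that, of "\<lambda>k. a k \<bullet> (x(i := v)) k"]
        sum.remove[OF finite_atLeastAtMost that, of "\<lambda>k. a k \<bullet> x k"]
      by (simp add: inner_diff_right)
  qed
  have mem: "x(i := v) \<in> copies b" if "i \<in> {1..b}" "x \<in> copies b" for i v and x :: "nat \<Rightarrow> real ^ 'd"
    using that by (auto simp: copies_def PiE_iff extensional_def)
  have "\<exists>x\<in>?H. \<exists>v. x(i := v) \<notin> ?H" if i: "i \<in> {1..b}" and ai: "a i \<noteq> 0" for i
  proof -
    let ?x = "(origin b)(i := (c / (a i \<bullet> a i)) *\<^sub>R a i)"
    have o: "origin b \<in> (copies b :: (nat \<Rightarrow> real ^ 'd) set)"
      by (simp add: origin_def copies_def)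
    have x: "?x \<in> ?H"
      unfolding mem_Collect_eq upd[OF i] using i ai mem[OF i o] by (simp add: origin_def)
    have "(\<Sum>k\<in>{1..b}. a k \<bullet> (?x(i := ?x i + a i)) k) = c + a i \<bullet> a i"
      using x upd[OF i, of ?x "?x i + a i"] by (simp only: mem_Collect_eq add_diff_cancel_left')
    then have "?x(i := ?x i + a i) \<notin> ?H"
      using ai by (simp only: mem_Collect_eq) simp
    with x show ?thesis by blast
  qed
  moreover have "a i \<noteq> 0" if "i \<in> {1..b}" "x \<in> ?H" "x(i := v) \<notin> ?H" for i x v
    using that(2,3) mem[OF that(1), of x v] unfolding mem_Collect_eq upd[OF that(1)] by auto
  ultimately show ?thesis
    unfolding involved_copies_def by blast
qed

definition dilate :: "nat \<Rightarrow> nat \<Rightarrow> (nat \<Rightarrow> real ^ 'd) set \<Rightarrow> (nat \<Rightarrow> real ^ 'd) set" where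
  "dilate q n A = (\<lambda>x. \<lambda>i\<in>{1..q}. real n *\<^sub>R x i) ` A"

definition lattice_points :: "nat \<Rightarrow> (nat \<Rightarrow> real ^ 'd) set" where
  "lattice_points q = {x \<in> copies q. \<forall>i\<in>{1..q}. \<forall>j. x i $ j \<in> \<int>}"

definition avoiding_count ::
    "(real ^ 'd) set \<Rightarrow> nat \<Rightarrow> (nat \<Rightarrow> real ^ 'd) set set \<Rightarrow> nat \<Rightarrow> nat \<Rightarrow> nat" where
  "avoiding_count P b \<H> q n =
     card (lattice_points q \<inter>
           (copies_topology q interior_of dilate q n (PiE {1..q} (\<lambda>_. P))) -
           \<Union> (arrangement_power b \<H> q))"

end

theory Submission
  imports Defs
begin

text \<open>Let \<open>E n\<close> be the number of lattice points in the interior of \<open>n P\<close>. The equations of the arrangement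
in \<open>D\<^sup>q\<close> are local: each one involves at most \<open>b\<close> of the \<open>q\<close> copies of \<open>D\<close>. Moebius inversion over
the subsets of \<open>{1..q}\<close>, together with the symmetry under permutations of the copies, therefore
turns the number of avoiding points into
\<open>\<Sum>k\<le>q. (q choose k) * E n ^ (q - k) * A k n\<close>, where \<open>A k n\<close> does not depend on \<open>q\<close>
(\<open>card_avoids_binomial\<close>). It is a sum over \<open>k\<close>-tuples of lattice points of a weight that vanishes
unless every one of the \<open>k\<close> copies occurs in an equation that the tuple satisfies. Such a tuple
satisfies at least \<open>k / b\<close> equations, each of which fixes a coordinate in a copy that the earlier
ones leave free, so that \<open>A k n\<close> is \<open>O(n ^ (d k - k / b))\<close> (\<open>abs_weight_sum_le\<close>).

Both \<open>E\<close> and \<open>A k\<close> are given, for all \<open>n \<ge> 1\<close>, by polynomials in \<open>n\<close> that depend on a residue of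
\<open>n\<close>. They are signed sums of numbers of integer points at height \<open>n\<close> in regions of \<open>(x, n)\<close>-space.
Each region is determined by the signs of finitely many rational homogeneous linear forms and lies
in an open simplicial cone. A form that takes both signs on the generators of a cone is made to have
constant sign by splitting the cone at a point of a two-dimensional face where the form vanishes; in
the end the region is a disjoint union of open simplicial cones (\<open>quasi_polynomial_cone_count\<close>). In an open
simplicial cone whose generators have the same height the points are counted by binomial
coefficients, and because the cone is open these agree with polynomials from height 1 on, not only
for large heights (\<open>quasi_polynomial_card_weighted_compositions\<close>). Rational forms suffice although the
hyperplanes may be irrational: a real linear equation has the same rational solutions as finitely
many rational equations (\<open>rational_decomposition\<close>). The same fact makes the facets of \<open>P\<close> rational.

By a comparison with Riemann sums, \<open>E n / n ^ d\<close> tends to the volume \<open>V\<close> of \<open>P\<close>; hence the leading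
coefficient of \<open>E\<close> is the constant \<open>V\<close>, which is thereby rational. In the variable \<open>y = 1 / n\<close> the
normalised count is \<open>\<Sum>k\<le>q. (q choose k) * A' k * (1 + G) ^ (q - k)\<close>, where \<open>G\<close> is divisible by
\<open>y\<close> and \<open>A' k\<close> by a power of \<open>y\<close> with exponent at least \<open>k / b\<close>. Its coefficient of \<open>y ^ r\<close>
only receives terms with \<open>k \<le> b r\<close>, so it has a period that does not depend on \<open>q\<close>, and the binomial theorem shows
that it is a polynomial in \<open>q\<close> (\<open>two_level_of_binomial_expansion\<close>).

An equation that involves the copies in a set \<open>S\<close> only is reindexed along injections of \<open>S\<close>.
For \<open>q \<ge> b\<close> these are the restrictions of the injections of \<open>{1..b}\<close>, and if \<open>q\<close> is less than
the number of copies in each equation there are none of either kind; this is where the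
restriction on \<open>q\<close> enters.\<close>

section \<open>Quasi-polynomials on the positive integers\<close>

text \<open>Positive arguments only: a count of points of an open region need not fit the polynomials at \<open>0\<close>.
Functions of this kind form an algebra, which is used throughout in place of explicit
coefficients.\<close>

definition quasi_polynomial :: "(nat \<Rightarrow> rat) \<Rightarrow> bool" where
  "quasi_polynomial f \<longleftrightarrow> (\<exists>K>0. \<exists>p. \<forall>n\<ge>1. f n = poly (p (n mod K)) (of_nat n))"

lemma quasi_polynomial_cong:
  assumes "quasi_polynomial f" "\<And>n. n \<ge> 1 \<Longrightarrow> g n = f n"
  shows "quasi_polynomial g"
  using assms unfolding quasi_polynomial_def by metis

lemma quasi_polynomial_const: "quasi_polynomial (\<lambda>n. c)"
  unfolding quasi_polynomial_def by (intro exI[of _ 1] conjI exI[of _ "\<lambda>_. [:c:]"]) auto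

lemma quasi_polynomial_of_nat: "quasi_polynomial of_nat"
  unfolding quasi_polynomial_def by (intro exI[of _ 1] conjI exI[of _ "\<lambda>_. [:0, 1:]"]) auto

lemma quasi_polynomial_indicator_mod:
  assumes "K > 0"
  shows "quasi_polynomial (\<lambda>n. if n mod K = r then 1 else 0)"
  unfolding quasi_polynomial_def using assms
  by (intro exI[of _ K] conjI exI[of _ "\<lambda>s. if s = r then 1 else 0"]) auto

lemma quasi_polynomial_binop:
  assumes "quasi_polynomial f" "quasi_polynomial g"
    and "\<And>p q x. poly (h p q) x = h' (poly p x) (poly q x)"
  shows "quasi_polynomial (\<lambda>n. h' (f n) (g n))"
proof -
  obtain K p where K: "K > 0" "\<forall>n\<ge>1. f n = poly (p (n mod K)) (of_nat n)"
    using assms(1) unfolding quasi_polynomial_def by blast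
  obtain L q where L: "L > 0" "\<forall>n\<ge>1. g n = poly (q (n mod L)) (of_nat n)"
    using assms(2) unfolding quasi_polynomial_def by blast
  show ?thesis
    unfolding quasi_polynomial_def
  proof (intro exI[of _ "K * L"] exI[of _ "\<lambda>r. h (p (r mod K)) (q (r mod L))"] conjI allI impI)
    fix n :: nat assume "1 \<le> n"
    then show "h' (f n) (g n) =
        poly (h (p (n mod (K * L) mod K)) (q (n mod (K * L) mod L))) (of_nat n)"
      using K L assms(3) by (simp add: mod_mod_cancel)
  qed (use K L in auto)
qed

lemma quasi_polynomial_add: "quasi_polynomial f \<Longrightarrow> quasi_polynomial g \<Longrightarrow> quasi_polynomial (\<lambda>n. f n + g n)"
  by (rule quasi_polynomial_binop[where h = "(+)"]) auto

lemma quasi_polynomial_mult: "quasi_polynomial f \<Longrightarrow> quasi_polynomial g \<Longrightarrow> quasi_polynomial (\<lambda>n. f n * g n)"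
  by (rule quasi_polynomial_binop[where h = "(*)"]) auto

lemma quasi_polynomial_sum:
  assumes "\<And>i. i \<in> A \<Longrightarrow> quasi_polynomial (f i)"
  shows "quasi_polynomial (\<lambda>n. \<Sum>i\<in>A. f i n)"
  using assms by (induction A rule: infinite_finite_induct) (auto intro: quasi_polynomial_const quasi_polynomial_add)

lemma quasi_polynomial_prod:
  assumes "\<And>i. i \<in> A \<Longrightarrow> quasi_polynomial (f i)"
  shows "quasi_polynomial (\<lambda>n. \<Prod>i\<in>A. f i n)"
  using assms by (induction A rule: infinite_finite_induct) (auto intro: quasi_polynomial_const quasi_polynomial_mult)

lemma finite_compositions:
  assumes "finite I"
  shows "finite {k \<in> PiE I (\<lambda>_. UNIV::nat set). sum k I = m}"
proof (rule finite_subset)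
  show "{k \<in> PiE I (\<lambda>_. UNIV::nat set). sum k I = m} \<subseteq> PiE I (\<lambda>_. {..m})"
  proof
    fix k assume "k \<in> {k \<in> PiE I (\<lambda>_. UNIV::nat set). sum k I = m}"
    then show "k \<in> PiE I (\<lambda>_. {..m})"
      using assms member_le_sum[of _ I k] by (auto simp: PiE_iff)
  qed
  show "finite (PiE I (\<lambda>_. {..m}))"
    using assms by (intro finite_PiE) auto
qed

lemma card_compositions:
  assumes "finite I"
  shows "card {k \<in> PiE I (\<lambda>_. UNIV::nat set). sum k I = m} = (m + card I - 1) choose m"
proof -
  obtain xs where xs: "set xs = I" "distinct xs" using finite_distinct_list[OF assms] by blast
  have len: "length xs = card I" using distinct_card[OF xs(2)] xs(1) by simp
  let ?S = "{k \<in> PiE I (\<lambda>_. UNIV::nat set). sum k I = m}"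
  let ?L = "{l :: nat list. size l = card I \<and> sum_list l = m}"
  have "bij_betw (\<lambda>k. map k xs) ?S ?L"
  proof (rule bij_betw_imageI)
    show "inj_on (\<lambda>k. map k xs) ?S"
      using xs(1) by (intro inj_onI PiE_ext[of _ I "\<lambda>_. UNIV"]) auto
    show "(\<lambda>k. map k xs) ` ?S = ?L"
    proof (intro equalityI subsetI)
      fix l assume "l \<in> (\<lambda>k. map k xs) ` ?S"
      then show "l \<in> ?L" using len xs by (auto simp: sum_list_distinct_conv_sum_set)
    next
      fix l assume l: "l \<in> ?L"
      define k where "k = (\<lambda>i\<in>I. the (map_of (zip xs l) i))"
      have lk: "map k xs = l"
        using l len xs unfolding k_def by (intro nth_equalityI) (auto simp: map_of_zip_nth)
      have "sum k I = sum_list (map k xs)" using xs by (simp add: sum_list_distinct_conv_sum_set)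
      then have "sum k I = m" using l unfolding lk by simp
      then have "k \<in> ?S" unfolding k_def by simp
      then show "l \<in> (\<lambda>k. map k xs) ` ?S" using lk by force
    qed
  qed
  then have "card ?S = card ?L" by (rule bij_betw_same_card)
  then show ?thesis by (simp add: card_length_sum_list)
qed

text \<open>The count is \<open>j choose (card I - 1)\<close>, with \<open>n = w + K * (j - (card I - 1))\<close>. The bound
\<open>w \<le> K * card I\<close> makes \<open>j\<close> nonnegative for every \<open>n \<ge> 1\<close> in the residue class of \<open>w\<close>, and for
\<open>j < card I - 1\<close> both the count and the binomial coefficient are zero. This is why the formula is
valid from \<open>n = 1\<close> on.\<close>

lemma quasi_polynomial_card_weighted_compositions:
  assumes I: "finite I" "I \<noteq> {}" and K: "K > 0" and w: "0 < w" "w \<le> K * card I"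
  shows "quasi_polynomial (\<lambda>n. of_nat (card {k \<in> PiE I (\<lambda>_. UNIV::nat set). K * sum k I + w = n}))"
proof -
  let ?c = "card I"
  let ?S = "\<lambda>n. {k \<in> PiE I (\<lambda>_. UNIV::nat set). K * sum k I + w = n}"
  define x :: "nat \<Rightarrow> rat" where "x n = (of_nat n - of_nat w) * (1 / of_nat K) + of_nat (?c - 1)" for n :: nat
  define G :: "nat \<Rightarrow> rat" where
    "G n = (if n mod K = w mod K then 1 else 0) *
       ((\<Prod>l\<in>{0..<?c - 1}. x n + (- of_nat l)) * (1 / fact (?c - 1)))" for n
  have c: "?c \<ge> 1" using I by (auto simp: card_gt_0_iff Suc_leI)
  have q: "quasi_polynomial x"
    unfolding x_def diff_conv_add_uminus
    by (intro quasi_polynomial_add quasi_polynomial_mult quasi_polynomial_const quasi_polynomial_of_nat)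
  have "quasi_polynomial G"
    unfolding G_def
    by (intro quasi_polynomial_mult quasi_polynomial_prod quasi_polynomial_const quasi_polynomial_add quasi_polynomial_indicator_mod K q)
  moreover have "of_nat (card (?S n)) = G n" if n1: "n \<ge> 1" for n
  proof (cases "n mod K = w mod K")
    case False
    then have "?S n = {}" by auto
    with False show ?thesis unfolding G_def by (simp only: card.empty) simp
  next
    case True
    obtain j where j: "n + K * (?c - 1) = w + K * j"
    proof -
      have le: "w \<le> n + K * (?c - 1)"
      proof (rule ccontr)
        assume "\<not> ?thesis"
        then have lt: "n + K * (?c - 1) < w" by simp
        have "(n + K * (?c - 1)) mod K = w mod K" using True by simp
        then have "K dvd w - (n + K * (?c - 1))" using lt
          by (metis less_imp_le_nat mod_eq_dvd_iff_nat)
        then have "K \<le> w - (n + K * (?c - 1))" using lt by (intro dvd_imp_le) auto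
        moreover have "K * ?c = K + K * (?c - 1)" using c by (cases ?c) auto
        ultimately show False using w n1 lt by linarith
      qed
      have "K dvd (n + K * (?c - 1)) - w" using True le
        by (metis mod_eq_dvd_iff_nat mod_mult_self2)
      then show ?thesis using le that by (metis dvd_def le_add_diff_inverse)
    qed
    have xj: "x n = of_nat j"
    proof -
      have "(of_nat (n + K * (?c - 1)) :: rat) = of_nat (w + K * j)" using j by simp
      then show ?thesis using K c unfolding x_def by (simp add: field_simps)
    qed
    have Gj: "G n = of_nat (j choose (?c - 1))"
      using True unfolding G_def xj binomial_gbinomial gbinomial_prod_rev by simp
    show ?thesis
    proof (cases "j \<ge> ?c - 1")
      case True
      have "?S n = {k \<in> PiE I (\<lambda>_. UNIV::nat set). sum k I = j - (?c - 1)}"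
      proof -
        obtain i where i: "j = (?c - 1) + i" using True le_Suc_ex by blast
        have "n = K * (j - (?c - 1)) + w"
          using j unfolding i distrib_left by simp
        then show ?thesis using K by auto
      qed
      then show ?thesis unfolding Gj
        using card_compositions[OF I(1), of "j - (?c - 1)"] binomial_symmetric[OF True] True c by simp
    next
      case False
      have "?S n = {}"
      proof (rule equals0I)
        fix k assume "k \<in> ?S n"
        then have "w + K * (sum k I + (?c - 1)) = w + K * j" using j by (simp add: algebra_simps)
        then have "sum k I + (?c - 1) = j" using K by simp
        with False show False by simp
      qed
      then show ?thesis unfolding Gj using False by (simp only: card.empty) simp
    qed
  qed
  ultimately show ?thesis by (rule quasi_polynomial_cong)
qed

section \<open>Rational open simplicial cones\<close>

definition lincomb :: "'b set \<Rightarrow> ('b \<Rightarrow> rat) \<Rightarrow> ('b \<Rightarrow> 'a \<Rightarrow> rat) \<Rightarrow> 'a \<Rightarrow> rat" where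
  "lincomb I t u = (\<lambda>k. \<Sum>i\<in>I. t i * u i k)"

text \<open>Open in its own linear span: all coefficients are positive. Together with independence of the
generators this makes disjoint decompositions exact, without inclusion-exclusion along faces.\<close>

definition open_cone :: "'b set \<Rightarrow> ('b \<Rightarrow> 'a \<Rightarrow> rat) \<Rightarrow> ('a \<Rightarrow> rat) set" where
  "open_cone I u = {lincomb I t u |t. \<forall>i\<in>I. t i > 0}"

definition independent_family :: "'b set \<Rightarrow> ('b \<Rightarrow> 'a \<Rightarrow> rat) \<Rightarrow> bool" where
  "independent_family I u \<longleftrightarrow> (\<forall>t. lincomb I t u = (\<lambda>_. 0) \<longrightarrow> (\<forall>i\<in>I. t i = 0))"

definition integral_vec :: "('a \<Rightarrow> rat) \<Rightarrow> bool" where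
  "integral_vec x \<longleftrightarrow> (\<forall>k. x k \<in> \<int>)"

definition dot :: "'a set \<Rightarrow> ('a \<Rightarrow> rat) \<Rightarrow> ('a \<Rightarrow> rat) \<Rightarrow> rat" where
  "dot J c x = (\<Sum>k\<in>J. c k * x k)"

lemma lincomb_cong: "(\<And>i. i \<in> I \<Longrightarrow> t i = t' i) \<Longrightarrow> lincomb I t u = lincomb I t' u"
  unfolding lincomb_def by (intro ext sum.cong) auto

lemma lincomb_independent_eqD:
  assumes "independent_family I u" "lincomb I t u = lincomb I t' u" "i \<in> I"
  shows "t i = t' i"
proof -
  have "lincomb I (\<lambda>i. t i - t' i) u = (\<lambda>_. 0)"
    using fun_cong[OF assms(2)] unfolding lincomb_def
    by (simp add: left_diff_distrib sum_subtractf)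
  then show ?thesis using assms(1,3) unfolding independent_family_def by fastforce
qed

lemma dot_lincomb: "dot J c (lincomb I t u) = (\<Sum>i\<in>I. t i * dot J c (u i))"
proof -
  have "dot J c (lincomb I t u) = (\<Sum>k\<in>J. \<Sum>i\<in>I. t i * (c k * u i k))"
    unfolding dot_def lincomb_def sum_distrib_left by (intro sum.cong refl) (simp add: mult_ac)
  also have "\<dots> = (\<Sum>i\<in>I. \<Sum>k\<in>J. t i * (c k * u i k))" by (rule sum.swap)
  finally show ?thesis unfolding dot_def sum_distrib_left .
qed

lemma finite_integral_vecs_bounded:
  fixes B :: "'a \<Rightarrow> rat"
  assumes "finite J"
  shows "finite {x. integral_vec x \<and> (\<forall>k. k \<notin> J \<longrightarrow> x k = 0) \<and> (\<forall>k\<in>J. \<bar>x k\<bar> \<le> B k)}"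
proof (rule finite_subset)
  define M where "M = (\<Sum>k\<in>J. \<bar>\<lceil>B k\<rceil>\<bar>)"
  let ?A = "of_int ` {-M..M} :: rat set"
  show "{x. integral_vec x \<and> (\<forall>k. k \<notin> J \<longrightarrow> x k = 0) \<and> (\<forall>k\<in>J. \<bar>x k\<bar> \<le> B k)}
      \<subseteq> {x. \<forall>k. (k \<in> J \<longrightarrow> x k \<in> ?A) \<and> (k \<notin> J \<longrightarrow> x k = 0)}"
  proof (intro subsetI CollectI allI conjI impI)
    fix x k assume x: "x \<in> {x. integral_vec x \<and> (\<forall>k. k \<notin> J \<longrightarrow> x k = 0) \<and> (\<forall>k\<in>J. \<bar>x k\<bar> \<le> B k)}"
      and k: "k \<in> J"
    obtain m where m: "x k = of_int m"
      using x unfolding integral_vec_def by (blast elim: Ints_cases)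
    have "\<bar>x k\<bar> \<le> B k" using x k by auto
    then have "of_int \<bar>m\<bar> \<le> B k" using m by simp
    also have "B k \<le> of_int \<lceil>B k\<rceil>" by simp
    also have "of_int \<lceil>B k\<rceil> \<le> (of_int M :: rat)"
      unfolding M_def of_int_le_iff using assms k member_le_sum[of k J "\<lambda>k. \<bar>\<lceil>B k\<rceil>\<bar>"] by simp
    finally have "\<bar>m\<bar> \<le> M" by linarith
    then show "x k \<in> ?A" using m by (intro image_eqI[of _ _ m]) auto
  qed auto
  show "finite {x. \<forall>k. (k \<in> J \<longrightarrow> x k \<in> ?A) \<and> (k \<notin> J \<longrightarrow> x k = 0)}"
    using assms by (intro finite_set_of_finite_funs) auto
qed

lemma common_denominator:
  assumes "finite (A :: rat set)"
  obtains D :: nat where "D > 0" "\<And>a. a \<in> A \<Longrightarrow> of_nat D * a \<in> \<int>"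
proof -
  have "\<exists>D::nat. D > 0 \<and> (\<forall>a\<in>A. of_nat D * a \<in> \<int>)"
    using assms
  proof (induction A)
    case empty
    then show ?case by auto
  next
    case (insert r A)
    then obtain D :: nat where D: "D > 0" "\<forall>a\<in>A. of_nat D * a \<in> \<int>" by blast
    obtain p q where q: "q > 0" "r = of_int p / of_int q"
      by (metis quotient_of_denom_pos quotient_of_div surj_pair)
    have r: "of_int q * r \<in> \<int>" using q by simp
    have "of_nat (D * nat q) * a \<in> \<int>" if "a \<in> insert r A" for a
    proof (cases "a = r")
      case True
      have "of_nat (D * nat q) * a = of_nat D * (of_int q * r)" using q True by simp
      also have "\<dots> \<in> \<int>" by (intro Ints_mult r) auto
      finally show ?thesis .
    next
      case False
      have "of_nat (D * nat q) * a = of_nat (nat q) * (of_nat D * a)" by simp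
      also have "\<dots> \<in> \<int>" using False that D(2) by (intro Ints_mult[OF Ints_of_nat, of "of_nat D * a" "nat q"]) blast
      finally show ?thesis .
    qed
    then show ?case using D q by (intro exI[of _ "D * nat q"]) auto
  qed
  then show ?thesis using that by blast
qed

lemma open_cone_scale:
  assumes "\<And>i. i \<in> I \<Longrightarrow> s i > 0"
  shows "open_cone I (\<lambda>i k. s i * u i k) = open_cone I u"
proof (intro equalityI subsetI)
  fix x assume "x \<in> open_cone I (\<lambda>i k. s i * u i k)"
  then obtain t where t: "\<forall>i\<in>I. t i > 0" "x = lincomb I t (\<lambda>i k. s i * u i k)"
    unfolding open_cone_def by blast
  have "x = lincomb I (\<lambda>i. t i * s i) u" unfolding t(2) lincomb_def by (simp add: mult_ac)
  then show "x \<in> open_cone I u" using t(1) assms unfolding open_cone_def by auto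
next
  fix x assume "x \<in> open_cone I u"
  then obtain t where t: "\<forall>i\<in>I. t i > 0" "x = lincomb I t u"
    unfolding open_cone_def by blast
  have "x = lincomb I (\<lambda>i. t i / s i) (\<lambda>i k. s i * u i k)"
    unfolding t(2) lincomb_def using assms by (intro ext sum.cong) (auto simp: less_imp_neq[symmetric] less_imp_neq)
  then show "x \<in> open_cone I (\<lambda>i k. s i * u i k)" using t(1) assms unfolding open_cone_def by auto
qed

lemma independent_family_scale:
  assumes "independent_family I u" "\<And>i. i \<in> I \<Longrightarrow> s i > 0"
  shows "independent_family I (\<lambda>i k. s i * u i k)"
  unfolding independent_family_def
proof (intro allI impI ballI)
  fix t i assume t: "lincomb I t (\<lambda>i k. s i * u i k) = (\<lambda>_. 0)" and i: "i \<in> I"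
  have "lincomb I (\<lambda>i. t i * s i) u = (\<lambda>_. 0)" using t unfolding lincomb_def by (simp add: mult_ac)
  then have "t i * s i = 0" using assms(1) i unfolding independent_family_def by blast
  then show "t i = 0" using assms(2)[OF i] by simp
qed

text \<open>A cone only depends on the rays of its generators. Clearing denominators first and multiplying the
\<open>i\<close>-th generator by the product of the other heights afterwards equalises the heights.\<close>

lemma scale_to_common_height:
  fixes u :: "'b \<Rightarrow> 'a \<Rightarrow> rat"
  assumes "finite I" "finite J" "\<And>i k. i \<in> I \<Longrightarrow> k \<notin> J \<Longrightarrow> u i k = 0" "\<And>i. i \<in> I \<Longrightarrow> u i z > 0"
  obtains s and K :: nat where "K > 0" "\<And>i. i \<in> I \<Longrightarrow> s i > 0"
    "\<And>i k. i \<in> I \<Longrightarrow> s i * u i k \<in> \<int>" "\<And>i. i \<in> I \<Longrightarrow> s i * u i z = of_nat K"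
proof -
  obtain D :: nat where D: "D > 0" "\<And>a. a \<in> (\<lambda>(i, k). u i k) ` (I \<times> insert z J) \<Longrightarrow> of_nat D * a \<in> \<int>"
    using common_denominator[of "(\<lambda>(i, k). u i k) ` (I \<times> insert z J)"] assms by auto
  have Du: "of_nat D * u i k \<in> \<int>" if "i \<in> I" for i k
    using D(2)[of "u i k"] assms(3)[of i k] that by (cases "k \<in> J") force+
  define H where "H i = nat \<lfloor>of_nat D * u i z\<rfloor>" for i
  have H: "of_nat D * u i z = of_nat (H i)" "H i > 0" if i: "i \<in> I" for i
  proof -
    have "of_nat D * u i z > 0" using D assms i by simp
    moreover obtain m where "of_nat D * u i z = of_int m" using Du[OF i] by (blast elim: Ints_cases)
    ultimately show "of_nat D * u i z = of_nat (H i)" "H i > 0" unfolding H_def by auto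
  qed
  \<comment> \<open>The height of the \<open>i\<close>-th generator becomes the product of all heights.\<close>
  define s :: "'b \<Rightarrow> rat" where "s i = of_nat (\<Prod>j\<in>I - {i}. H j) * of_nat D" for i
  show thesis
  proof (rule that[of "\<Prod>i\<in>I. H i" s])
    show "prod H I > 0" using H by (auto intro: prod_pos)
    fix i assume i: "i \<in> I"
    show "s i > 0" unfolding s_def using D H by (auto intro!: mult_pos_pos prod_pos)
    show "s i * u i k \<in> \<int>" for k
      unfolding s_def mult.assoc by (intro Ints_mult Du i) auto
    show "s i * u i z = of_nat (prod H I)"
      unfolding s_def mult.assoc H(1)[OF i] using assms(1) i by (simp add: prod.remove mult.commute)
  qed
qed

text \<open>Every integer point of the cone is, in exactly one way, a point of the half-open box with coefficients
in \<open>(0, 1]\<close> plus a natural combination of the generators. For each of the finitely many integer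
points \<open>\<pi>\<close> of the box this leaves a composition count with offset \<open>w \<pi> = \<pi> z\<close>. The intervals are
closed on the right because the cone is open; this gives \<open>0 < w \<pi> \<le> K * card I\<close>.\<close>

lemma quasi_polynomial_simplicial_cone_integral:
  fixes u :: "'b \<Rightarrow> 'a \<Rightarrow> rat"
  assumes I: "finite I" "I \<noteq> {}" and J: "finite J" and ind: "independent_family I u"
    and supp: "\<And>i k. i \<in> I \<Longrightarrow> k \<notin> J \<Longrightarrow> u i k = 0"
    and int: "\<And>i k. i \<in> I \<Longrightarrow> u i k \<in> \<int>"
    and K: "K > 0" and height: "\<And>i. i \<in> I \<Longrightarrow> u i z = of_nat K"
  shows "quasi_polynomial (\<lambda>n. of_nat (card {x \<in> open_cone I u. integral_vec x \<and> x z = of_nat n}))"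
proof -
  define Box where "Box = {lincomb I \<tau> u |\<tau>. (\<forall>i\<in>I. 0 < \<tau> i \<and> \<tau> i \<le> 1) \<and> integral_vec (lincomb I \<tau> u)}"
  define w where "w \<pi> = nat \<lfloor>\<pi> z\<rfloor>" for \<pi> :: "'a \<Rightarrow> rat"
  define C where "C \<pi> n = {k \<in> PiE I (\<lambda>_. UNIV::nat set). K * sum k I + w \<pi> = n}" for \<pi> n
  define h where "h = (\<lambda>(\<pi>, k::'b \<Rightarrow> nat). (\<lambda>j. \<pi> j + lincomb I (\<lambda>i. of_nat (k i)) u j))"
  let ?S = "\<lambda>n. {x \<in> open_cone I u. integral_vec x \<and> x z = of_nat n}"
  have lz: "lincomb I t u z = of_nat K * sum t I" for t
    unfolding lincomb_def sum_distrib_left using height by (intro sum.cong) auto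
  have fin: "finite Box"
  proof (rule finite_subset[OF _ finite_integral_vecs_bounded[OF J]])
    show "Box \<subseteq> {x. integral_vec x \<and> (\<forall>k. k \<notin> J \<longrightarrow> x k = 0) \<and> (\<forall>k\<in>J. \<bar>x k\<bar> \<le> (\<Sum>i\<in>I. \<bar>u i k\<bar>))}"
    proof (intro subsetI CollectI conjI allI ballI impI)
      fix x assume "x \<in> Box"
      then obtain \<tau> where \<tau>: "\<forall>i\<in>I. 0 < \<tau> i \<and> \<tau> i \<le> 1" "integral_vec x" "x = lincomb I \<tau> u"
        unfolding Box_def by blast
      show "integral_vec x" by fact
      fix k
      show "x k = 0" if "k \<notin> J" using \<tau> supp that unfolding lincomb_def by simp
      have "\<bar>x k\<bar> \<le> (\<Sum>i\<in>I. \<bar>\<tau> i * u i k\<bar>)" unfolding \<tau>(3) lincomb_def by (rule sum_abs)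
      also have "\<dots> \<le> (\<Sum>i\<in>I. \<bar>u i k\<bar>)"
      proof (rule sum_mono)
        fix i assume "i \<in> I"
        then have "\<bar>\<tau> i\<bar> \<le> 1" using \<tau> by auto
        then show "\<bar>\<tau> i * u i k\<bar> \<le> \<bar>u i k\<bar>" unfolding abs_mult by (intro mult_left_le_one_le) auto
      qed
      finally show "\<bar>x k\<bar> \<le> (\<Sum>i\<in>I. \<bar>u i k\<bar>)" .
    qed
  qed
  have w: "\<pi> z = of_nat (w \<pi>) \<and> 0 < w \<pi> \<and> w \<pi> \<le> K * card I" if pi: "\<pi> \<in> Box" for \<pi>
  proof -
    obtain \<tau> where \<tau>: "\<forall>i\<in>I. 0 < \<tau> i \<and> \<tau> i \<le> 1" "integral_vec \<pi>" "\<pi> = lincomb I \<tau> u"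
      using pi unfolding Box_def by blast
    obtain m where m: "\<pi> z = of_int m" using \<tau>(2) unfolding integral_vec_def by (blast elim: Ints_cases)
    have "sum \<tau> I > 0" using \<tau> I by (intro sum_pos) auto
    then have "\<pi> z > 0" using K unfolding \<tau>(3) lz by simp
    then have mp: "m > 0" using m by simp
    have "sum \<tau> I \<le> of_nat (card I) * 1" using \<tau> by (intro sum_bounded_above) auto
    then have "\<pi> z \<le> of_nat K * of_nat (card I)" unfolding \<tau>(3) lz by (intro mult_left_mono) auto
    also have "\<dots> = of_int (int (K * card I))" by simp
    finally have "m \<le> int (K * card I)" unfolding m of_int_le_iff .
    then show ?thesis unfolding w_def m using mp by (auto simp: nat_le_iff)
  qed
  have addl: "h (lincomb I \<tau> u, k) = lincomb I (\<lambda>i. \<tau> i + of_nat (k i)) u" for \<tau> k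
    unfolding h_def lincomb_def by (simp add: algebra_simps sum.distrib)
  have "bij_betw h (SIGMA \<pi>:Box. C \<pi> n) (?S n)" for n
    unfolding bij_betw_def
  proof (intro conjI equalityI subsetI)
    show "inj_on h (SIGMA \<pi>:Box. C \<pi> n)"
    proof (rule inj_onI)
      fix p p' assume p: "p \<in> (SIGMA \<pi>:Box. C \<pi> n)" "p' \<in> (SIGMA \<pi>:Box. C \<pi> n)" "h p = h p'"
      obtain \<tau> k where \<tau>: "\<forall>i\<in>I. 0 < \<tau> i \<and> \<tau> i \<le> 1" "p = (lincomb I \<tau> u, k)" "k \<in> PiE I (\<lambda>_. UNIV)"
        using p(1) unfolding Box_def C_def by blast
      obtain \<tau>' k' where \<tau>': "\<forall>i\<in>I. 0 < \<tau>' i \<and> \<tau>' i \<le> 1" "p' = (lincomb I \<tau>' u, k')" "k' \<in> PiE I (\<lambda>_. UNIV)"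
        using p(2) unfolding Box_def C_def by blast
      have eq: "\<tau> i + of_nat (k i) = \<tau>' i + of_nat (k' i)" if "i \<in> I" for i
        using lincomb_independent_eqD[OF ind p(3)[unfolded \<tau>(2) \<tau>'(2) addl] that] .
      have kk: "k i = k' i" if i: "i \<in> I" for i
      proof -
        have "(of_nat (k i) :: rat) < of_nat (k' i + 1)" "(of_nat (k' i) :: rat) < of_nat (k i + 1)"
          using eq[OF i] bspec[OF \<tau>(1) i] bspec[OF \<tau>'(1) i] unfolding of_nat_add of_nat_1 by linarith+
        then show ?thesis unfolding of_nat_less_iff by simp
      qed
      have "k = k'" using kk \<tau>(3) \<tau>'(3) by (intro PiE_ext) auto
      moreover have "lincomb I \<tau> u = lincomb I \<tau>' u"
      proof (rule lincomb_cong)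
        fix i assume i: "i \<in> I"
        show "\<tau> i = \<tau>' i" using eq[OF i] unfolding kk[OF i] by (rule add_right_imp_eq)
      qed
      ultimately show "p = p'" unfolding \<tau>(2) \<tau>'(2) by simp
    qed
  next
    fix x assume "x \<in> h ` (SIGMA \<pi>:Box. C \<pi> n)"
    then obtain \<pi> k where p: "\<pi> \<in> Box" "k \<in> C \<pi> n" "x = h (\<pi>, k)" by blast
    obtain \<tau> where \<tau>: "\<forall>i\<in>I. 0 < \<tau> i \<and> \<tau> i \<le> 1" "\<pi> = lincomb I \<tau> u" "integral_vec \<pi>"
      using p(1) unfolding Box_def by blast
    have x: "x = lincomb I (\<lambda>i. \<tau> i + of_nat (k i)) u" using p(3) \<tau>(2) addl by simp
    have "\<forall>i\<in>I. \<tau> i + of_nat (k i) > 0" using \<tau>(1) by (intro ballI add_pos_nonneg) auto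
    then have "x \<in> open_cone I u" unfolding open_cone_def x by blast
    moreover have "integral_vec x"
      unfolding integral_vec_def p(3) h_def prod.case lincomb_def
      using \<tau>(3) int unfolding integral_vec_def
      by (intro allI Ints_add Ints_sum Ints_mult Ints_of_nat) auto
    moreover have "x z = of_nat n"
    proof -
      have "x z = \<pi> z + lincomb I (\<lambda>i. of_nat (k i)) u z" unfolding p(3) h_def by simp
      also have "\<dots> = of_nat (K * sum k I + w \<pi>)" unfolding lz using w[OF p(1)] by simp
      also have "\<dots> = of_nat n" using p(2) unfolding C_def by simp
      finally show ?thesis .
    qed
    ultimately show "x \<in> ?S n" by simp
  next
    fix x assume x: "x \<in> ?S n"
    then obtain t where t: "\<forall>i\<in>I. t i > 0" "x = lincomb I t u" unfolding open_cone_def by blast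
    \<comment> \<open>Rounding this way leaves a remainder in \<open>(0, 1]\<close>.\<close>
    define k where "k = (\<lambda>i\<in>I. nat (\<lceil>t i\<rceil> - 1))"
    define \<tau> where "\<tau> i = t i - of_nat (k i)" for i
    have kt: "of_nat (k i) = of_int \<lceil>t i\<rceil> - (1::rat)" if "i \<in> I" for i
    proof -
      have "\<lceil>t i\<rceil> \<ge> 1" using t(1) that by (simp add: Suc_leI less_ceiling_iff)
      then show ?thesis unfolding k_def using that by (simp add: of_nat_nat)
    qed
    have \<tau>: "\<forall>i\<in>I. 0 < \<tau> i \<and> \<tau> i \<le> 1"
    proof
      fix i assume i: "i \<in> I"
      show "0 < \<tau> i \<and> \<tau> i \<le> 1" unfolding \<tau>_def kt[OF i] by linarith
    qed
    have xh: "x = h (lincomb I \<tau> u, k)" unfolding addl \<tau>_def t(2) by simp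
    have "lincomb I \<tau> u = (\<lambda>j. x j - lincomb I (\<lambda>i. of_nat (k i)) u j)" unfolding xh h_def by auto
    moreover have "integral_vec (\<lambda>j. x j - lincomb I (\<lambda>i. of_nat (k i)) u j)"
      using x int unfolding integral_vec_def lincomb_def
      by (intro allI Ints_diff Ints_sum Ints_mult Ints_of_nat) auto
    ultimately have "integral_vec (lincomb I \<tau> u)" by simp
    then have B: "lincomb I \<tau> u \<in> Box" using \<tau> unfolding Box_def by blast
    have "(of_nat (K * sum k I + w (lincomb I \<tau> u)) :: rat) = x z"
      unfolding xh h_def using w[OF B] lz[of "\<lambda>i. of_nat (k i)"] by simp
    also have "x z = of_nat n" using x by simp
    finally have "K * sum k I + w (lincomb I \<tau> u) = n" unfolding of_nat_eq_iff .
    moreover have "k \<in> PiE I (\<lambda>_. UNIV)" unfolding k_def by simp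
    ultimately have "k \<in> C (lincomb I \<tau> u) n" unfolding C_def by blast
    with B xh show "x \<in> h ` (SIGMA \<pi>:Box. C \<pi> n)" by blast
  qed
  then have card: "card (?S n) = card (SIGMA \<pi>:Box. C \<pi> n)" for n
    by (rule bij_betw_same_card[symmetric])
  have finC: "finite (C \<pi> n)" for \<pi> n
  proof (rule finite_subset[OF _ finite_UN_I])
    show "C \<pi> n \<subseteq> (\<Union>m\<in>{..n}. {k \<in> PiE I (\<lambda>_. UNIV::nat set). sum k I = m})"
    proof
      fix k assume k: "k \<in> C \<pi> n"
      have "sum k I \<le> K * sum k I" using K by simp
      moreover have "K * sum k I + w \<pi> = n" using k unfolding C_def by blast
      ultimately have "sum k I \<le> n" by linarith
      then show "k \<in> (\<Union>m\<in>{..n}. {k \<in> PiE I (\<lambda>_. UNIV::nat set). sum k I = m})"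
        using k unfolding C_def by auto
    qed
    show "finite {k \<in> PiE I (\<lambda>_. UNIV::nat set). sum k I = m}" for m
      using finite_compositions[OF I(1)] .
  qed simp
  have "quasi_polynomial (\<lambda>n. \<Sum>\<pi>\<in>Box. of_nat (card (C \<pi> n)))"
    unfolding C_def using w by (intro quasi_polynomial_sum quasi_polynomial_card_weighted_compositions I K) blast+
  moreover have "of_nat (card (?S n)) = (\<Sum>\<pi>\<in>Box. of_nat (card (C \<pi> n)) :: rat)" for n
    unfolding card using card_SigmaI[OF fin, of "\<lambda>\<pi>. C \<pi> n"] finC by simp
  ultimately show ?thesis by (rule quasi_polynomial_cong)
qed

lemma quasi_polynomial_simplicial_cone:
  fixes u :: "'b \<Rightarrow> 'a \<Rightarrow> rat"
  assumes I: "finite I" and J: "finite J" and ind: "independent_family I u"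
    and supp: "\<And>i k. i \<in> I \<Longrightarrow> k \<notin> J \<Longrightarrow> u i k = 0"
    and height: "\<And>i. i \<in> I \<Longrightarrow> u i z > 0"
  shows "quasi_polynomial (\<lambda>n. of_nat (card {x \<in> open_cone I u. integral_vec x \<and> x z = of_nat n}))"
proof (cases "I = {}")
  case True
  have "{x \<in> open_cone I u. integral_vec x \<and> x z = of_nat n} = {}" if "n \<ge> 1" for n
    using True that by (auto simp: open_cone_def lincomb_def)
  then have "of_nat (card {x \<in> open_cone I u. integral_vec x \<and> x z = of_nat n}) = (0::rat)"
    if "n \<ge> 1" for n using that by (simp only: card.empty of_nat_0)
  then show ?thesis by (rule quasi_polynomial_cong[OF quasi_polynomial_const])
next
  case False
  obtain s and K :: nat where s: "K > 0" "\<And>i. i \<in> I \<Longrightarrow> s i > 0"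
    "\<And>i k. i \<in> I \<Longrightarrow> s i * u i k \<in> \<int>" "\<And>i. i \<in> I \<Longrightarrow> s i * u i z = of_nat K"
    by (rule scale_to_common_height[where I = I and J = J and u = u and z = z])
      (use I J supp height in auto)
  have cone: "open_cone I (\<lambda>i k. s i * u i k) = open_cone I u"
    by (rule open_cone_scale) (rule s(2))
  have "quasi_polynomial (\<lambda>n. of_nat (card {x \<in> open_cone I (\<lambda>i k. s i * u i k). integral_vec x \<and> x z = of_nat n}))"
  proof (rule quasi_polynomial_simplicial_cone_integral[where J = J and K = K])
    show "independent_family I (\<lambda>i k. s i * u i k)"
      by (rule independent_family_scale[OF ind s(2)])
    show "s i * u i k = 0" if "i \<in> I" "k \<notin> J" for i k using supp[OF that] by simp
  qed (use I False J s in auto)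
  then show ?thesis unfolding cone .
qed

section \<open>Subdividing cones by linear forms\<close>

lemma lincomb_remove_two:
  assumes "finite I" "a \<in> I" "b \<in> I" "a \<noteq> b"
  shows "lincomb I t u = (\<lambda>k. t a * u a k + t b * u b k + lincomb (I - {a, b}) t u k)"
proof
  fix k
  have "I - {a} - {b} = I - {a, b}" by auto
  then show "lincomb I t u k = t a * u a k + t b * u b k + lincomb (I - {a, b}) t u k"
    using assms unfolding lincomb_def
    by (simp add: sum.remove[of I a] sum.remove[of "I - {a}" b])
qed

lemma lincomb_replace:
  assumes I: "finite I" "a \<in> I" "b \<in> I" "a \<noteq> b"
    and w: "w = (\<lambda>k. \<alpha> * u b k + \<beta> * u a k)"
  shows "lincomb I t (u(b := w)) = lincomb I (t(b := \<alpha> * t b, a := t a + \<beta> * t b)) u"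
    and "lincomb I t (u(a := w)) = lincomb I (t(a := \<beta> * t a, b := t b + \<alpha> * t a)) u"
    and "lincomb (I - {b}) t (u(a := w)) = lincomb I (t(a := \<beta> * t a, b := \<alpha> * t a)) u"
proof -
  have rest: "lincomb (I - {a, b}) t' (u'(a := v)) = lincomb (I - {a, b}) t' u'"
    "lincomb (I - {a, b}) t' (u'(b := v)) = lincomb (I - {a, b}) t' u'"
    "lincomb (I - {a, b}) (t'(a := y)) u' = lincomb (I - {a, b}) t' u'"
    "lincomb (I - {a, b}) (t'(b := y)) u' = lincomb (I - {a, b}) t' u'" for t' u' v y
    unfolding lincomb_def by (intro ext sum.cong; simp)+
  show "lincomb I t (u(b := w)) = lincomb I (t(b := \<alpha> * t b, a := t a + \<beta> * t b)) u"
    unfolding lincomb_remove_two[OF I] rest w using I(4) by (intro ext) (simp add: algebra_simps)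
  show "lincomb I t (u(a := w)) = lincomb I (t(a := \<beta> * t a, b := t b + \<alpha> * t a)) u"
    unfolding lincomb_remove_two[OF I] rest w using I(4) by (intro ext) (simp add: algebra_simps)
  have "lincomb (I - {b}) t (u(a := w)) = (\<lambda>k. t a * w k + lincomb (I - {a, b}) t u k)"
  proof
    fix k
    have "I - {b} - {a} = I - {a, b}" by auto
    then have "lincomb (I - {b}) t (u(a := w)) k = t a * w k + lincomb (I - {a, b}) t (u(a := w)) k"
      using I unfolding lincomb_def by (simp add: sum.remove[of "I - {b}" a])
    then show "lincomb (I - {b}) t (u(a := w)) k = t a * w k + lincomb (I - {a, b}) t u k"
      by (simp add: rest)
  qed
  then show "lincomb (I - {b}) t (u(a := w)) = lincomb I (t(a := \<beta> * t a, b := \<alpha> * t a)) u"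
    unfolding lincomb_remove_two[OF I, of "t(a := \<beta> * t a, b := \<alpha> * t a)"] rest w
    using I(4) by (simp add: fun_eq_iff algebra_simps)
qed

lemma open_cone_replace:
  assumes I: "finite I" "a \<in> I" "b \<in> I" "a \<noteq> b"
    and w: "w = (\<lambda>k. \<alpha> * u b k + \<beta> * u a k)" and pos: "\<alpha> > 0" "\<beta> > 0"
  shows "open_cone I (u(b := w)) = {lincomb I t u |t. (\<forall>i\<in>I. t i > 0) \<and> \<beta> * t b < \<alpha> * t a}"
proof (intro equalityI subsetI)
  fix x assume "x \<in> open_cone I (u(b := w))"
  then obtain t where t: "\<forall>i\<in>I. t i > 0" "x = lincomb I t (u(b := w))"
    unfolding open_cone_def by blast
  define t' where "t' = t(b := \<alpha> * t b, a := t a + \<beta> * t b)"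
  have "\<forall>i\<in>I. t' i > 0" "\<beta> * t' b < \<alpha> * t' a"
    unfolding t'_def using t(1) I pos by (auto simp: algebra_simps add_pos_pos)
  then show "x \<in> {lincomb I t u |t. (\<forall>i\<in>I. t i > 0) \<and> \<beta> * t b < \<alpha> * t a}"
    unfolding t(2) lincomb_replace[OF I w] t'_def by blast
next
  fix x assume "x \<in> {lincomb I t u |t. (\<forall>i\<in>I. t i > 0) \<and> \<beta> * t b < \<alpha> * t a}"
  then obtain t where t: "\<forall>i\<in>I. t i > 0" "\<beta> * t b < \<alpha> * t a" "x = lincomb I t u" by blast
  define t' where "t' = t(b := t b / \<alpha>, a := t a - \<beta> * (t b / \<alpha>))"
  have "x = lincomb I t' (u(b := w))"
    unfolding t(3) lincomb_replace[OF I w] t'_def using I(4) pos by (intro lincomb_cong) (auto simp: field_simps)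
  moreover have "\<forall>i\<in>I. t' i > 0" unfolding t'_def using t I pos by (auto simp: field_simps)
  ultimately show "x \<in> open_cone I (u(b := w))" unfolding open_cone_def by blast
qed

text \<open>Replacing \<open>b\<close>, replacing \<open>a\<close>, or dropping \<open>b\<close> and replacing \<open>a\<close> cuts the cone along the hyperplane
\<open>\<beta> * t b = \<alpha> * t a\<close> through the ray of \<open>w\<close>.\<close>

lemma open_cone_pieces:
  assumes I: "finite I" "a \<in> I" "b \<in> I" "a \<noteq> b"
    and w: "w = (\<lambda>k. \<alpha> * u b k + \<beta> * u a k)" and pos: "\<alpha> > 0" "\<beta> > 0"
  shows "open_cone I (u(b := w)) = {lincomb I t u |t. (\<forall>i\<in>I. t i > 0) \<and> \<beta> * t b < \<alpha> * t a}"
    and "open_cone I (u(a := w)) = {lincomb I t u |t. (\<forall>i\<in>I. t i > 0) \<and> \<beta> * t b > \<alpha> * t a}"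
    and "open_cone (I - {b}) (u(a := w)) = {lincomb I t u |t. (\<forall>i\<in>I. t i > 0) \<and> \<beta> * t b = \<alpha> * t a}"
proof -
  show "open_cone I (u(b := w)) = {lincomb I t u |t. (\<forall>i\<in>I. t i > 0) \<and> \<beta> * t b < \<alpha> * t a}"
    by (rule open_cone_replace[OF I w pos])
  have w': "w = (\<lambda>k. \<beta> * u a k + \<alpha> * u b k)" unfolding w by (simp add: add.commute)
  show "open_cone I (u(a := w)) = {lincomb I t u |t. (\<forall>i\<in>I. t i > 0) \<and> \<beta> * t b > \<alpha> * t a}"
    by (rule open_cone_replace[OF I(1,3,2) I(4)[symmetric] w' pos(2,1)])
  show "open_cone (I - {b}) (u(a := w)) = {lincomb I t u |t. (\<forall>i\<in>I. t i > 0) \<and> \<beta> * t b = \<alpha> * t a}"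
  proof (intro equalityI subsetI)
    fix x assume "x \<in> open_cone (I - {b}) (u(a := w))"
    then obtain t where t: "\<forall>i\<in>I - {b}. t i > 0" "x = lincomb (I - {b}) t (u(a := w))"
      unfolding open_cone_def by blast
    define t' where "t' = t(a := \<beta> * t a, b := \<alpha> * t a)"
    have "\<forall>i\<in>I. t' i > 0" "\<beta> * t' b = \<alpha> * t' a"
      unfolding t'_def using t(1) I pos by (auto simp: algebra_simps add_pos_pos)
    then show "x \<in> {lincomb I t u |t. (\<forall>i\<in>I. t i > 0) \<and> \<beta> * t b = \<alpha> * t a}"
      unfolding t(2) lincomb_replace[OF I w] t'_def by blast
  next
    fix x assume "x \<in> {lincomb I t u |t. (\<forall>i\<in>I. t i > 0) \<and> \<beta> * t b = \<alpha> * t a}"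
    then obtain t where t: "\<forall>i\<in>I. t i > 0" "\<beta> * t b = \<alpha> * t a" "x = lincomb I t u" by blast
    define t' where "t' = t(a := t a / \<beta>)"
    have "x = lincomb (I - {b}) t' (u(a := w))"
      unfolding t(3) lincomb_replace[OF I w] t'_def using I(4) pos t(2) by (intro lincomb_cong) (auto simp: field_simps)
    moreover have "\<forall>i\<in>I - {b}. t' i > 0" unfolding t'_def using t I pos by (auto simp: field_simps)
    ultimately show "x \<in> open_cone (I - {b}) (u(a := w))" unfolding open_cone_def by blast
  qed
qed

lemma open_cone_split:
  assumes I: "finite I" "a \<in> I" "b \<in> I" "a \<noteq> b" and ind: "independent_family I u"
    and w: "w = (\<lambda>k. \<alpha> * u b k + \<beta> * u a k)" and pos: "\<alpha> > 0" "\<beta> > 0"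
  shows "open_cone I u = open_cone I (u(b := w)) \<union> open_cone I (u(a := w)) \<union> open_cone (I - {b}) (u(a := w))"
    and "open_cone I (u(b := w)) \<inter> open_cone I (u(a := w)) = {}"
    and "(open_cone I (u(b := w)) \<union> open_cone I (u(a := w))) \<inter> open_cone (I - {b}) (u(a := w)) = {}"
proof -
  note p = open_cone_pieces[OF I w pos]
  have disj: "{lincomb I t u |t. (\<forall>i\<in>I. t i > 0) \<and> Q (\<beta> * t b) (\<alpha> * t a)} \<inter>
      {lincomb I t u |t. (\<forall>i\<in>I. t i > 0) \<and> Q' (\<beta> * t b) (\<alpha> * t a)} = {}"
    if QQ: "\<And>r s. Q r s \<Longrightarrow> \<not> Q' r s" for Q Q'
  proof (rule equals0I, elim IntE CollectE exE conjE)
    fix x t t' assume x: "x = lincomb I t u" "Q (\<beta> * t b) (\<alpha> * t a)"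
      "x = lincomb I t' u" "Q' (\<beta> * t' b) (\<alpha> * t' a)"
    have "lincomb I t u = lincomb I t' u" using x by simp
    then have "t a = t' a" "t b = t' b" using lincomb_independent_eqD[OF ind] I by blast+
    with x(2,4) QQ show False by metis
  qed
  show "open_cone I u = open_cone I (u(b := w)) \<union> open_cone I (u(a := w)) \<union> open_cone (I - {b}) (u(a := w))"
    unfolding p unfolding open_cone_def using linorder_less_linear by blast
  show "open_cone I (u(b := w)) \<inter> open_cone I (u(a := w)) = {}"
    unfolding p by (rule disj) simp
  show "(open_cone I (u(b := w)) \<union> open_cone I (u(a := w))) \<inter> open_cone (I - {b}) (u(a := w)) = {}"
    unfolding p Int_Un_distrib2 Un_empty by (intro conjI disj) simp_all
qed

text \<open>The coefficient of \<open>u b\<close> in a vanishing combination is \<open>\<alpha> * t b\<close>, and \<open>\<alpha> \<noteq> 0\<close>.\<close>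

lemma independent_family_replace:
  assumes I: "finite I" "a \<in> I" "b \<in> I" "a \<noteq> b" and ind: "independent_family I u"
    and w: "w = (\<lambda>k. \<alpha> * u b k + \<beta> * u a k)" and pos: "\<alpha> > 0"
  shows "independent_family I (u(b := w))"
  unfolding independent_family_def
proof (intro allI impI)
  fix t assume "lincomb I t (u(b := w)) = (\<lambda>_. 0)"
  note * = ind[unfolded independent_family_def, rule_format, OF this[unfolded lincomb_replace[OF I w]]]
  have "t i = 0" if "i \<in> I" "i \<noteq> a" "i \<noteq> b" for i using *[OF that(1)] that by simp
  then show "\<forall>i\<in>I. t i = 0" using *[OF I(2)] *[OF I(3)] I(4) pos by auto
qed

lemma independent_family_pieces:
  assumes I: "finite I" "a \<in> I" "b \<in> I" "a \<noteq> b" and ind: "independent_family I u"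
    and w: "w = (\<lambda>k. \<alpha> * u b k + \<beta> * u a k)" and pos: "\<alpha> > 0" "\<beta> > 0"
  shows "independent_family I (u(b := w))" "independent_family I (u(a := w))"
    "independent_family (I - {b}) (u(a := w))"
proof -
  show "independent_family I (u(b := w))"
    by (rule independent_family_replace[OF I ind w pos(1)])
  have w': "w = (\<lambda>k. \<beta> * u a k + \<alpha> * u b k)" unfolding w by (simp add: add.commute)
  show "independent_family I (u(a := w))"
    by (rule independent_family_replace[OF I(1,3,2) I(4)[symmetric] ind w' pos(2)])
  show "independent_family (I - {b}) (u(a := w))"
    unfolding independent_family_def
  proof (intro allI impI)
    fix t assume "lincomb (I - {b}) t (u(a := w)) = (\<lambda>_. 0)"
    note * = ind[unfolded independent_family_def, rule_format, OF this[unfolded lincomb_replace[OF I w]]]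
    have "t i = 0" if "i \<in> I" "i \<noteq> a" "i \<noteq> b" for i using *[OF that(1)] that by simp
    then show "\<forall>i\<in>I - {b}. t i = 0" using *[OF I(2)] *[OF I(3)] I(4) pos by auto
  qed
qed

lemma finite_cone_slice:
  fixes u :: "'b \<Rightarrow> 'a \<Rightarrow> rat"
  assumes I: "finite I" and J: "finite J"
    and supp: "\<And>i k. i \<in> I \<Longrightarrow> k \<notin> J \<Longrightarrow> u i k = 0"
    and height: "\<And>i. i \<in> I \<Longrightarrow> u i z > 0"
  shows "finite {x \<in> open_cone I u. integral_vec x \<and> x z = h}"
proof (rule finite_subset[OF _ finite_integral_vecs_bounded[OF J]])
  show "{x \<in> open_cone I u. integral_vec x \<and> x z = h} \<subseteq>
    {x. integral_vec x \<and> (\<forall>k. k \<notin> J \<longrightarrow> x k = 0) \<and> (\<forall>k\<in>J. \<bar>x k\<bar> \<le> (\<Sum>i\<in>I. (h / u i z) * \<bar>u i k\<bar>))}"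
  proof (intro subsetI CollectI conjI allI ballI impI)
    fix x assume x: "x \<in> {x \<in> open_cone I u. integral_vec x \<and> x z = h}"
    then show "integral_vec x" by simp
    obtain t where t: "\<forall>i\<in>I. t i > 0" "x = lincomb I t u" using x unfolding open_cone_def by blast
    fix k
    show "x k = 0" if "k \<notin> J" using t supp that unfolding lincomb_def by simp
    have le: "t i * u i z \<le> h" if i: "i \<in> I" for i
    proof -
      have "t i * u i z \<le> (\<Sum>i\<in>I. t i * u i z)"
        using t height I i by (intro member_le_sum) (auto simp: less_imp_le)
      then show ?thesis using x unfolding t(2) lincomb_def by simp
    qed
    have "\<bar>x k\<bar> \<le> (\<Sum>i\<in>I. \<bar>t i * u i k\<bar>)" unfolding t(2) lincomb_def by (rule sum_abs)
    also have "\<dots> \<le> (\<Sum>i\<in>I. (h / u i z) * \<bar>u i k\<bar>)"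
    proof (rule sum_mono)
      fix i assume i: "i \<in> I"
      then have "\<bar>t i\<bar> \<le> h / u i z" using le[OF i] t height[OF i] by (auto simp: field_simps)
      then show "\<bar>t i * u i k\<bar> \<le> (h / u i z) * \<bar>u i k\<bar>" unfolding abs_mult by (intro mult_right_mono) auto
    qed
    finally show "\<bar>x k\<bar> \<le> (\<Sum>i\<in>I. (h / u i z) * \<bar>u i k\<bar>)" .
  qed
qed

lemma sgn_dot_constant_on_cone:
  assumes "finite I"
    and "(\<forall>i\<in>I. dot J c (u i) \<ge> 0) \<or> (\<forall>i\<in>I. dot J c (u i) \<le> 0)"
    and "x \<in> open_cone I u" "y \<in> open_cone I u"
  shows "sgn (dot J c x) = sgn (dot J c y)"
proof -
  have *: "sgn (dot J c' x) = (if \<exists>i\<in>I. dot J c' (u i) > 0 then 1 else 0)"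
    if c': "\<forall>i\<in>I. dot J c' (u i) \<ge> 0" and x: "x \<in> open_cone I u" for x c'
  proof -
    obtain t where t: "\<forall>i\<in>I. t i > 0" "x = lincomb I t u" using x unfolding open_cone_def by blast
    show ?thesis
    proof (cases "\<exists>i\<in>I. dot J c' (u i) > 0")
      case True
      then have "(\<Sum>i\<in>I. t i * dot J c' (u i)) > 0"
        using assms(1) t c' by (auto intro!: sum_pos2)
      with True show ?thesis unfolding t(2) dot_lincomb by simp
    next
      case False
      then have "\<forall>i\<in>I. dot J c' (u i) = 0" using c' by (auto simp: order_le_less)
      then show ?thesis unfolding t(2) dot_lincomb by simp
    qed
  qed
  have neg: "dot J (\<lambda>k. - c k) x = - dot J c x" for x unfolding dot_def by (simp add: sum_negf)
  from assms(2) show ?thesis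
  proof
    assume "\<forall>i\<in>I. dot J c (u i) \<ge> 0"
    then show ?thesis using * assms by simp
  next
    assume "\<forall>i\<in>I. dot J c (u i) \<le> 0"
    then have "\<forall>i\<in>I. dot J (\<lambda>k. - c k) (u i) \<ge> 0" unfolding neg by simp
    then have "sgn (dot J (\<lambda>k. - c k) x) = sgn (dot J (\<lambda>k. - c k) y)" using * assms by simp
    then show ?thesis unfolding neg by (simp add: sgn_minus)
  qed
qed

text \<open>The predicate \<open>R\<close> may be any function of the signs of the forms in \<open>Ls\<close>. A form of constant sign on
the cone can be removed from \<open>Ls\<close>. If a form \<open>c\<close> is positive at \<open>u a\<close> and negative at \<open>u b\<close>, the
cone is split at the positive combination of \<open>u a\<close> and \<open>u b\<close> where \<open>c\<close> vanishes; each of the three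
pieces has fewer generators where \<open>c\<close> is not zero. New generators are positive combinations of old
ones, so the heights stay positive, which keeps the slices finite.\<close>

theorem quasi_polynomial_cone_count:
  fixes u :: "'b \<Rightarrow> 'a \<Rightarrow> rat"
  assumes "finite Ls" and J: "finite J"
    and "finite I" "independent_family I u"
    and "\<And>i k. i \<in> I \<Longrightarrow> k \<notin> J \<Longrightarrow> u i k = 0"
    and "\<And>i. i \<in> I \<Longrightarrow> u i z > 0"
    and "\<And>x y. x \<in> open_cone I u \<Longrightarrow> y \<in> open_cone I u \<Longrightarrow>
      (\<forall>c\<in>Ls. sgn (dot J c x) = sgn (dot J c y)) \<Longrightarrow> R x \<longleftrightarrow> R y"
  shows "quasi_polynomial (\<lambda>n. of_nat (card {x \<in> open_cone I u. integral_vec x \<and> x z = of_nat n \<and> R x}))"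
  using assms(1,3-)
proof (induction Ls arbitrary: I u)
  case empty
  show ?case
  proof (cases "\<exists>x\<in>open_cone I u. R x")
    case True
    then have "\<forall>x\<in>open_cone I u. R x" using empty.prems(5) by blast
    then have "{x \<in> open_cone I u. integral_vec x \<and> x z = h \<and> R x} =
      {x \<in> open_cone I u. integral_vec x \<and> x z = h}" for h by auto
    then show ?thesis using quasi_polynomial_simplicial_cone[OF empty(1) J empty(2-4)] by simp
  next
    case False
    then have "{x \<in> open_cone I u. integral_vec x \<and> x z = h \<and> R x} = {}" for h by blast
    then show ?thesis by (simp only: card.empty of_nat_0 quasi_polynomial_const)
  qed
next
  case (insert c Ls)
  show ?case
    using insert.prems
  proof (induction "card {i \<in> I. dot J c (u i) \<noteq> 0}" arbitrary: I u rule: less_induct)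
    case less
    show ?case
    proof (cases "(\<forall>i\<in>I. dot J c (u i) \<ge> 0) \<or> (\<forall>i\<in>I. dot J c (u i) \<le> 0)")
      case True
      show ?thesis
      proof (rule insert.IH[OF less.prems(1-4)])
        fix x y assume xy: "x \<in> open_cone I u" "y \<in> open_cone I u"
          "\<forall>c\<in>Ls. sgn (dot J c x) = sgn (dot J c y)"
        show "R x \<longleftrightarrow> R y"
          using less.prems(5)[OF xy(1,2)] xy(3) sgn_dot_constant_on_cone[OF less.prems(1) True xy(1,2)] by blast
      qed
    next
      case False
      then obtain a b where ab: "a \<in> I" "b \<in> I" "dot J c (u a) > 0" "dot J c (u b) < 0"
        by (meson not_le)
      then have "a \<noteq> b" by auto
      \<comment> \<open>These weights make the form \<open>c\<close> vanish at \<open>w\<close>.\<close>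
      define \<alpha> \<beta> where "\<alpha> = dot J c (u a)" and "\<beta> = - dot J c (u b)"
      define w where "w = (\<lambda>k. \<alpha> * u b k + \<beta> * u a k)"
      have pos: "\<alpha> > 0" "\<beta> > 0" using ab unfolding \<alpha>_def \<beta>_def by auto
      have I: "finite I" "a \<in> I" "b \<in> I" "a \<noteq> b" using less.prems ab \<open>a \<noteq> b\<close> by auto
      note split = open_cone_split[OF I less.prems(2) w_def pos]
      note ind = independent_family_pieces[OF I less.prems(2) w_def pos]
      have cw: "dot J c w = 0"
      proof -
        have "dot J c w = \<alpha> * dot J c (u b) + \<beta> * dot J c (u a)"
          unfolding w_def dot_def by (simp add: sum_distrib_left sum.distrib algebra_simps)
        then show ?thesis unfolding \<alpha>_def \<beta>_def by simp
      qed
      have wz: "w z > 0" using pos less.prems(4) I unfolding w_def by (auto intro: add_pos_pos)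
      have wsupp: "w k = 0" if "k \<notin> J" for k using less.prems(3) I that unfolding w_def by simp
      have fin: "finite {i \<in> I. dot J c (u i) \<noteq> 0}" using I by simp
      let ?Q = "\<lambda>I u. quasi_polynomial (\<lambda>n. of_nat (card {x \<in> open_cone I u. integral_vec x \<and> x z = of_nat n \<and> R x}))"
      have piece: "?Q I' u'"
        if c: "card {i \<in> I'. dot J c (u' i) \<noteq> 0} < card {i \<in> I. dot J c (u i) \<noteq> 0}"
          and I': "I' \<subseteq> I" and ind': "independent_family I' u'"
          and u': "u' = u(b := w) \<or> u' = u(a := w)"
          and cone: "open_cone I' u' \<subseteq> open_cone I u" for I' u'
      proof (rule less.hyps[OF c _ ind'])
        show "finite I'" using I' I(1) by (rule finite_subset)
        show "u' i k = 0" if "i \<in> I'" "k \<notin> J" for i k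
          using u' less.prems(3)[of i k] wsupp[of k] that I' by (cases "i = a"; cases "i = b") auto
        show "u' i z > 0" if "i \<in> I'" for i
          using u' less.prems(4)[of i] wz that I' by (cases "i = a"; cases "i = b") auto
        fix x y assume xy: "x \<in> open_cone I' u'" "y \<in> open_cone I' u'"
          "\<forall>c\<in>insert c Ls. sgn (dot J c x) = sgn (dot J c y)"
        show "R x \<longleftrightarrow> R y"
          using less.prems(5)[OF subsetD[OF cone xy(1)] subsetD[OF cone xy(2)] xy(3)] .
      qed
      have fewer: "card A < card {i \<in> I. dot J c (u i) \<noteq> 0}"
        if A: "A \<subseteq> {i \<in> I. dot J c (u i) \<noteq> 0} - {i}" and i: "i \<in> {i \<in> I. dot J c (u i) \<noteq> 0}" for A i
        using card_mono[OF _ A] card_Diff1_less[OF fin i] fin by simp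
      have ab_in: "a \<in> {i \<in> I. dot J c (u i) \<noteq> 0}" "b \<in> {i \<in> I. dot J c (u i) \<noteq> 0}" using ab by auto
      have q1: "?Q I (u(b := w))"
      proof (rule piece[OF _ subset_refl ind(1) disjI1[OF refl]])
        show "card {i \<in> I. dot J c ((u(b := w)) i) \<noteq> 0} < card {i \<in> I. dot J c (u i) \<noteq> 0}"
          by (rule fewer[OF _ ab_in(2)]) (use cw in auto)
        show "open_cone I (u(b := w)) \<subseteq> open_cone I u" unfolding split(1) by blast
      qed
      have q2: "?Q I (u(a := w))"
      proof (rule piece[OF _ subset_refl ind(2) disjI2[OF refl]])
        show "card {i \<in> I. dot J c ((u(a := w)) i) \<noteq> 0} < card {i \<in> I. dot J c (u i) \<noteq> 0}"
          by (rule fewer[OF _ ab_in(1)]) (use cw in auto)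
        show "open_cone I (u(a := w)) \<subseteq> open_cone I u" unfolding split(1) by blast
      qed
      have q3: "?Q (I - {b}) (u(a := w))"
      proof (rule piece[OF _ Diff_subset ind(3) disjI2[OF refl]])
        show "card {i \<in> I - {b}. dot J c ((u(a := w)) i) \<noteq> 0} < card {i \<in> I. dot J c (u i) \<noteq> 0}"
          by (rule fewer[OF _ ab_in(1)]) (use cw in auto)
        show "open_cone (I - {b}) (u(a := w)) \<subseteq> open_cone I u" unfolding split(1) by blast
      qed
      let ?S = "\<lambda>I u n. {x \<in> open_cone I u. integral_vec x \<and> x z = of_nat n \<and> R x}"
      have finS: "finite (?S I u n)" for n
      proof (rule finite_subset)
        show "finite {x \<in> open_cone I u. integral_vec x \<and> x z = of_nat n}"
          by (rule finite_cone_slice[where J = J]) (use less.prems J in auto)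
      qed blast
      have un: "?S I u n = ?S I (u(b := w)) n \<union> ?S I (u(a := w)) n \<union> ?S (I - {b}) (u(a := w)) n" for n
        unfolding split(1) by blast
      have "card (?S I u n) = card (?S I (u(b := w)) n) + card (?S I (u(a := w)) n)
          + card (?S (I - {b}) (u(a := w)) n)" for n
      proof -
        have f: "finite (?S I (u(b := w)) n)" "finite (?S I (u(a := w)) n)"
          "finite (?S (I - {b}) (u(a := w)) n)"
          using finS[of n] unfolding un by auto
        have "card (?S I u n) = card (?S I (u(b := w)) n \<union> ?S I (u(a := w)) n)
            + card (?S (I - {b}) (u(a := w)) n)"
          unfolding un using f split(3) by (intro card_Un_disjoint) auto
        also have "card (?S I (u(b := w)) n \<union> ?S I (u(a := w)) n)
            = card (?S I (u(b := w)) n) + card (?S I (u(a := w)) n)"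
          using f split(2) by (intro card_Un_disjoint) auto
        finally show ?thesis .
      qed
      then show ?thesis using quasi_polynomial_add[OF quasi_polynomial_add[OF q1 q2] q3] by (simp only: of_nat_add)
    qed
  qed
qed

section \<open>Lattice points of bounded homogeneous regions\<close>

text \<open>Homogenisation: \<open>x\<close> at parameter \<open>n\<close> becomes a point at height \<open>n\<close> in one more coordinate, named
\<open>None\<close>. The bound on \<open>x\<close> places the region inside the cone over a large simplex, all of whose
generators have height 1, so that no decomposition of the whole space is needed.\<close>

theorem quasi_polynomial_lattice_count:
  fixes R :: "('a \<Rightarrow> rat) \<Rightarrow> rat \<Rightarrow> bool" and Ls :: "(('a \<Rightarrow> rat) \<times> rat) set"
  assumes J: "finite J" and Ls: "finite Ls"
    and det: "\<And>x y m n. (\<forall>(c, d)\<in>Ls. sgn (dot J c x + d * m) = sgn (dot J c y + d * n)) \<Longrightarrow> R x m \<longleftrightarrow> R y n"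
    and bound: "\<And>n x k. n \<ge> 1 \<Longrightarrow> integral_vec x \<Longrightarrow> (\<forall>k. k \<notin> J \<longrightarrow> x k = 0) \<Longrightarrow> R x (of_nat n) \<Longrightarrow>
       k \<in> J \<Longrightarrow> \<bar>x k\<bar> \<le> of_nat C * of_nat n"
  shows "quasi_polynomial (\<lambda>n. of_nat (card {x. integral_vec x \<and> (\<forall>k. k \<notin> J \<longrightarrow> x k = 0) \<and> R x (of_nat n)}))"
proof -
  \<comment> \<open>The simplex has a vertex at \<open>- (C + 1)\<close> in all coordinates and edges of length \<open>M\<close>, long enough
to contain the box \<open>[-C, C]\<close> in its interior.\<close>
  define M :: rat where "M = of_nat (card J) * (2 * of_nat C + 1) + 1"
  have M: "M > 0" unfolding M_def by (intro add_nonneg_pos mult_nonneg_nonneg) auto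
  define I where "I = insert None (Some ` J)"
  define u :: "'a option \<Rightarrow> 'a option \<Rightarrow> rat" where
    "u i k = (case k of None \<Rightarrow> 1
      | Some j \<Rightarrow> if j \<in> J then - (of_nat C + 1) + (if i = k then M else 0) else 0)" for i k
  have finI: "finite I" unfolding I_def using J by simp
  have sumI: "sum f I = f None + (\<Sum>j\<in>J. f (Some j))" for f :: "'a option \<Rightarrow> rat"
    unfolding I_def using J by (subst sum.insert) (auto simp: sum.reindex)
  have lin: "lincomb I t u k = (case k of None \<Rightarrow> sum t I
      | Some j \<Rightarrow> if j \<in> J then - (of_nat C + 1) * sum t I + M * t k else 0)" for t k
  proof (cases k)
    case None
    then show ?thesis unfolding lincomb_def u_def by simp
  next
    case (Some j)
    show ?thesis
    proof (cases "j \<in> J")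
      case True
      then have "k \<in> I" unfolding I_def Some by simp
      have "lincomb I t u k = (\<Sum>i\<in>I. - (of_nat C + 1) * t i + (if i = k then M * t i else 0))"
        unfolding lincomb_def u_def using True Some by (intro sum.cong) (auto simp: algebra_simps)
      also have "\<dots> = - (of_nat C + 1) * sum t I + M * t k"
        using finI \<open>k \<in> I\<close> by (simp add: sum.distrib sum_distrib_left sum.delta')
      finally show ?thesis using True Some by simp
    next
      case False
      then show ?thesis unfolding lincomb_def u_def Some by simp
    qed
  qed
  have ind: "independent_family I u"
    unfolding independent_family_def
  proof (intro allI impI)
    fix t assume t: "lincomb I t u = (\<lambda>_. 0)"
    have s: "sum t I = 0" using fun_cong[OF t, of None] unfolding lin by simp
    have "t (Some j) = 0" if "j \<in> J" for j
      using fun_cong[OF t, of "Some j"] that s M unfolding lin by simp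
    then show "\<forall>i\<in>I. t i = 0" using s unfolding sumI unfolding I_def by simp
  qed
  define Ls' where "Ls' = (\<lambda>(c, d). case_option d c) ` Ls"
  have dot_opt: "dot I (case_option d c) y = dot J c (\<lambda>j. y (Some j)) + d * y None" for c d y
    unfolding dot_def sumI by simp
  define R' where "R' y = R (\<lambda>j. y (Some j)) (y None)" for y :: "'a option \<Rightarrow> rat"
  let ?T = "\<lambda>n. {y \<in> open_cone I u. integral_vec y \<and> y None = of_nat n \<and> R' y}"
  let ?S = "\<lambda>n. {x. integral_vec x \<and> (\<forall>k. k \<notin> J \<longrightarrow> x k = 0) \<and> R x (of_nat n)}"
  have "quasi_polynomial (\<lambda>n. of_nat (card (?T n)))"
  proof (rule quasi_polynomial_cone_count[where Ls = Ls' and J = I])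
    show "finite Ls'" unfolding Ls'_def using Ls by simp
    show "u i k = 0" if "i \<in> I" "k \<notin> I" for i k
      using that unfolding u_def I_def by (cases k) auto
    show "u i None > 0" for i unfolding u_def by simp
    fix x y assume "\<forall>c\<in>Ls'. sgn (dot I c x) = sgn (dot I c y)"
    then show "R' x \<longleftrightarrow> R' y"
      unfolding R'_def Ls'_def by (intro det) (auto simp: dot_opt)
  qed (use finI ind in auto)
  moreover have "of_nat (card (?S n)) = (of_nat (card (?T n)) :: rat)" if n: "n \<ge> 1" for n
  proof -
    let ?f = "\<lambda>x. case_option (of_nat n) x :: 'a option \<Rightarrow> rat" and ?g = "\<lambda>y j. y (Some j)"
    have "bij_betw ?f (?S n) (?T n)"
    proof (rule bij_betw_byWitness[where f' = ?g])
      show "\<forall>x\<in>?S n. ?g (?f x) = x" by simp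
      show "\<forall>y\<in>?T n. ?f (?g y) = y" by (auto simp: fun_eq_iff split: option.split)
      show "?f ` ?S n \<subseteq> ?T n"
      proof (rule image_subsetI)
        fix x assume x: "x \<in> ?S n"
        define a where "a j = (x j + (of_nat C + 1) * of_nat n) / M" for j
        define t where "t = case_option (of_nat n - sum a J) a"
        have st: "sum t I = of_nat n" unfolding sumI t_def by simp
        have aM: "M * a j = x j + (of_nat C + 1) * of_nat n" for j unfolding a_def using M by simp
        have eq: "?f x = lincomb I t u"
        proof
          fix k show "?f x k = lincomb I t u k"
            unfolding lin st using x M by (cases k) (auto simp: t_def aM algebra_simps)
        qed
        have b: "\<bar>x j\<bar> \<le> of_nat C * of_nat n" if "j \<in> J" for j
          using bound[OF n _ _ _ that] x by blast
        have apos: "a j > 0" if "j \<in> J" for j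
        proof -
          have "x j + (of_nat C + 1) * of_nat n > 0" using b[OF that] n by (simp add: algebra_simps abs_le_iff)
          then show ?thesis unfolding a_def using M by simp
        qed
        have "M * sum a J = (\<Sum>j\<in>J. x j + (of_nat C + 1) * of_nat n)"
          unfolding a_def sum_distrib_left using M by simp
        also have "\<dots> \<le> (\<Sum>j\<in>J. (2 * of_nat C + 1) * of_nat n)"
        proof (rule sum_mono)
          fix j assume "j \<in> J"
          then show "x j + (of_nat C + 1) * of_nat n \<le> (2 * of_nat C + 1) * of_nat n"
            using b[of j] by (simp add: algebra_simps abs_le_iff)
        qed
        also have "\<dots> = (M - 1) * of_nat n" unfolding M_def by simp
        also have "\<dots> < M * of_nat n" using n by (simp add: algebra_simps)
        finally have "sum a J < of_nat n" using M by simp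
        then have "\<forall>i\<in>I. t i > 0" unfolding t_def I_def using apos by simp
        then have "?f x \<in> open_cone I u" unfolding eq open_cone_def by blast
        moreover have "integral_vec (?f x)"
          using x unfolding integral_vec_def by (auto split: option.split)
        ultimately show "?f x \<in> ?T n" using x unfolding R'_def by simp
      qed
      show "?g ` ?T n \<subseteq> ?S n"
      proof (rule image_subsetI)
        fix y assume y: "y \<in> ?T n"
        then obtain t where t: "y = lincomb I t u" unfolding open_cone_def by blast
        have "y (Some k) = 0" if "k \<notin> J" for k unfolding t lin using that by simp
        then show "?g y \<in> ?S n" using y unfolding R'_def integral_vec_def by auto
      qed
    qed
    then show ?thesis unfolding of_nat_eq_iff by (rule bij_betw_same_card)
  qed
  ultimately show ?thesis by (rule quasi_polynomial_cong)
qed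

section \<open>Moebius weights of local constraints\<close>

text \<open>The intended reading of \<open>V T x\<close> is that \<open>x\<close> satisfies some equation that involves exactly the copies in \<open>T\<close>.\<close>

definition avoids :: "('k set \<Rightarrow> ('k \<Rightarrow> 'v) \<Rightarrow> bool) \<Rightarrow> 'k set \<Rightarrow> ('k \<Rightarrow> 'v) \<Rightarrow> bool" where
  "avoids V K x \<longleftrightarrow> (\<forall>T\<subseteq>K. \<not> V T x)"

text \<open>The Moebius inverse, over the subsets of \<open>L\<close>, of the indicator function of avoidance.\<close>

definition mobius_weight :: "('k set \<Rightarrow> ('k \<Rightarrow> 'v) \<Rightarrow> bool) \<Rightarrow> 'k set \<Rightarrow> ('k \<Rightarrow> 'v) \<Rightarrow> rat" where
  "mobius_weight V L x = (\<Sum>M\<in>Pow L. (-1) ^ card (L - M) * of_bool (avoids V M x))"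

definition weight_sum :: "('k set \<Rightarrow> ('k \<Rightarrow> 'v) \<Rightarrow> bool) \<Rightarrow> 'v set \<Rightarrow> 'k set \<Rightarrow> rat" where
  "weight_sum V X L = (\<Sum>x\<in>PiE L (\<lambda>_. X). mobius_weight V L x)"

definition local_constraints :: "('k set \<Rightarrow> ('k \<Rightarrow> 'v) \<Rightarrow> bool) \<Rightarrow> bool" where
  "local_constraints V \<longleftrightarrow> (\<forall>T x y. (\<forall>i\<in>T. x i = y i) \<longrightarrow> V T x = V T y)"

lemma local_constraintsD:
  "local_constraints V \<Longrightarrow> (\<And>i. i \<in> T \<Longrightarrow> x i = y i) \<Longrightarrow> V T x = V T y"
  unfolding local_constraints_def by blast

lemma of_bool_avoids_eq_sum_mobius_weight:
  assumes "finite K"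
  shows "of_bool (avoids V K x) = (\<Sum>L\<in>Pow K. mobius_weight V L x)"
proof -
  define f :: "'a set \<Rightarrow> rat" where "f M = of_bool (avoids V M x)" for M
  define g where "g L = (-1) ^ card L * mobius_weight V L x" for L
  have fg: "f S = (\<Sum>T\<in>Pow S. (-1) ^ card T * g T)" if "finite S" for S
  proof (rule inclusion_exclusion_symmetric[OF _ that])
    fix L :: "'a set" assume L: "finite L"
    have "g L = (\<Sum>M\<in>Pow L. (-1) ^ card L * (-1) ^ card (L - M) * f M)"
      unfolding g_def mobius_weight_def f_def sum_distrib_left by (simp add: mult.assoc)
    also have "\<dots> = (\<Sum>M\<in>Pow L. (-1) ^ card M * f M)"
    proof (rule sum.cong[OF refl])
      fix M assume M: "M \<in> Pow L"
      then have "card L = card M + card (L - M)"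
        using L by (metis PowD card_Diff_subset card_mono finite_subset le_add_diff_inverse)
      then have "(-1) ^ card L * (-1) ^ card (L - M) = ((-1::rat) ^ card M)"
        by (simp add: power_add flip: power_mult_distrib)
      then show "(-1) ^ card L * (-1) ^ card (L - M) * f M = (-1) ^ card M * f M" by simp
    qed
    finally show "g L = (\<Sum>M\<in>Pow L. (-1) ^ card M * f M)" .
  qed
  have "f K = (\<Sum>L\<in>Pow K. (-1) ^ card L * g L)" by (rule fg[OF assms])
  also have "\<dots> = (\<Sum>L\<in>Pow K. mobius_weight V L x)"
    unfolding g_def by (intro sum.cong refl) (simp add: mult.assoc[symmetric] flip: power_mult_distrib)
  finally show ?thesis unfolding f_def .
qed

text \<open>If no satisfied equation involves \<open>i\<close>, adding \<open>i\<close> to \<open>M\<close> does not change whether \<open>M\<close> is avoided,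
so the terms for \<open>M\<close> and \<open>insert i M\<close> cancel.\<close>

lemma mobius_weight_uncovered:
  assumes L: "finite L" "i \<in> L" and no: "\<And>T. T \<subseteq> L \<Longrightarrow> i \<in> T \<Longrightarrow> \<not> V T x"
  shows "mobius_weight V L x = 0"
proof -
  let ?h = "\<lambda>M. (-1) ^ card (L - M) * of_bool (avoids V M x) :: rat"
  let ?P = "Pow (L - {i})"
  have PL: "Pow L = ?P \<union> insert i ` ?P"
    using L(2) by (metis Pow_insert insert_Diff)
  have disj: "?P \<inter> insert i ` ?P = {}" by auto
  have inj: "inj_on (insert i) ?P" by (rule inj_onI) (auto simp: insert_eq_iff)
  have "mobius_weight V L x = sum ?h ?P + sum ?h (insert i ` ?P)"
    unfolding mobius_weight_def PL using L disj by (intro sum.union_disjoint) auto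
  also have "sum ?h (insert i ` ?P) = (\<Sum>M\<in>?P. - ?h M)"
    unfolding sum.reindex[OF inj] o_def
  proof (rule sum.cong[OF refl])
    fix M assume M: "M \<in> ?P"
    have "L - M = insert i (L - insert i M)" using M L by auto
    then have c: "card (L - M) = Suc (card (L - insert i M))"
      using L by (metis Diff_iff card_insert_disjoint finite_Diff insertI1)
    have "avoids V (insert i M) x = avoids V M x"
    proof
      assume a: "avoids V M x"
      show "avoids V (insert i M) x"
        unfolding avoids_def
      proof (intro allI impI)
        fix T assume T: "T \<subseteq> insert i M"
        show "\<not> V T x"
        proof (cases "i \<in> T")
          case True then show ?thesis using no[of T] T M L by auto
        next
          case False then show ?thesis using a T unfolding avoids_def by blast
        qed
      qed
    qed (auto simp: avoids_def)
    then show "?h (insert i M) = - ?h M" unfolding c by simp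
  qed
  finally show ?thesis by (simp add: sum_negf)
qed

lemma abs_mobius_weight_le:
  assumes "finite L"
  shows "\<bar>mobius_weight V L x\<bar> \<le> 2 ^ card L"
proof -
  have "\<bar>mobius_weight V L x\<bar> \<le> (\<Sum>M\<in>Pow L. \<bar>(-1) ^ card (L - M) * of_bool (avoids V M x)\<bar>)"
    unfolding mobius_weight_def by (rule sum_abs)
  also have "\<dots> \<le> (\<Sum>M\<in>Pow L. 1)" by (rule sum_mono) (simp add: abs_mult power_abs)
  also have "\<dots> = 2 ^ card L" using assms by (simp add: card_Pow)
  finally show ?thesis .
qed

lemma avoids_cong:
  assumes "local_constraints V" "\<And>i. i \<in> M \<Longrightarrow> x i = y i"
  shows "avoids V M x = avoids V M y"
  unfolding avoids_def using local_constraintsD[OF assms(1)] assms(2) by (metis subsetD)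

lemma mobius_weight_cong:
  assumes "local_constraints V" "\<And>i. i \<in> L \<Longrightarrow> x i = y i"
  shows "mobius_weight V L x = mobius_weight V L y"
proof -
  have "avoids V M x = avoids V M y" if "M \<in> Pow L" for M
    using that assms(2) by (intro avoids_cong[OF assms(1)]) auto
  then show ?thesis unfolding mobius_weight_def by (intro sum.cong) auto
qed

lemma sum_PiE_restrict:
  fixes g :: "('k \<Rightarrow> 'v) \<Rightarrow> rat"
  assumes "finite K" "L \<subseteq> K"
  shows "(\<Sum>x\<in>PiE K (\<lambda>_. X). g (restrict x L)) = of_nat (card X) ^ card (K - L) * (\<Sum>y\<in>PiE L (\<lambda>_. X). g y)"
proof -
  have "(\<Sum>x\<in>PiE K (\<lambda>_. X). g (restrict x L)) =
      (\<Sum>(y, z)\<in>PiE L (\<lambda>_. X) \<times> PiE (K - L) (\<lambda>_. X). g y)"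
    by (rule sum.reindex_bij_witness[where i = "\<lambda>(y, z) k. if k \<in> L then y k else z k"
          and j = "\<lambda>x. (restrict x L, restrict x (K - L))"])
      (use assms(2) in \<open>auto simp: fun_eq_iff PiE_iff extensional_def restrict_def\<close>)
  also have "\<dots> = of_nat (card (PiE (K - L) (\<lambda>_. X))) * (\<Sum>y\<in>PiE L (\<lambda>_. X). g y)"
    by (simp flip: sum.cartesian_product add: sum_distrib_left)
  also have "of_nat (card (PiE (K - L) (\<lambda>_. X))) = (of_nat (card X) ^ card (K - L) :: rat)"
    using assms by (simp add: card_PiE)
  finally show ?thesis .
qed

lemma card_avoids_eq_sum_weight_sum:
  assumes V: "local_constraints V" and K: "finite K" and X: "finite X"
  shows "of_nat (card {x \<in> PiE K (\<lambda>_. X). avoids V K x}) =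
    (\<Sum>L\<in>Pow K. of_nat (card X) ^ card (K - L) * weight_sum V X L)"
proof -
  have fin: "finite (PiE K (\<lambda>_. X))" using K X by (intro finite_PiE) auto
  have "of_nat (card {x \<in> PiE K (\<lambda>_. X). avoids V K x}) = (\<Sum>x\<in>PiE K (\<lambda>_. X). of_bool (avoids V K x) :: rat)"
    using fin by (simp add: Int_def)
  also have "\<dots> = (\<Sum>x\<in>PiE K (\<lambda>_. X). \<Sum>L\<in>Pow K. mobius_weight V L x)"
    unfolding of_bool_avoids_eq_sum_mobius_weight[OF K] ..
  also have "\<dots> = (\<Sum>L\<in>Pow K. \<Sum>x\<in>PiE K (\<lambda>_. X). mobius_weight V L x)" by (rule sum.swap)
  also have "\<dots> = (\<Sum>L\<in>Pow K. \<Sum>x\<in>PiE K (\<lambda>_. X). mobius_weight V L (restrict x L))"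
    by (intro sum.cong refl mobius_weight_cong[OF V]) auto
  also have "\<dots> = (\<Sum>L\<in>Pow K. of_nat (card X) ^ card (K - L) * weight_sum V X L)"
    unfolding weight_sum_def using K by (intro sum.cong refl sum_PiE_restrict) auto
  finally show ?thesis .
qed

lemma weight_sum_bij:
  assumes V: "local_constraints V" and bij: "bij_betw \<pi> K L"
    and sym: "\<And>T x. T \<subseteq> K \<Longrightarrow> V (\<pi> ` T) x = V T (\<lambda>i. x (\<pi> i))"
  shows "weight_sum V X L = weight_sum V X K"
proof -
  have inj: "inj_on \<pi> K" and im: "\<pi> ` K = L" using bij by (auto simp: bij_betw_def)
  have av: "avoids V (\<pi> ` M) x = avoids V M (\<lambda>i. x (\<pi> i))" if "M \<subseteq> K" for M x
    unfolding avoids_def all_subset_image using sym subset_trans[OF _ that] by simp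
  have mw: "mobius_weight V L x = mobius_weight V K (\<lambda>i. x (\<pi> i))" for x
  proof -
    have "mobius_weight V L x = (\<Sum>M\<in>(`) \<pi> ` Pow K. (-1) ^ card (L - M) * of_bool (avoids V M x))"
      unfolding mobius_weight_def im[symmetric] image_Pow_surj[OF refl] ..
    also have "\<dots> = (\<Sum>M\<in>Pow K. (-1) ^ card (L - \<pi> ` M) * of_bool (avoids V (\<pi> ` M) x))"
      by (subst sum.reindex[OF inj_on_image_Pow[OF inj]]) simp
    also have "\<dots> = mobius_weight V K (\<lambda>i. x (\<pi> i))"
      unfolding mobius_weight_def
    proof (rule sum.cong[OF refl])
      fix M assume M: "M \<in> Pow K"
      have "L - \<pi> ` M = \<pi> ` (K - M)" using inj M unfolding im[symmetric]
        by (simp add: inj_on_image_set_diff[of \<pi> K K M])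
      then have "card (L - \<pi> ` M) = card (K - M)"
        using inj by (metis Diff_subset card_image inj_on_subset)
      then show "(-1) ^ card (L - \<pi> ` M) * of_bool (avoids V (\<pi> ` M) x) =
          (-1) ^ card (K - M) * (of_bool (avoids V M (\<lambda>i. x (\<pi> i))) :: rat)"
        using av M by simp
    qed
    finally show ?thesis .
  qed
  define \<rho> where "\<rho> = inv_into K \<pi>"
  have \<rho>: "\<rho> (\<pi> i) = i" if "i \<in> K" for i using inj that unfolding \<rho>_def by simp
  have \<rho>': "\<pi> (\<rho> i) = i" "\<rho> i \<in> K" if "i \<in> L" for i
    using that im unfolding \<rho>_def by (auto simp: f_inv_into_f inv_into_into)
  have piL: "\<pi> i \<in> L" if "i \<in> K" for i using that im by auto
  show ?thesis
    unfolding weight_sum_def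
  proof (rule sum.reindex_bij_witness[where j = "\<lambda>x. \<lambda>i\<in>K. x (\<pi> i)" and i = "\<lambda>y. \<lambda>i\<in>L. y (\<rho> i)"])
    fix x assume x: "x \<in> PiE L (\<lambda>_. X)"
    show "(\<lambda>i\<in>L. (\<lambda>i\<in>K. x (\<pi> i)) (\<rho> i)) = x"
      using x \<rho>' by (auto simp: fun_eq_iff PiE_iff extensional_def restrict_def)
    show "(\<lambda>i\<in>K. x (\<pi> i)) \<in> PiE K (\<lambda>_. X)" using x piL by auto
    show "mobius_weight V K (\<lambda>i\<in>K. x (\<pi> i)) = mobius_weight V L x"
      unfolding mw by (rule mobius_weight_cong[OF V]) simp
  next
    fix y assume y: "y \<in> PiE K (\<lambda>_. X)"
    show "(\<lambda>i\<in>K. (\<lambda>i\<in>L. y (\<rho> i)) (\<pi> i)) = y"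
      using y \<rho> piL by (auto simp: fun_eq_iff PiE_iff extensional_def restrict_def)
    show "(\<lambda>i\<in>L. y (\<rho> i)) \<in> PiE L (\<lambda>_. X)" using y \<rho>' by auto
  qed
qed

lemma sum_Pow_card:
  fixes h :: "nat \<Rightarrow> rat"
  assumes "finite K"
  shows "(\<Sum>L\<in>Pow K. h (card L)) = (\<Sum>k\<le>card K. of_nat (card K choose k) * h k)"
proof -
  have "(\<Sum>L\<in>Pow K. h (card L)) = (\<Sum>k\<le>card K. \<Sum>L\<in>{L \<in> Pow K. card L = k}. h (card L))"
    using assms by (intro sum.group[symmetric]) (auto intro: card_mono)
  also have "\<dots> = (\<Sum>k\<le>card K. of_nat (card {L \<in> Pow K. card L = k}) * h k)"
    by (intro sum.cong refl) simp
  finally show ?thesis using n_subsets[OF assms] by simp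
qed

text \<open>The weights of \<open>L\<close> only depend on the coordinates in \<open>L\<close>; the others contribute a factor
\<open>card X\<close> each. By symmetry the sum over \<open>L\<close> only depends on \<open>card L\<close>.\<close>

theorem card_avoids_binomial:
  fixes V :: "nat set \<Rightarrow> (nat \<Rightarrow> 'v) \<Rightarrow> bool"
  assumes V: "local_constraints V" and X: "finite X"
    and sym: "\<And>T x \<pi>. finite T \<Longrightarrow> inj_on \<pi> T \<Longrightarrow> V (\<pi> ` T) x = V T (\<lambda>i. x (\<pi> i))"
  shows "of_nat (card {x \<in> PiE {1..q} (\<lambda>_. X). avoids V {1..q} x}) =
    (\<Sum>k\<le>q. of_nat (q choose k) * (of_nat (card X) ^ (q - k) * weight_sum V X {1..k}))"
proof -
  have "of_nat (card {x \<in> PiE {1..q} (\<lambda>_. X). avoids V {1..q} x}) =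
    (\<Sum>L\<in>Pow {1..q}. of_nat (card X) ^ card ({1..q} - L) * weight_sum V X L)"
    by (rule card_avoids_eq_sum_weight_sum[OF V _ X]) simp
  also have "\<dots> = (\<Sum>L\<in>Pow {1..q}. of_nat (card X) ^ (q - card L) * weight_sum V X {1..card L})"
  proof (rule sum.cong[OF refl])
    fix L assume "L \<in> Pow {1..q}"
    then have L: "L \<subseteq> {1..q}" and fin: "finite L" by (auto intro: finite_subset)
    obtain \<pi> where \<pi>: "bij_betw \<pi> {1..card L} L"
      using ex_bij_betw_nat_finite_1[OF fin] by blast
    have "weight_sum V X L = weight_sum V X {1..card L}"
    proof (rule weight_sum_bij[OF V \<pi>])
      fix T x assume T: "T \<subseteq> {1..card L}"
      show "V (\<pi> ` T) x = V T (\<lambda>i. x (\<pi> i))"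
        using \<pi> T by (intro sym) (auto intro: finite_subset inj_on_subset simp: bij_betw_def)
    qed
    moreover have "card ({1..q} - L) = q - card L" using L fin by (simp add: card_Diff_subset)
    ultimately show "of_nat (card X) ^ card ({1..q} - L) * weight_sum V X L =
        of_nat (card X) ^ (q - card L) * weight_sum V X {1..card L}" by simp
  qed
  also have "\<dots> = (\<Sum>k\<le>q. of_nat (q choose k) * (of_nat (card X) ^ (q - k) * weight_sum V X {1..k}))"
    using sum_Pow_card[of "{1..q}" "\<lambda>k. of_nat (card X) ^ (q - k) * weight_sum V X {1..k}"] by simp
  finally show ?thesis .
qed

lemma card_extensions_le:
  assumes "finite E" "D \<subseteq> E" "finite X"
  shows "card {z \<in> PiE E (\<lambda>_. X). restrict z D = y} \<le> card X ^ card (E - D)"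
proof -
  let ?S = "{z \<in> PiE E (\<lambda>_. X). restrict z D = y}"
  have "inj_on (\<lambda>z. restrict z (E - D)) ?S"
  proof (rule inj_onI)
    fix z z' assume z: "z \<in> ?S" "z' \<in> ?S" "restrict z (E - D) = restrict z' (E - D)"
    have "z i = z' i" if "i \<in> E" for i
    proof (cases "i \<in> D")
      case True
      have "restrict z D i = restrict z' D i" using z by simp
      then show ?thesis using True by simp
    next
      case False
      then show ?thesis using fun_cong[OF z(3), of i] that by simp
    qed
    then show "z = z'" using z by (intro PiE_ext[of z E "\<lambda>_. X" z']) auto
  qed
  then have "card ?S \<le> card (PiE (E - D) (\<lambda>_. X))"
    using assms by (intro card_inj_on_le[of _ ?S]) (auto intro!: finite_PiE)
  also have "\<dots> = card X ^ card (E - D)" using assms by (simp add: card_PiE)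
  finally show ?thesis .
qed

text \<open>Here \<open>D\<close> is the set of copies whose coordinates are already fixed. A copy \<open>i\<close> outside \<open>D\<close> lies
in the set \<open>T\<close> of a satisfied equation; the coordinates in \<open>T - D\<close> are chosen next. The equation
saves a factor \<open>N\<close> among the choices for the copy \<open>i\<close>, and at most \<open>b\<close> copies become fixed, so that
\<open>c\<close> savings are possible as long as \<open>c * b < card (L - D) + b\<close>. The number of choices of \<open>T\<close> and of
an equation is absorbed in the constant \<open>2 ^ card L * W\<close>, which does not depend on \<open>X\<close>, \<open>B\<close> or \<open>N\<close>.\<close>

lemma card_covered_extensions_le:
  assumes V: "local_constraints V" and L: "finite L" and X: "finite X" "card X \<le> B"
    and W: "W \<ge> 1"
    and size: "\<And>T x. V T x \<Longrightarrow> card T \<le> b"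
    and hit: "\<And>T i z. T \<subseteq> L \<Longrightarrow> i \<in> T \<Longrightarrow> card {v \<in> X. V T (z(i := v))} * N \<le> W * B"
    and D: "D \<subseteq> L" and c: "c * b < card (L - D) + b"
  shows "card {x \<in> PiE L (\<lambda>_. X). restrict x D = y \<and> (\<forall>i\<in>L - D. \<exists>T\<subseteq>L. i \<in> T \<and> V T x)} * N ^ c
    \<le> (2 ^ card L * W) ^ card (L - D) * B ^ card (L - D)"
  using D c
proof (induction "card (L - D)" arbitrary: D c y rule: less_induct)
  case less
  let ?Z = "2 ^ card L * W"
  let ?Ext = "\<lambda>D y. {x \<in> PiE L (\<lambda>_. X). restrict x D = y \<and> (\<forall>i\<in>L - D. \<exists>T\<subseteq>L. i \<in> T \<and> V T x)}"
  have Z: "?Z \<ge> 1" using W by simp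
  have finE: "finite (?Ext D y)" for D y
    using L X by (intro finite_subset[OF _ finite_PiE[of L "\<lambda>_. X"]]) auto
  show ?case
  proof (cases c)
    case 0
    have "card (?Ext D y) \<le> card {z \<in> PiE L (\<lambda>_. X). restrict z D = y}"
      using L X by (intro card_mono finite_subset[OF _ finite_PiE[of L "\<lambda>_. X"]]) auto
    also have "\<dots> \<le> card X ^ card (L - D)" by (rule card_extensions_le[OF L less.prems(1) X(1)])
    also have "\<dots> \<le> B ^ card (L - D)" using X by (intro power_mono) auto
    also have "\<dots> \<le> ?Z ^ card (L - D) * B ^ card (L - D)" using Z by simp
    finally show ?thesis using 0 by simp
  next
    case (Suc c')
    have "card (L - D) > 0"
      using less.prems(2) Suc by auto
    then obtain i where i: "i \<in> L - D" by (metis card.empty ex_in_conv less_irrefl)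
    define Ts where "Ts = {T. T \<subseteq> L \<and> i \<in> T \<and> card T \<le> b}"
    have finTs: "finite Ts" and cardTs: "card Ts \<le> 2 ^ card L"
    proof -
      have "Ts \<subseteq> Pow L" unfolding Ts_def by auto
      then show "finite Ts" "card Ts \<le> 2 ^ card L"
        using L card_mono[of "Pow L" Ts] by (auto simp: card_Pow intro: finite_subset)
    qed
    define Y where "Y T = {z \<in> PiE (D \<union> T) (\<lambda>_. X). restrict z D = y \<and> V T z}" for T
    have finDT: "finite (D \<union> T)" if "T \<in> Ts" for T
      using that less.prems(1) L unfolding Ts_def by (auto intro: finite_subset)
    have finY: "finite (Y T)" if "T \<in> Ts" for T
      using finDT[OF that] X unfolding Y_def by (intro finite_subset[OF _ finite_PiE[of "D \<union> T" "\<lambda>_. X"]]) auto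
    have cardY: "card (Y T) * N \<le> W * B ^ card (T - D)" if T: "T \<in> Ts" for T
    proof -
      have iT: "i \<in> T" "T \<subseteq> L" using T unfolding Ts_def by auto
      let ?E = "D \<union> T - {i}"
      let ?R = "{z \<in> PiE ?E (\<lambda>_. X). restrict z D = y}"
      have finR: "finite ?R" using finDT[OF T] X by (intro finite_subset[OF _ finite_PiE[of ?E "\<lambda>_. X"]]) auto
      have "Y T \<subseteq> (\<Union>z\<in>?R. (\<lambda>v. z(i := v)) ` {v \<in> X. V T (z(i := v))})"
      proof
        fix x assume x: "x \<in> Y T"
        let ?z = "restrict x ?E"
        have zx: "?z(i := x i) = x"
          using x iT unfolding Y_def by (auto simp: fun_eq_iff PiE_iff extensional_def restrict_def)
        have "restrict ?z D = y"
        proof -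
          have "D \<subseteq> ?E" using i by auto
          then have "restrict ?z D = restrict x D" by (auto simp: fun_eq_iff restrict_def)
          then show ?thesis using x unfolding Y_def by simp
        qed
        then have "?z \<in> ?R" using x unfolding Y_def by auto
        moreover have "x \<in> (\<lambda>v. ?z(i := v)) ` {v \<in> X. V T (?z(i := v))}"
        proof (rule image_eqI)
          show "x = ?z(i := x i)" by (rule zx[symmetric])
          show "x i \<in> {v \<in> X. V T (?z(i := v))}"
            using x iT unfolding mem_Collect_eq zx Y_def by auto
        qed
        ultimately show "x \<in> (\<Union>z\<in>?R. (\<lambda>v. z(i := v)) ` {v \<in> X. V T (z(i := v))})"
          by (rule UN_I[where a = ?z and B = "\<lambda>z. (\<lambda>v. z(i := v)) ` {v \<in> X. V T (z(i := v))}"])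
      qed
      then have "card (Y T) \<le> card (\<Union>z\<in>?R. (\<lambda>v. z(i := v)) ` {v \<in> X. V T (z(i := v))})"
        by (intro card_mono finite_UN_I[OF finR] finite_imageI) (use X in auto)
      also have "\<dots> \<le> (\<Sum>z\<in>?R. card ((\<lambda>v. z(i := v)) ` {v \<in> X. V T (z(i := v))}))"
        by (rule card_UN_le[OF finR])
      also have "\<dots> \<le> (\<Sum>z\<in>?R. card {v \<in> X. V T (z(i := v))})"
        using X by (intro sum_mono card_image_le) auto
      finally have "card (Y T) * N \<le> (\<Sum>z\<in>?R. card {v \<in> X. V T (z(i := v))}) * N"
        by (rule mult_le_mono1)
      also have "\<dots> = (\<Sum>z\<in>?R. card {v \<in> X. V T (z(i := v))} * N)" by (rule sum_distrib_right)
      also have "\<dots> \<le> (\<Sum>z\<in>?R. W * B)" using hit[OF iT(2,1)] by (intro sum_mono)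
      also have "\<dots> = card ?R * (W * B)" by simp
      also have "\<dots> \<le> B ^ card (?E - D) * (W * B)"
      proof (rule mult_le_mono1)
        have "card ?R \<le> card X ^ card (?E - D)"
          using finDT[OF T] i X by (intro card_extensions_le) auto
        also have "\<dots> \<le> B ^ card (?E - D)" using X by (intro power_mono) auto
        finally show "card ?R \<le> B ^ card (?E - D)" .
      qed
      also have "\<dots> = W * B ^ Suc (card (?E - D))" by simp
      also have "Suc (card (?E - D)) = card (T - D)"
      proof -
        have "T - D = insert i (?E - D)" using i iT by auto
        moreover have "finite (?E - D)" using finDT[OF T] by auto
        ultimately show ?thesis by (metis (no_types, lifting) Diff_iff card_insert_disjoint insertI1)
      qed
      finally show ?thesis .
    qed
    have step: "card (?Ext (D \<union> T) z) * N ^ c' \<le> ?Z ^ card (L - (D \<union> T)) * B ^ card (L - (D \<union> T))"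
      and cT: "card (L - D) = card (L - (D \<union> T)) + card (T - D)" and tpos: "card (T - D) \<ge> 1"
      if T: "T \<in> Ts" for T z
    proof -
      have iT: "i \<in> T" "T \<subseteq> L" "card T \<le> b" using T unfolding Ts_def by auto
      have finT: "finite (T - D)" using finDT[OF T] by auto
      have "L - D = (L - (D \<union> T)) \<union> (T - D)" using iT by auto
      then show cT: "card (L - D) = card (L - (D \<union> T)) + card (T - D)"
        using L finT by (simp only:) (intro card_Un_disjoint; auto)
      show t1: "card (T - D) \<ge> 1" using finT i iT by (auto simp: Suc_le_eq card_gt_0_iff)
      have "card (T - D) \<le> b" using iT finDT[OF T] by (meson Diff_subset card_mono finite_Un le_trans)
      then have "c' * b < card (L - (D \<union> T)) + b"
        using less.prems(2) cT Suc by simp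
      then show "card (?Ext (D \<union> T) z) * N ^ c' \<le> ?Z ^ card (L - (D \<union> T)) * B ^ card (L - (D \<union> T))"
        using less.prems(1) iT cT t1 by (intro less.hyps) auto
    qed
    have "?Ext D y \<subseteq> (\<Union>T\<in>Ts. \<Union>z\<in>Y T. ?Ext (D \<union> T) z)"
    proof
      fix x assume x: "x \<in> ?Ext D y"
      then obtain T where T: "T \<subseteq> L" "i \<in> T" "V T x" using i by blast
      then have "T \<in> Ts" unfolding Ts_def using size by auto
      let ?z = "restrict x (D \<union> T)"
      have "V T ?z" using T(3) local_constraintsD[OF V, of T x ?z] by simp
      moreover have "restrict ?z D = y"
      proof -
        have "restrict ?z D = restrict x D" by (auto simp: fun_eq_iff)
        also have "\<dots> = y" using x by simp
        finally show ?thesis .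
      qed
      moreover have "?z \<in> PiE (D \<union> T) (\<lambda>_. X)" using x T less.prems(1) by auto
      ultimately have "?z \<in> Y T" unfolding Y_def by blast
      moreover have "x \<in> ?Ext (D \<union> T) ?z" using x by simp
      ultimately have "x \<in> (\<Union>z\<in>Y T. ?Ext (D \<union> T) z)"
        by (rule UN_I[where a = ?z and B = "?Ext (D \<union> T)"])
      then show "x \<in> (\<Union>T\<in>Ts. \<Union>z\<in>Y T. ?Ext (D \<union> T) z)"
        by (rule UN_I[where a = T and B = "\<lambda>T. \<Union>z\<in>Y T. ?Ext (D \<union> T) z", OF \<open>T \<in> Ts\<close>])
    qed
    then have "card (?Ext D y) \<le> card (\<Union>T\<in>Ts. \<Union>z\<in>Y T. ?Ext (D \<union> T) z)"
      by (intro card_mono finite_UN_I finTs finY finE)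
    also have "\<dots> \<le> (\<Sum>T\<in>Ts. card (\<Union>z\<in>Y T. ?Ext (D \<union> T) z))" by (rule card_UN_le[OF finTs])
    also have "\<dots> \<le> (\<Sum>T\<in>Ts. \<Sum>z\<in>Y T. card (?Ext (D \<union> T) z))"
      using finY by (intro sum_mono card_UN_le)
    finally have "card (?Ext D y) * N ^ c \<le> (\<Sum>T\<in>Ts. \<Sum>z\<in>Y T. card (?Ext (D \<union> T) z)) * N ^ c"
      by (rule mult_le_mono1)
    also have "\<dots> = (\<Sum>T\<in>Ts. N * (\<Sum>z\<in>Y T. card (?Ext (D \<union> T) z) * N ^ c'))"
      unfolding Suc by (simp add: sum_distrib_left sum_distrib_right mult_ac)
    also have "\<dots> \<le> (\<Sum>T\<in>Ts. W * ?Z ^ (card (L - D) - 1) * B ^ card (L - D))"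
    proof (rule sum_mono)
      fix T assume T: "T \<in> Ts"
      let ?m = "card (L - (D \<union> T))"
      have "N * (\<Sum>z\<in>Y T. card (?Ext (D \<union> T) z) * N ^ c') \<le> N * (\<Sum>z\<in>Y T. ?Z ^ ?m * B ^ ?m)"
        using step(1)[OF T] by (intro mult_le_mono2 sum_mono)
      also have "\<dots> = (card (Y T) * N) * (?Z ^ ?m * B ^ ?m)" by simp
      also have "\<dots> \<le> (W * B ^ card (T - D)) * (?Z ^ ?m * B ^ ?m)" by (rule mult_le_mono1[OF cardY[OF T]])
      also have "\<dots> = W * ?Z ^ ?m * B ^ card (L - D)" unfolding cT[OF T] by (simp only: power_add mult_ac)
      also have "\<dots> \<le> W * ?Z ^ (card (L - D) - 1) * B ^ card (L - D)"
        using Z tpos[OF T] cT[OF T] by (intro mult_le_mono1 mult_le_mono2 power_increasing) auto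
      finally show "N * (\<Sum>z\<in>Y T. card (?Ext (D \<union> T) z) * N ^ c')
          \<le> W * ?Z ^ (card (L - D) - 1) * B ^ card (L - D)" .
    qed
    also have "\<dots> = card Ts * (W * ?Z ^ (card (L - D) - 1) * B ^ card (L - D))"
      by (simp only: sum_constant of_nat_id)
    also have "\<dots> \<le> 2 ^ card L * (W * ?Z ^ (card (L - D) - 1) * B ^ card (L - D))"
      by (rule mult_le_mono1[OF cardTs])
    also have "\<dots> = ?Z ^ Suc (card (L - D) - 1) * B ^ card (L - D)" by (simp only: power_Suc mult_ac)
    also have "Suc (card (L - D) - 1) = card (L - D)" using \<open>card (L - D) > 0\<close> by simp
    finally show ?thesis .
  qed
qed

theorem abs_weight_sum_le:
  assumes V: "local_constraints V" and L: "finite L" and X: "finite X" "card X \<le> B"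
    and W: "W \<ge> 1"
    and size: "\<And>T x. V T x \<Longrightarrow> card T \<le> b"
    and hit: "\<And>T i z. T \<subseteq> L \<Longrightarrow> i \<in> T \<Longrightarrow> card {v \<in> X. V T (z(i := v))} * N \<le> W * B"
    and c: "c * b < card L + b"
  shows "\<bar>weight_sum V X L\<bar> * of_nat N ^ c \<le> of_nat (2 ^ card L * (2 ^ card L * W) ^ card L) * of_nat B ^ card L"
proof -
  let ?C = "{x \<in> PiE L (\<lambda>_. X). \<forall>i\<in>L. \<exists>T\<subseteq>L. i \<in> T \<and> V T x}"
  have fin: "finite (PiE L (\<lambda>_. X))" using L X by (intro finite_PiE) auto
  have "weight_sum V X L = (\<Sum>x\<in>?C. mobius_weight V L x)"
    unfolding weight_sum_def
  proof (rule sum.mono_neutral_right[OF fin])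
    show "\<forall>x\<in>PiE L (\<lambda>_. X) - ?C. mobius_weight V L x = 0"
    proof
      fix x assume "x \<in> PiE L (\<lambda>_. X) - ?C"
      then obtain i where i: "i \<in> L" "\<And>T. T \<subseteq> L \<Longrightarrow> i \<in> T \<Longrightarrow> \<not> V T x" by blast
      show "mobius_weight V L x = 0" by (rule mobius_weight_uncovered[where V = V and x = x, OF L i])
    qed
  qed blast
  also have "\<bar>\<dots>\<bar> \<le> (\<Sum>x\<in>?C. \<bar>mobius_weight V L x\<bar>)" by (rule sum_abs)
  also have "\<dots> \<le> (\<Sum>x\<in>?C. 2 ^ card L)" by (intro sum_mono abs_mobius_weight_le[OF L])
  also have "\<dots> = of_nat (2 ^ card L * card ?C)" by simp
  finally have "\<bar>weight_sum V X L\<bar> * of_nat N ^ c \<le> of_nat (2 ^ card L * card ?C) * of_nat N ^ c"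
    by (rule mult_right_mono) simp
  also have "\<dots> = of_nat (2 ^ card L * (card ?C * N ^ c))" by simp
  also have "\<dots> \<le> of_nat (2 ^ card L * ((2 ^ card L * W) ^ card L * B ^ card L))"
  proof -
    have "card ?C * N ^ c \<le> (2 ^ card L * W) ^ card L * B ^ card L"
    proof -
      have "?C = {x \<in> PiE L (\<lambda>_. X). restrict x {} = (\<lambda>_. undefined) \<and>
          (\<forall>i\<in>L - {}. \<exists>T\<subseteq>L. i \<in> T \<and> V T x)}"
        by (simp add: restrict_def)
      then show ?thesis
        using card_covered_extensions_le[where V = V and D = "{}" and y = "\<lambda>_. undefined" and L = L
            and N = N and X = X and B = B and W = W and b = b and c = c] V L X W size hit c by simp
    qed
    then show ?thesis unfolding of_nat_le_iff by (rule mult_le_mono2)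
  qed
  also have "\<dots> = of_nat (2 ^ card L * (2 ^ card L * W) ^ card L) * of_nat B ^ card L"
    by (simp only: of_nat_mult of_nat_power mult.assoc)
  finally show ?thesis .
qed

section \<open>Rational hyperplanes of a rational polytope\<close>

lemma of_rat_dot: "of_rat (dot J c x) = (\<Sum>j\<in>J. of_rat (c j) * of_rat (x j))"
  unfolding dot_def by (simp add: of_rat_sum of_rat_mult)

text \<open>The coefficients \<open>\<beta> t\<close> form a basis of the rational span of the \<open>a j\<close>, chosen among them one by
one. A new \<open>a i\<close> in the span of the previous ones is substituted, which gives the coordinates of \<open>a i\<close>;
otherwise it is a new basis element, and a rational relation forces \<open>x i = 0\<close>.\<close>

lemma rational_decomposition:
  fixes a :: "'a \<Rightarrow> real"
  assumes "finite J"
  shows "\<exists>m (\<beta> :: nat \<Rightarrow> real) (c :: nat \<Rightarrow> 'a \<Rightarrow> rat).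
    (\<forall>j\<in>J. a j = (\<Sum>t<m. \<beta> t * of_rat (c t j))) \<and>
    (\<forall>x. (\<Sum>j\<in>J. a j * of_rat (x j)) = 0 \<longleftrightarrow> (\<forall>t<m. dot J (c t) x = 0))"
  using assms
proof (induction J)
  case empty
  then show ?case by (intro exI[of _ 0]) (simp add: dot_def)
next
  case (insert i J)
  from insert.IH obtain m :: nat and \<beta> c where IH: "(\<forall>j\<in>J. a j = (\<Sum>t<m. \<beta> t * of_rat (c t j))) \<and>
    (\<forall>x. (\<Sum>j\<in>J. a j * of_rat (x j)) = 0 \<longleftrightarrow> (\<forall>t<m. dot J (c t) x = 0))"
    by (elim exE) (rule that, assumption)
  note 1 = IH[THEN conjunct1] and 2 = IH[THEN conjunct2, rule_format]
  have sum_ins: "(\<Sum>j\<in>insert i J. a j * of_rat (x j)) = a i * of_rat (x i) + (\<Sum>j\<in>J. a j * of_rat (x j))" for x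
    using insert by simp
  have dot_ins: "dot (insert i J) d x = d i * x i + dot J d x" for d x
    unfolding dot_def using insert by simp
  have dot_upd: "dot J (d(i := v)) x = dot J d x" for d v x
    unfolding dot_def using insert by (intro sum.cong) auto
  show ?case
  proof (cases "\<exists>r. a i = (\<Sum>j\<in>J. a j * of_rat (r j))")
    case True
    then obtain r where r: "a i = (\<Sum>j\<in>J. a j * of_rat (r j))" by blast
    let ?c = "\<lambda>t. (c t)(i := dot J (c t) r)"
    have "a i = (\<Sum>j\<in>J. \<Sum>t<m. \<beta> t * (of_rat (c t j) * of_rat (r j)))"
      unfolding r using 1 by (intro sum.cong) (auto simp: sum_distrib_left sum_distrib_right mult_ac)
    also have "\<dots> = (\<Sum>t<m. \<Sum>j\<in>J. \<beta> t * (of_rat (c t j) * of_rat (r j)))" by (rule sum.swap)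
    also have "\<dots> = (\<Sum>t<m. \<beta> t * of_rat (dot J (c t) r))"
      unfolding of_rat_dot by (simp add: sum_distrib_left)
    finally have ai: "a i = (\<Sum>t<m. \<beta> t * of_rat (dot J (c t) r))" .
    have "(\<Sum>j\<in>insert i J. a j * of_rat (x j)) = 0 \<longleftrightarrow> (\<forall>t<m. dot (insert i J) (?c t) x = 0)" for x
    proof -
      have "(\<Sum>j\<in>insert i J. a j * of_rat (x j)) = (\<Sum>j\<in>J. a j * of_rat (r j * x i + x j))"
        unfolding sum_ins unfolding r
        by (simp add: sum_distrib_left sum_distrib_right sum.distrib of_rat_add of_rat_mult algebra_simps)
      also have "\<dots> = 0 \<longleftrightarrow> (\<forall>t<m. dot J (c t) (\<lambda>j. r j * x i + x j) = 0)" by (rule 2)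
      also have "\<dots> \<longleftrightarrow> (\<forall>t<m. dot (insert i J) (?c t) x = 0)"
      proof -
        have "dot J (c t) (\<lambda>j. r j * x i + x j) = dot (insert i J) (?c t) x" for t
          unfolding dot_ins dot_upd unfolding dot_def
          by (simp add: sum.distrib sum_distrib_left sum_distrib_right algebra_simps)
        then show ?thesis by simp
      qed
      finally show ?thesis .
    qed
    moreover have "\<forall>j\<in>insert i J. a j = (\<Sum>t<m. \<beta> t * of_rat (?c t j))"
      using 1 ai insert.hyps(2) by (auto intro!: sum.cong)
    ultimately show ?thesis
      by (intro exI[of _ m] exI[of _ \<beta>] exI[of _ ?c] conjI allI)
  next
    case False
    let ?c = "\<lambda>t. if t < m then (c t)(i := 0) else (\<lambda>_. 0)(i := 1)"
    let ?\<beta> = "\<beta>(m := a i)"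
    have "\<forall>j\<in>insert i J. a j = (\<Sum>t<Suc m. ?\<beta> t * of_rat (?c t j))"
    proof
      fix j assume j: "j \<in> insert i J"
      have "(\<Sum>t<Suc m. ?\<beta> t * of_rat (?c t j))
        = (\<Sum>t<m. \<beta> t * of_rat (((c t)(i := 0)) j)) + a i * of_rat (((\<lambda>_. 0)(i := 1)) j)"
        unfolding sum.lessThan_Suc by (intro arg_cong2[where f = "(+)"] sum.cong) auto
      also have "\<dots> = a j" using 1 j insert.hyps(2) by (cases "j = i") auto
      finally show "a j = (\<Sum>t<Suc m. ?\<beta> t * of_rat (?c t j))" by simp
    qed
    moreover have "(\<Sum>j\<in>insert i J. a j * of_rat (x j)) = 0 \<longleftrightarrow>
        (\<forall>t<Suc m. dot (insert i J) (?c t) x = 0)" for x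
    proof -
      have "x i = 0" if "a i * of_rat (x i) + (\<Sum>j\<in>J. a j * of_rat (x j)) = 0"
      proof (rule ccontr)
        assume xi: "x i \<noteq> 0"
        have "a i * of_rat (x i) = (\<Sum>j\<in>J. a j * (- of_rat (x j)))"
          using that by (simp add: sum_negf eq_neg_iff_add_eq_0)
        then have "a i = (\<Sum>j\<in>J. a j * (- of_rat (x j))) / of_rat (x i)" using xi by (simp add: field_simps)
        also have "\<dots> = (\<Sum>j\<in>J. a j * of_rat (- x j / x i))"
          unfolding sum_divide_distrib by (simp add: of_rat_divide of_rat_minus)
        finally have "\<exists>r. a i = (\<Sum>j\<in>J. a j * of_rat (r j))" by (rule exI[where x = "\<lambda>j. - x j / x i"])
        with False show False by (rule notE)
      qed
      then have "(\<Sum>j\<in>insert i J. a j * of_rat (x j)) = 0 \<longleftrightarrow> x i = 0 \<and> (\<Sum>j\<in>J. a j * of_rat (x j)) = 0"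
        unfolding sum_ins by auto
      also have "\<dots> \<longleftrightarrow> x i = 0 \<and> (\<forall>t<m. dot J (c t) x = 0)" unfolding 2 ..
      also have "\<dots> \<longleftrightarrow> (\<forall>t<Suc m. dot (insert i J) (?c t) x = 0)"
      proof -
        have "dot (insert i J) (?c m) x = x i"
          unfolding dot_ins by (simp add: dot_upd) (simp add: dot_def)
        moreover have "dot (insert i J) (?c t) x = dot J (c t) x" if "t < m" for t
          unfolding dot_ins using that by (simp add: dot_upd)
        ultimately show ?thesis unfolding less_Suc_eq by auto
      qed
      finally show ?thesis .
    qed
    ultimately show ?thesis
      by (intro exI[of _ "Suc m"] exI[of _ ?\<beta>] exI[of _ ?c] conjI allI)
  qed
qed

definition rat_vec :: "('d \<Rightarrow> rat) \<Rightarrow> real ^ 'd" where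
  "rat_vec c = (\<chi> j. of_rat (c j))"

lemma parallel_if_hyperplane_subset:
  fixes a c :: "'n::euclidean_space"
  assumes "a \<noteq> 0" "c \<noteq> 0" "{x. a \<bullet> x = b} \<subseteq> {x. c \<bullet> x = d}"
  obtains l where "l \<noteq> 0" "c = l *\<^sub>R a" "d = l * b"
proof -
  define x0 where "x0 = (b / (a \<bullet> a)) *\<^sub>R a"
  define l where "l = (c \<bullet> a) / (a \<bullet> a)"
  define y where "y = c - l *\<^sub>R a"
  have x0: "a \<bullet> x0 = b" unfolding x0_def using assms by simp
  then have cx0: "c \<bullet> x0 = d" using assms by auto
  have ay: "a \<bullet> y = 0" unfolding y_def l_def using assms by (simp add: inner_diff_right inner_commute)
  then have "x0 + y \<in> {x. a \<bullet> x = b}" using x0 by (simp add: inner_add_right)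
  then have "c \<bullet> (x0 + y) = d" using assms(3) by blast
  then have "c \<bullet> y = 0" using cx0 by (simp add: inner_add_right)
  then have "y \<bullet> y = 0" using ay unfolding y_def[of] by (simp add: inner_diff_left y_def)
  then have c: "c = l *\<^sub>R a" unfolding y_def by simp
  have "d = l * b" using cx0 x0 unfolding c by simp
  then show ?thesis using that c assms(2) by (cases "l = 0") auto
qed

text \<open>The equation \<open>a \<bullet> v = b\<close> at the rational points \<open>v \<in> V\<close> splits into rational equations, which hold on
the affine hull of \<open>V\<close>, that is, on the whole hyperplane. One of them has a nonzero normal vector
and is then proportional to the given equation; a negative factor reverses the inequality.\<close>

lemma rational_halfspace:
  fixes a :: "real ^ 'd"
  assumes a: "a \<noteq> 0" and V: "\<And>v j. v \<in> V \<Longrightarrow> v $ j \<in> \<rat>"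
    and hull: "{x. a \<bullet> x = b} \<subseteq> affine hull V" and on: "\<And>v. v \<in> V \<Longrightarrow> a \<bullet> v = b"
  obtains c d where "{x. a \<bullet> x < b} = {x. rat_vec c \<bullet> x < of_rat d}"
proof -
  define \<alpha> where "\<alpha> = case_option (- b) (\<lambda>j. a $ j)"
  have sum_opt: "(\<Sum>j\<in>UNIV. f j) = f None + (\<Sum>j\<in>UNIV. f (Some j))" for f :: "'d option \<Rightarrow> real"
    by (simp add: UNIV_option_conv sum.reindex)
  have sum_opt_rat: "(\<Sum>j\<in>UNIV. f j) = f None + (\<Sum>j\<in>UNIV. f (Some j))" for f :: "'d option \<Rightarrow> rat"
    by (simp add: UNIV_option_conv sum.reindex)
  obtain m :: nat and \<beta> c where *: "(\<forall>j\<in>UNIV. \<alpha> j = (\<Sum>t<m. \<beta> t * of_rat (c t j))) \<and>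
    (\<forall>x. (\<Sum>j\<in>UNIV. \<alpha> j * of_rat (x j)) = 0 \<longleftrightarrow> (\<forall>t<m. dot UNIV (c t) x = 0))"
    using rational_decomposition[OF finite, of "UNIV :: 'd option set" \<alpha>] by (elim exE) (rule that, assumption)
  have dec: "\<alpha> j = (\<Sum>t<m. \<beta> t * of_rat (c t j))" for j
    using *[THEN conjunct1] by blast
  have zero: "dot UNIV (c t) x = 0" if "(\<Sum>j\<in>UNIV. \<alpha> j * of_rat (x j)) = 0" "t < m" for x t
    using *[THEN conjunct2] that by blast
  define A where "A t = rat_vec (\<lambda>j. c t (Some j))" for t
  define e where "e t = - c t None" for t
  have on': "A t \<bullet> v = of_rat (e t)" if "t < m" "v \<in> V" for t v
  proof -
    have "\<forall>j. \<exists>r. v $ j = of_rat r" using V[OF that(2)] by (metis Rats_cases)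
    then obtain r where r: "\<And>j. v $ j = of_rat (r j)" by metis
    have "(\<Sum>j\<in>UNIV. \<alpha> j * of_rat (case_option 1 r j)) = - b + a \<bullet> v"
      unfolding sum_opt \<alpha>_def inner_vec_def by (simp add: r)
    then have "dot UNIV (c t) (case_option 1 r) = 0" using zero on[OF that(2)] that(1) by simp
    then have "c t None + (\<Sum>j\<in>UNIV. c t (Some j) * r j) = 0"
      unfolding dot_def sum_opt_rat by simp
    then have "of_rat (c t None + (\<Sum>j\<in>UNIV. c t (Some j) * r j)) = (0 :: real)" by simp
    then show ?thesis
      unfolding A_def e_def rat_vec_def inner_vec_def
      by (simp add: of_rat_add of_rat_sum of_rat_mult of_rat_minus r)
  qed
  have "\<exists>t<m. A t \<noteq> 0"
  proof (rule ccontr)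
    assume "\<not> ?thesis"
    then have z: "of_rat (c t (Some j)) = (0::real)" if "t < m" for t j
      using that unfolding A_def rat_vec_def by (auto simp: vec_eq_iff)
    have "a $ j = 0" for j
      using dec[of "Some j"] z unfolding \<alpha>_def by simp
    then show False using a by (simp add: vec_eq_iff)
  qed
  then obtain t where t: "t < m" "A t \<noteq> 0" by blast
  have "affine hull V \<subseteq> {x. A t \<bullet> x = of_rat (e t)}"
    using on'[OF t(1)] by (intro hull_minimal affine_hyperplane) auto
  then have "{x. a \<bullet> x = b} \<subseteq> {x. A t \<bullet> x = of_rat (e t)}" using hull by blast
  then obtain l where l: "l \<noteq> 0" "A t = l *\<^sub>R a" "of_rat (e t) = l * b"
    using parallel_if_hyperplane_subset[OF a t(2)] by metis
  show thesis
  proof (cases "l > 0")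
    case True
    have "{x. a \<bullet> x < b} = {x. A t \<bullet> x < of_rat (e t)}" unfolding l(2,3) using True by simp
    then show thesis using that unfolding A_def by blast
  next
    case False
    then have "l < 0" using l by simp
    have "rat_vec (\<lambda>j. - c t (Some j)) = - A t" unfolding A_def rat_vec_def by (simp add: vec_eq_iff of_rat_minus)
    moreover have "{x. a \<bullet> x < b} = {x. - A t \<bullet> x < of_rat (- e t)}"
      unfolding of_rat_minus l(2,3) using \<open>l < 0\<close> by simp
    ultimately show thesis using that by metis
  qed
qed

text \<open>Each facet is the convex hull of extreme points of \<open>P\<close>, and since \<open>P\<close> is full-dimensional they
span the supporting hyperplane of the facet.\<close>

theorem interior_rational_polytope:
  fixes P :: "(real ^ 'd) set"
  assumes P: "rational_polytope P" and full: "aff_dim P = int CARD('d)"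
  obtains G where "finite G" "interior P = {x. \<forall>(c, d)\<in>G. rat_vec c \<bullet> x < of_rat d}"
proof -
  have poly: "polytope P" and rat: "\<And>v j. v extreme_point_of P \<Longrightarrow> v $ j \<in> \<rat>"
    using P unfolding rational_polytope_def by auto
  have hullP: "affine hull P = UNIV" using full aff_dim_eq_full[of P] by simp
  obtain F where F: "finite F" "P = affine hull P \<inter> \<Inter>F"
    "\<forall>h\<in>F. \<exists>a b. a \<noteq> 0 \<and> h = {x. a \<bullet> x \<le> b}"
    "\<forall>F'. F' \<subset> F \<longrightarrow> P \<subset> affine hull P \<inter> \<Inter>F'"
    using polytope_imp_polyhedron[OF poly] unfolding polyhedron_Int_affine_minimal by auto
  obtain a b where ab: "\<And>h. h \<in> F \<Longrightarrow> a h \<noteq> 0 \<and> h = {x. a h \<bullet> x \<le> b h}"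
    using F(3) by metis
  have psub: "\<And>F'. F' \<subset> F \<Longrightarrow> P \<subset> affine hull P \<inter> \<Inter>F'"
    by (rule F(4)[rule_format])
  have "rel_interior P = {x \<in> P. \<forall>h\<in>F. a h \<bullet> x < b h}"
    by (rule rel_interior_polyhedron_explicit[where F = F and a = a and b = b])
      (rule F(1), rule F(2), rule ab, assumption, rule psub, assumption)
  then have "interior P = {x \<in> P. \<forall>h\<in>F. a h \<bullet> x < b h}"
    using rel_interior_interior[OF hullP] by simp
  also have "\<dots> = {x. \<forall>h\<in>F. a h \<bullet> x < b h}"
  proof -
    have "x \<in> P" if x: "\<forall>h\<in>F. a h \<bullet> x < b h" for x
    proof -
      have "x \<in> h" if h: "h \<in> F" for h
      proof -
        have "h = {x. a h \<bullet> x \<le> b h}" using ab[OF h] by blast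
        moreover have "a h \<bullet> x \<le> b h" using x h by (simp add: less_imp_le)
        ultimately show ?thesis by blast
      qed
      then have "x \<in> affine hull P \<inter> \<Inter>F" using hullP by auto
      then show ?thesis using F(2) by blast
    qed
    then show ?thesis by blast
  qed
  finally have int: "interior P = {x. \<forall>h\<in>F. a h \<bullet> x < b h}" .
  have "\<exists>c d. {x. a h \<bullet> x < b h} = {x. rat_vec c \<bullet> x < of_rat d}" if h: "h \<in> F" for h
  proof -
    define C where "C = P \<inter> {x. a h \<bullet> x = b h}"
    have C: "C facet_of P"
    proof (rule facet_of_polyhedron_explicit[where F = F and a = a and b = b, THEN iffD2])
      show "\<exists>h. h \<in> F \<and> C = P \<inter> {x. a h \<bullet> x = b h}" using h unfolding C_def by blast
    qed (rule F(1), rule F(2), rule ab, assumption, rule psub, assumption)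
    then have face: "C face_of P" and dim: "aff_dim C = aff_dim P - 1" and ne: "C \<noteq> {}"
      unfolding facet_of_def by auto
    define V where "V = {v. v extreme_point_of C}"
    have CV: "C = convex hull V"
      unfolding V_def
      by (rule Krein_Milman_Minkowski)
        (use face poly in \<open>auto intro: face_of_imp_compact face_of_imp_convex polytope_imp_compact polytope_imp_convex\<close>)
    have a: "a h \<noteq> 0" using ab[OF h] by blast
    have "affine hull C = {x. a h \<bullet> x = b h}"
    proof (rule affine_dim_equal)
      show "affine hull C \<subseteq> {x. a h \<bullet> x = b h}"
        unfolding C_def by (intro hull_minimal affine_hyperplane) auto
      show "aff_dim (affine hull C) = aff_dim {x. a h \<bullet> x = b h}"
        using a dim full by (simp add: aff_dim_hyperplane)
    qed (use ne in \<open>auto simp: affine_hyperplane\<close>)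
    then have "{x. a h \<bullet> x = b h} \<subseteq> affine hull V"
      unfolding CV by simp
    moreover have "v $ j \<in> \<rat>" if "v \<in> V" for v j
      using that face rat extreme_point_of_face[OF face] unfolding V_def by blast
    moreover have "a h \<bullet> v = b h" if "v \<in> V" for v
      using that hull_inc[of v V convex] CV unfolding C_def by blast
    ultimately show ?thesis using rational_halfspace[OF a, of V "b h"] by metis
  qed
  then obtain c d where cd: "\<And>h. h \<in> F \<Longrightarrow> {x. a h \<bullet> x < b h} = {x. rat_vec (c h) \<bullet> x < of_rat (d h)}"
    by metis
  show thesis
  proof (rule that[of "(\<lambda>h. (c h, d h)) ` F"])
    show "finite ((\<lambda>h. (c h, d h)) ` F)" using F(1) by simp
    have "interior P = (\<Inter>h\<in>F. {x. a h \<bullet> x < b h})" unfolding int by auto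
    also have "\<dots> = (\<Inter>h\<in>F. {x. rat_vec (c h) \<bullet> x < of_rat (d h)})" using cd by simp
    finally show "interior P = {x. \<forall>(c, d)\<in>(\<lambda>h. (c h, d h)) ` F. rat_vec c \<bullet> x < of_rat d}" by auto
  qed
qed

text \<open>An open box inside the product has its sides inside the factors.\<close>

lemma interior_of_PiE:
  assumes "finite I"
  shows "product_topology (\<lambda>_. euclidean) I interior_of PiE I (\<lambda>_. T :: (real ^ 'd) set) = PiE I (\<lambda>_. interior T)"
proof (rule interior_of_unique)
  show "PiE I (\<lambda>_. interior T) \<subseteq> PiE I (\<lambda>_. T)" by (intro PiE_mono interior_subset)
  show "openin (product_topology (\<lambda>_. euclidean) I) (PiE I (\<lambda>_. interior T))"
    using assms by (simp add: openin_PiE)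
  fix U assume U: "U \<subseteq> PiE I (\<lambda>_. T)" "openin (product_topology (\<lambda>_. euclidean) I) U"
  show "U \<subseteq> PiE I (\<lambda>_. interior T)"
  proof
    fix x assume x: "x \<in> U"
    then obtain W where W: "x \<in> PiE I W" "\<And>i. open (W i)" "PiE I W \<subseteq> U"
      using product_topology_open_contains_basis[OF U(2)] by (metis open_openin)
    have "PiE I W \<subseteq> PiE I (\<lambda>_. T)" using W(3) U(1) by blast
    then have "\<forall>i\<in>I. W i \<subseteq> T" using W(1) unfolding subset_PiE by blast
    then show "x \<in> PiE I (\<lambda>_. interior T)"
      using W(1,2) by (auto simp: PiE_iff intro!: interiorI[of "W _"])
  qed
qed

lemma dilate_PiE: "dilate q n (PiE {1..q} (\<lambda>_. P)) = PiE {1..q} (\<lambda>_. (*\<^sub>R) (real n) ` P)"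
proof (intro equalityI subsetI)
  fix x assume "x \<in> dilate q n (PiE {1..q} (\<lambda>_. P))"
  then show "x \<in> PiE {1..q} (\<lambda>_. (*\<^sub>R) (real n) ` P)" unfolding dilate_def by auto
next
  fix x assume x: "x \<in> PiE {1..q} (\<lambda>_. (*\<^sub>R) (real n) ` P)"
  then have "\<forall>i\<in>{1..q}. \<exists>y\<in>P. x i = real n *\<^sub>R y" by auto
  then obtain y where y: "\<And>i. i \<in> {1..q} \<Longrightarrow> y i \<in> P \<and> x i = real n *\<^sub>R y i" by metis
  have "x = (\<lambda>i\<in>{1..q}. real n *\<^sub>R restrict y {1..q} i)"
    using x y by (auto simp: fun_eq_iff PiE_iff extensional_def)
  moreover have "restrict y {1..q} \<in> PiE {1..q} (\<lambda>_. P)" using y by auto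
  ultimately show "x \<in> dilate q n (PiE {1..q} (\<lambda>_. P))" unfolding dilate_def by blast
qed

definition interior_lattice_points :: "(real ^ 'd) set \<Rightarrow> nat \<Rightarrow> (real ^ 'd) set" where
  "interior_lattice_points P n = {v. (\<forall>j. v $ j \<in> \<int>) \<and> v \<in> (*\<^sub>R) (real n) ` interior P}"

lemma lattice_points_interior_dilate:
  assumes "n \<ge> 1"
  shows "lattice_points q \<inter> (copies_topology q interior_of dilate q n (PiE {1..q} (\<lambda>_. P)))
    = PiE {1..q} (\<lambda>_. interior_lattice_points P n)"
proof -
  have "interior ((*\<^sub>R) (real n) ` P) = (*\<^sub>R) (real n) ` interior P"
    using assms by (intro interior_injective_linear_image) (auto intro: injI linear_scaleR)
  then show ?thesis
    unfolding copies_topology_def dilate_PiE interior_of_PiE[OF finite_atLeastAtMost]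
    unfolding lattice_points_def interior_lattice_points_def copies_def by (auto simp: PiE_iff)
qed

section \<open>Lattice points of the dilates and the volume\<close>

definition int_box :: "nat \<Rightarrow> (real ^ 'd) set" where
  "int_box M = {v. \<forall>j. v $ j \<in> \<int> \<and> \<bar>v $ j\<bar> \<le> real M}"

lemma finite_int_box: "finite (int_box M :: (real ^ 'd) set)"
  and card_int_box_le: "card (int_box M :: (real ^ 'd) set) \<le> (2 * M + 1) ^ CARD('d)"
proof -
  let ?F = "PiE (UNIV :: 'd set) (\<lambda>_. {- int M..int M})"
  let ?h = "\<lambda>f. (\<chi> j. real_of_int (f j)) :: real ^ 'd"
  have sub: "int_box M \<subseteq> ?h ` ?F"
  proof
    fix v :: "real ^ 'd" assume v: "v \<in> int_box M"
    have "v = ?h (\<lambda>j. \<lfloor>v $ j\<rfloor>)"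
      using v unfolding int_box_def by (auto simp: vec_eq_iff)
    moreover have "(\<lambda>j. \<lfloor>v $ j\<rfloor>) \<in> ?F"
    proof
      fix j :: 'd
      obtain m where "v $ j = of_int m" using v unfolding int_box_def by (blast elim: Ints_cases)
      moreover have "\<bar>v $ j\<bar> \<le> real M" using v unfolding int_box_def by blast
      ultimately show "\<lfloor>v $ j\<rfloor> \<in> {- int M..int M}" by (simp add: abs_le_iff)
    qed simp
    ultimately show "v \<in> ?h ` ?F" by (rule image_eqI)
  qed
  have fin: "finite ?F" by (intro finite_PiE) auto
  show "finite (int_box M :: (real ^ 'd) set)" using sub fin by (meson finite_imageI finite_subset)
  have "card (int_box M :: (real ^ 'd) set) \<le> card (?h ` ?F)" by (rule card_mono[OF finite_imageI[OF fin] sub])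
  also have "\<dots> \<le> card ?F" by (rule card_image_le[OF fin])
  also have "\<dots> = (2 * M + 1) ^ CARD('d)" by (simp add: card_PiE nat_add_distrib nat_mult_distrib)
  finally show "card (int_box M :: (real ^ 'd) set) \<le> (2 * M + 1) ^ CARD('d)" .
qed

text \<open>If \<open>a $ j \<noteq> 0\<close>, a point of the hyperplane is determined by its coordinates other than the \<open>j\<close>-th.
Overwriting the \<open>j\<close>-th coordinate by the \<open>2 M + 1\<close> possible values is therefore injective.\<close>

lemma card_int_box_hyperplane_le:
  fixes a :: "real ^ 'd"
  assumes "a \<noteq> 0"
  shows "card {v \<in> int_box M. a \<bullet> v = s} * (2 * M + 1) \<le> (2 * M + 1) ^ CARD('d)"
proof -
  obtain j where j: "a $ j \<noteq> 0" using assms by (auto simp: vec_eq_iff)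
  let ?S = "{v \<in> int_box M. a \<bullet> v = s}" and ?I = "{- int M..int M}"
  let ?h = "\<lambda>(v, t). (\<chi> k. if k = j then real_of_int t else v $ k) :: real ^ 'd"
  have inj: "inj_on ?h (?S \<times> ?I)"
  proof (rule inj_onI)
    fix p p' assume p: "p \<in> ?S \<times> ?I" "p' \<in> ?S \<times> ?I" "?h p = ?h p'"
    obtain v t v' t' where pv: "p = (v, t)" "p' = (v', t')" by fastforce
    have v: "a \<bullet> v = a \<bullet> v'"
      and eq: "(\<chi> k. if k = j then real_of_int t else v $ k) = (\<chi> k. if k = j then real_of_int t' else v' $ k)"
      using p unfolding pv by simp_all
    have eqk: "(if k = j then real_of_int t else v $ k) = (if k = j then real_of_int t' else v' $ k)" for k
      using eq by (simp add: vec_eq_iff)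
    have off: "v $ k = v' $ k" if "k \<noteq> j" for k using eqk[of k] that by simp
    have "a \<bullet> v = a $ j * v $ j + (\<Sum>k\<in>UNIV - {j}. a $ k * v $ k)" for v
      unfolding inner_vec_def by (simp add: sum.remove[of UNIV j])
    then have "a $ j * v $ j = a $ j * v' $ j" using v off by simp
    then have "v $ j = v' $ j" using j by simp
    then have "v = v'" using off by (metis vec_eq_iff)
    moreover have "t = t'" using eqk[of j] by simp
    ultimately show "p = p'" unfolding pv by blast
  qed
  have "?h ` (?S \<times> ?I) \<subseteq> int_box M"
    unfolding int_box_def by (auto simp: abs_le_iff)
  then have "card (?S \<times> ?I) \<le> card (int_box M :: (real ^ 'd) set)"
    by (rule card_inj_on_le[OF inj _ finite_int_box])
  also have "card (?S \<times> ?I) = card ?S * (2 * M + 1)"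
    by (simp add: card_cartesian_product nat_add_distrib nat_mult_distrib)
  finally show ?thesis using card_int_box_le[of M, where 'd = 'd] by linarith
qed

lemma interior_lattice_points_subset_int_box:
  assumes "bounded P"
  shows "\<exists>C::nat. \<forall>n. interior_lattice_points P n \<subseteq> int_box (C * n)"
proof -
  obtain r where r: "\<And>v. v \<in> P \<Longrightarrow> norm v \<le> r" using assms unfolding bounded_iff by blast
  obtain C :: nat where C: "r \<le> real C" using real_arch_simple by blast
  have "interior_lattice_points P n \<subseteq> int_box (C * n)" for n
  proof
    fix v assume v: "v \<in> interior_lattice_points P n"
    then obtain x where x: "x \<in> interior P" "v = real n *\<^sub>R x" unfolding interior_lattice_points_def by blast
    have "\<bar>x $ j\<bar> \<le> real C" for j
      using component_le_norm_cart[of x j] r[of x] x(1) interior_subset C by fastforce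
    then have "\<bar>v $ j\<bar> \<le> real (C * n)" for j
      unfolding x(2) by (simp add: abs_mult mult.commute[of "real C"] mult_left_mono)
    then show "v \<in> int_box (C * n)" using v unfolding interior_lattice_points_def int_box_def by blast
  qed
  then show ?thesis by blast
qed

text \<open>The half-open cube of side \<open>1 / n\<close> whose smallest corner is \<open>z / n\<close>.\<close>

definition grid_cube :: "nat \<Rightarrow> real ^ 'd \<Rightarrow> (real ^ 'd) set" where
  "grid_cube n z = {x. \<forall>j. z $ j \<le> real n * x $ j \<and> real n * x $ j < z $ j + 1}"

definition grid_floor :: "nat \<Rightarrow> real ^ 'd \<Rightarrow> real ^ 'd" where
  "grid_floor n x = (\<chi> j. of_int \<lfloor>real n * x $ j\<rfloor>)"

lemma borel_grid_cube: "grid_cube n z \<in> sets borel"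
proof -
  have "grid_cube n z = (\<Inter>j. {x. z $ j \<le> real n * x $ j} \<inter> {x. real n * x $ j < z $ j + 1})"
    unfolding grid_cube_def by auto
  also have "\<dots> \<in> sets borel"
  proof (intro sets.finite_INT sets.Int)
    fix j :: 'a
    show "{x. z $ j \<le> real n * x $ j} \<in> sets borel"
      by (intro borel_closed closed_Collect_le continuous_intros)
    show "{x. real n * x $ j < z $ j + 1} \<in> sets borel"
      by (intro borel_open open_Collect_less continuous_intros)
  qed auto
  finally show ?thesis .
qed

lemma measure_grid_cube:
  fixes z :: "real ^ 'd"
  assumes "n \<ge> 1"
  shows "measure lebesgue (grid_cube n z) = (1 / real n) ^ CARD('d)"
    and "integrable lebesgue (indicat_real (grid_cube n z))"
proof -
  let ?a = "(\<chi> j. z $ j / real n) :: real ^ 'd" and ?b = "(\<chi> j. (z $ j + 1) / real n) :: real ^ 'd"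
  have n: "real n > 0" using assms by simp
  have 1: "box ?a ?b \<subseteq> grid_cube n z"
    unfolding grid_cube_def using n by (auto simp: mem_box_cart field_simps intro: less_imp_le)
  have 2: "grid_cube n z \<subseteq> cbox ?a ?b"
  proof
    fix x assume "x \<in> grid_cube n z"
    then have "z $ j \<le> real n * x $ j" "real n * x $ j \<le> z $ j + 1" for j
      unfolding grid_cube_def by (auto intro: less_imp_le)
    then show "x \<in> cbox ?a ?b" using n by (simp add: mem_box_cart field_simps)
  qed
  have lm: "grid_cube n z \<in> lmeasurable"
    by (rule bounded_set_imp_lmeasurable[OF bounded_subset[OF bounded_cbox 2]])
      (rule sets_completionI_sets, simp add: borel_grid_cube)
  have c: "measure lebesgue (cbox ?a ?b) = (1 / real n) ^ CARD('d)"
  proof -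
    have "cbox ?a ?b \<noteq> {}" using n by (auto simp: interval_ne_empty_cart divide_right_mono)
    then have "measure lborel (cbox ?a ?b) = (\<Prod>j\<in>UNIV. ?b $ j - ?a $ j)" by (rule content_cbox_cart)
    also have "\<dots> = (1 / real n) ^ CARD('d)" by (simp flip: diff_divide_distrib)
    finally show ?thesis by simp
  qed
  have "measure lebesgue (box ?a ?b) = measure lebesgue (cbox ?a ?b)"
  proof -
    have "?a \<bullet> b \<le> ?b \<bullet> b" if "b \<in> Basis" for b
      using that n by (auto simp: Basis_vec_def inner_axis divide_right_mono)
    then have "measure lborel (box ?a ?b) = measure lborel (cbox ?a ?b)"
      unfolding measure_lborel_box_eq measure_lborel_cbox_eq by simp
    then show ?thesis by simp
  qed
  moreover have "measure lebesgue (box ?a ?b) \<le> measure lebesgue (grid_cube n z)"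
    using 1 lm by (intro measure_mono_fmeasurable) auto
  moreover have "measure lebesgue (grid_cube n z) \<le> measure lebesgue (cbox ?a ?b)"
    using 2 lm by (intro measure_mono_fmeasurable) (auto simp: fmeasurableD)
  ultimately show "measure lebesgue (grid_cube n z) = (1 / real n) ^ CARD('d)" using c by simp
  show "integrable lebesgue (indicat_real (grid_cube n z))"
    using lm by (simp add: lmeasurable_iff_integrable)
qed

lemma grid_cube_iff_grid_floor:
  assumes "\<And>j. z $ j \<in> \<int>"
  shows "x \<in> grid_cube n z \<longleftrightarrow> z = grid_floor n x"
proof -
  have "z $ j \<le> real n * x $ j \<and> real n * x $ j < z $ j + 1 \<longleftrightarrow> z $ j = of_int \<lfloor>real n * x $ j\<rfloor>" for j
  proof -
    obtain m where "z $ j = of_int m" using assms[of j] by (blast elim: Ints_cases)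
    then show ?thesis by (metis floor_eq_iff of_int_eq_iff)
  qed
  then show ?thesis unfolding grid_cube_def grid_floor_def by (auto simp: vec_eq_iff)
qed

text \<open>The cubes with integral \<open>z\<close> partition the space, so \<open>x\<close> lies in exactly one of them, the one that
belongs to \<open>grid_floor n x\<close>.\<close>

lemma sum_indicator_grid_cubes:
  assumes "bounded P" "n \<ge> 1"
  shows "(\<Sum>z\<in>interior_lattice_points P n. indicat_real (grid_cube n z) x)
    = indicat_real (interior P) ((1 / real n) *\<^sub>R grid_floor n x)"
proof -
  let ?X = "interior_lattice_points P n"
  obtain C :: nat where "\<forall>n. interior_lattice_points P n \<subseteq> int_box (C * n)"
    using interior_lattice_points_subset_int_box[OF assms(1)] by (rule exE)
  then have "?X \<subseteq> int_box (C * n)" by (rule spec)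
  then have fin: "finite ?X" by (rule finite_subset[OF _ finite_int_box])
  have "(\<Sum>z\<in>?X. indicat_real (grid_cube n z) x) = (\<Sum>z\<in>?X. if z = grid_floor n x then 1 else 0)"
    by (intro sum.cong refl) (simp add: grid_cube_iff_grid_floor interior_lattice_points_def indicator_def)
  also have "\<dots> = indicat_real ?X (grid_floor n x)" using fin by (simp add: indicator_def)
  also have "grid_floor n x \<in> ?X \<longleftrightarrow> (1 / real n) *\<^sub>R grid_floor n x \<in> interior P"
  proof -
    have "grid_floor n x $ j \<in> \<int>" for j unfolding grid_floor_def by simp
    moreover have "grid_floor n x \<in> (*\<^sub>R) (real n) ` interior P \<longleftrightarrow> (1 / real n) *\<^sub>R grid_floor n x \<in> interior P"
      using assms(2) by (force simp: image_iff)
    ultimately show ?thesis unfolding interior_lattice_points_def by blast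
  qed
  then have "indicat_real ?X (grid_floor n x) = indicat_real (interior P) ((1 / real n) *\<^sub>R grid_floor n x)"
    by (simp add: indicator_def)
  finally show ?thesis .
qed

lemma grid_floor_close: "n \<ge> 1 \<Longrightarrow> \<bar>((1 / real n) *\<^sub>R grid_floor n x) $ j - x $ j\<bar> \<le> 1 / real n"
proof -
  assume n: "n \<ge> 1"
  have "\<bar>of_int \<lfloor>real n * x $ j\<rfloor> - real n * x $ j\<bar> \<le> 1" by linarith
  then have "\<bar>(of_int \<lfloor>real n * x $ j\<rfloor> - real n * x $ j) / real n\<bar> \<le> 1 / real n"
    using n by (simp add: divide_right_mono abs_divide)
  then show ?thesis using n unfolding grid_floor_def by (simp add: diff_divide_distrib)
qed

lemma grid_floor_tendsto: "(\<lambda>n. (1 / real (Suc n)) *\<^sub>R grid_floor (Suc n) x) \<longlonglongrightarrow> x"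
proof (rule vec_tendstoI)
  fix j
  have "(\<lambda>n. ((1 / real (Suc n)) *\<^sub>R grid_floor (Suc n) x) $ j - x $ j) \<longlonglongrightarrow> 0"
    by (rule Lim_null_comparison[OF _ LIMSEQ_inverse_real_of_nat])
      (use grid_floor_close[of "Suc _" x j] in \<open>simp add: inverse_eq_divide\<close>)
  then show "(\<lambda>n. ((1 / real (Suc n)) *\<^sub>R grid_floor (Suc n) x) $ j) \<longlonglongrightarrow> x $ j"
    by (rule LIM_zero_cancel)
qed

text \<open>The left side is the integral of the indicator function of \<open>interior P\<close> evaluated at the grid point
below \<open>x\<close>. These functions converge to the indicator function off the frontier, which is negligible
by convexity, and they vanish outside a common box.\<close>

theorem interior_lattice_points_asymptotics:
  fixes P :: "(real ^ 'd) set"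
  assumes bdd: "bounded P" and conv: "convex P"
  shows "(\<lambda>n. real (card (interior_lattice_points P n)) / real n ^ CARD('d)) \<longlonglongrightarrow> measure lebesgue P"
proof -
  define g where "g n x = (\<Sum>z\<in>interior_lattice_points P (Suc n). indicat_real (grid_cube (Suc n) z) x)" for n x
  have geq: "g n x = indicat_real (interior P) ((1 / real (Suc n)) *\<^sub>R grid_floor (Suc n) x)" for n x
    unfolding g_def by (rule sum_indicator_grid_cubes[OF bdd]) simp
  have neg: "negligible (frontier P)" by (rule negligible_convex_frontier[OF conv])
  obtain r where r: "\<And>v. v \<in> P \<Longrightarrow> norm v \<le> r" using bdd unfolding bounded_iff by blast
  define Q where "Q = cbox (\<chi> j. - (r + 1)) ((\<chi> j. r + 1) :: real ^ 'd)"
  have intg: "integrable lebesgue (g n)" for n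
    unfolding g_def by (intro Bochner_Integration.integrable_sum measure_grid_cube(2)) simp
  have val: "integral\<^sup>L lebesgue (g n) = real (card (interior_lattice_points P (Suc n))) / real (Suc n) ^ CARD('d)" for n
  proof -
    have "integral\<^sup>L lebesgue (g n) =
        (\<Sum>z\<in>interior_lattice_points P (Suc n). integral\<^sup>L lebesgue (indicat_real (grid_cube (Suc n) z)))"
      unfolding g_def by (intro Bochner_Integration.integral_sum measure_grid_cube(2)) simp
    also have "\<dots> = (\<Sum>z\<in>interior_lattice_points P (Suc n). (1 / real (Suc n)) ^ CARD('d))"
      using measure_grid_cube(1)[of "Suc n", where 'd = 'd] by (intro sum.cong refl) simp
    finally show ?thesis by (simp add: power_divide)
  qed
  have "(\<lambda>n. integral\<^sup>L lebesgue (g n)) \<longlonglongrightarrow> integral\<^sup>L lebesgue (indicat_real (interior P))"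
  proof (rule integral_dominated_convergence[where w = "indicat_real Q"])
    show "indicat_real (interior P) \<in> borel_measurable lebesgue"
      by (rule borel_measurable_indicator, rule sets_completionI_sets) simp
    show "g n \<in> borel_measurable lebesgue" for n using intg by (rule borel_measurable_integrable)
    show "integrable lebesgue (indicat_real Q)"
      unfolding Q_def by (rule lmeasurable_iff_integrable[THEN iffD1, OF lmeasurable_cbox])
    have "frontier P \<in> null_sets lebesgue" using neg by (simp add: negligible_iff_null_sets)
    then have "AE x in lebesgue. x \<notin> frontier P" by (rule AE_not_in)
    then show "AE x in lebesgue. (\<lambda>n. g n x) \<longlonglongrightarrow> indicat_real (interior P) x"
    proof (rule AE_mp, intro AE_I2 impI)
      fix x :: "real ^ 'd" assume "x \<notin> frontier P"
      then consider "x \<in> interior P" | "x \<in> - closure P" unfolding frontier_def by auto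
      then show "(\<lambda>n. g n x) \<longlonglongrightarrow> indicat_real (interior P) x"
      proof cases
        case 1
        then have "\<forall>\<^sub>F n in sequentially. (1 / real (Suc n)) *\<^sub>R grid_floor (Suc n) x \<in> interior P"
          by (intro topological_tendstoD[OF grid_floor_tendsto]) auto
        then have "\<forall>\<^sub>F n in sequentially. g n x = indicat_real (interior P) x"
          by eventually_elim (use 1 in \<open>simp add: geq\<close>)
        then show ?thesis by (rule tendsto_eventually)
      next
        case 2
        then have "\<forall>\<^sub>F n in sequentially. (1 / real (Suc n)) *\<^sub>R grid_floor (Suc n) x \<in> - closure P"
          by (intro topological_tendstoD[OF grid_floor_tendsto]) auto
        then have "\<forall>\<^sub>F n in sequentially. g n x = indicat_real (interior P) x"
        proof eventually_elim
          case (elim n)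
          have "interior P \<subseteq> closure P" using interior_subset closure_subset by blast
          then show ?case using elim 2 unfolding geq by (auto simp: indicator_def)
        qed
        then show ?thesis by (rule tendsto_eventually)
      qed
    qed
    show "AE x in lebesgue. norm (g n x) \<le> indicat_real Q x" for n
    proof (rule AE_I2)
      fix x :: "real ^ 'd"
      show "norm (g n x) \<le> indicat_real Q x"
      proof (cases "(1 / real (Suc n)) *\<^sub>R grid_floor (Suc n) x \<in> interior P")
        case True
        let ?y = "(1 / real (Suc n)) *\<^sub>R grid_floor (Suc n) x"
        have "?y \<in> P" using True interior_subset by blast
        have bound: "\<bar>x $ j\<bar> \<le> r + 1" for j
        proof -
          have "\<bar>?y $ j\<bar> \<le> r" using r[OF \<open>?y \<in> P\<close>] component_le_norm_cart[of ?y j] by linarith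
          moreover have "\<bar>?y $ j - x $ j\<bar> \<le> 1"
            using grid_floor_close[of "Suc n" x j] by (rule order_trans) simp_all
          ultimately show ?thesis by linarith
        qed
        have "- (r + 1) \<le> x $ j \<and> x $ j \<le> r + 1" for j
          using bound[of j] unfolding abs_le_iff by linarith
        then have "x \<in> Q" unfolding Q_def mem_box_cart by simp
        then show ?thesis unfolding geq by (simp add: indicator_def)
      next
        case False
        then show ?thesis unfolding geq by simp
      qed
    qed
  qed
  then have "(\<lambda>n. real (card (interior_lattice_points P (Suc n))) / real (Suc n) ^ CARD('d)) \<longlonglongrightarrow> measure lebesgue (interior P)"
    unfolding val by simp
  then have "(\<lambda>n. real (card (interior_lattice_points P n)) / real n ^ CARD('d)) \<longlonglongrightarrow> measure lebesgue (interior P)"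
    by (rule LIMSEQ_imp_Suc)
  then show ?thesis using measure_interior[OF bdd neg] by simp
qed

section \<open>Two-level quasi-polynomials from binomial expansions\<close>

lemma poly_ge_lead_coeff_eventually:
  fixes p :: "rat poly"
  assumes "lead_coeff p > 0"
  shows "\<exists>x0. \<forall>x\<ge>x0. poly p x \<ge> lead_coeff p"
  using assms
proof (induction p)
  case 0
  then show ?case by simp
next
  case (pCons a q)
  show ?case
  proof (cases "q = 0")
    case True
    then show ?thesis by simp
  next
    case False
    define l where "l = lead_coeff q"
    have l: "l > 0" "lead_coeff (pCons a q) = l" using pCons.prems False unfolding l_def by auto
    obtain x0 where x0: "\<forall>x\<ge>x0. poly q x \<ge> l" using pCons.IH l unfolding l_def by auto
    show ?thesis
    proof (intro exI[of _ "max x0 (1 + \<bar>a\<bar> / l)"] allI impI)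
      fix x assume x: "max x0 (1 + \<bar>a\<bar> / l) \<le> x"
      have "0 \<le> \<bar>a\<bar> / l" using l by simp
      then have x1: "x \<ge> 1 + \<bar>a\<bar> / l" "x \<ge> 0" using x by (auto simp: max_def split: if_splits)
      have "l + \<bar>a\<bar> = (1 + \<bar>a\<bar> / l) * l" using l by (simp add: field_simps)
      also have "\<dots> \<le> x * l" using x1 l by (intro mult_right_mono) auto
      also have "\<dots> \<le> x * poly q x" using x0 x x1 by (intro mult_left_mono) auto
      finally have "l \<le> a + x * poly q x" by (simp add: abs_if split: if_splits)
      then show "lead_coeff (pCons a q) \<le> poly (pCons a q) x" unfolding l by simp
    qed
  qed
qed

text \<open>Otherwise \<open>x ^ c * p\<close> minus \<open>C x ^ D\<close> has the leading coefficient of \<open>p\<close>, and its sign at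
large arguments of the residue class contradicts the bound.\<close>

lemma degree_le_of_growth:
  fixes p :: "rat poly" and K :: nat
  assumes K: "K > 0" "i < K" and p: "p \<noteq> 0"
    and bound: "\<And>n. n \<ge> 1 \<Longrightarrow> n mod K = i \<Longrightarrow> \<bar>poly p (of_nat n)\<bar> * of_nat n ^ c \<le> C * of_nat n ^ D"
  shows "degree p + c \<le> D"
proof (rule ccontr)
  assume "\<not> degree p + c \<le> D"
  then have deg: "D < degree p + c" by simp
  have main: False if p': "lead_coeff p' > 0" "degree p' = degree p"
    "\<And>n. \<bar>poly p' (of_nat n)\<bar> = \<bar>poly p (of_nat n)\<bar>" for p' :: "rat poly"
  proof -
    let ?Q = "monom 1 c * p'" and ?M = "monom C D"
    have p'0: "p' \<noteq> 0" using p'(1) by auto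
    have dQ: "degree ?Q = c + degree p" using p'0 p'(2) by (simp add: degree_mult_eq degree_monom_eq)
    have dM: "degree ?M < degree ?Q" using dQ deg degree_monom_le[of C D] by linarith
    have "lead_coeff (?Q - ?M) = lead_coeff ?Q"
    proof -
      have "degree (- ?M) < degree ?Q" using dM by simp
      then show ?thesis using lead_coeff_add_le[of "- ?M" ?Q]
        by (metis add.commute add_uminus_conv_diff lead_coeff_add_le)
    qed
    also have "\<dots> = lead_coeff p'" by (simp add: lead_coeff_mult degree_monom_eq)
    finally have "lead_coeff (?Q - ?M) > 0" using p'(1) by simp
    then obtain x0 where x0: "\<And>x. x \<ge> x0 \<Longrightarrow> poly (?Q - ?M) x > 0"
      using poly_ge_lead_coeff_eventually by (meson less_le_trans)
    obtain m :: nat where m: "x0 \<le> of_nat m" using real_arch_simple by blast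
    define n where "n = i + K * (m + 1)"
    have "m + 1 \<le> K * (m + 1)" using mult_le_mono1[of 1 K "m + 1"] K(1) by simp
    then have n: "n \<ge> 1" "m \<le> n" unfolding n_def by linarith+
    have "n mod K = i" unfolding n_def mod_mult_self2 using K by simp
    have "of_nat m \<le> (of_nat n :: rat)" using n by simp
    then have "poly (?Q - ?M) (of_nat n) > 0" using x0 m by (meson order_trans)
    then have "C * of_nat n ^ D < of_nat n ^ c * poly p' (of_nat n)"
      by (simp add: poly_monom)
    also have "\<dots> \<le> of_nat n ^ c * \<bar>poly p' (of_nat n)\<bar>" by (intro mult_left_mono) auto
    also have "\<dots> \<le> C * of_nat n ^ D"
      using bound[OF n(1) \<open>n mod K = i\<close>] unfolding p'(3) by (simp add: mult.commute)
    finally show False by simp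
  qed
  have "lead_coeff p \<noteq> 0" using p by simp
  then consider "lead_coeff p > 0" | "lead_coeff (- p) > 0" by fastforce
  then show False
  proof cases
    case 1
    then show ?thesis using main[of p] by simp
  next
    case 2
    then show ?thesis using main[of "- p"] by simp
  qed
qed

lemma poly_eq_sum_atMost:
  fixes p :: "'a::comm_semiring_1 poly"
  assumes "degree p \<le> D"
  shows "poly p x = (\<Sum>k\<le>D. coeff p k * x ^ k)"
  unfolding poly_altdef
proof (rule sum.mono_neutral_left)
  show "\<forall>k\<in>{..D} - {..degree p}. coeff p k * x ^ k = 0" by (simp add: coeff_eq_0)
qed (use assms in auto)

text \<open>Passing to \<open>1 / n\<close> makes the degree bound visible as vanishing of low coefficients, and it makes
products of expansions of different degrees compatible with the common normalisation.\<close>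

lemma quasi_polynomial_reversed:
  assumes f: "quasi_polynomial f" and bound: "\<And>n. n \<ge> 1 \<Longrightarrow> \<bar>f n\<bar> * of_nat n ^ c \<le> C * of_nat n ^ D"
  shows "\<exists>K R. K > 0 \<and> (\<forall>n\<ge>1. f n = of_nat n ^ D * poly (R (n mod K)) (1 / of_nat n)) \<and>
    (\<forall>i. degree (R i) \<le> D) \<and> (\<forall>i r. r < c \<longrightarrow> coeff (R i) r = 0)"
proof -
  obtain K p where K: "K > 0" and p: "\<And>n. n \<ge> 1 \<Longrightarrow> f n = poly (p (n mod K)) (of_nat n)"
    using f unfolding quasi_polynomial_def by blast
  have deg: "degree (p i) + c \<le> D" if "i < K" "p i \<noteq> 0" for i
    using bound p by (intro degree_le_of_growth[OF K that, of c C]) auto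
  define R where "R i = (\<Sum>k\<le>D. monom (coeff (p (i mod K)) k) (D - k))" for i
  have coeffR: "coeff (R i) r = (if r \<le> D then coeff (p (i mod K)) (D - r) else 0)" for i r
  proof -
    have "coeff (R i) r = (\<Sum>k\<le>D. if D - k = r then coeff (p (i mod K)) k else 0)"
      unfolding R_def coeff_sum coeff_monom ..
    also have "\<dots> = (\<Sum>k\<le>D. if r \<le> D \<and> k = D - r then coeff (p (i mod K)) k else 0)"
      by (intro sum.cong) auto
    also have "\<dots> = (if r \<le> D then coeff (p (i mod K)) (D - r) else 0)" by simp
    finally show ?thesis .
  qed
  show ?thesis
  proof (intro exI[of _ K] exI[of _ R] conjI allI impI)
    show "K > 0" by fact
    fix n :: nat assume n: "1 \<le> n"
    have i: "n mod K < K" using K by simp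
    have "degree (p (n mod K)) \<le> D" using deg[OF i] by (cases "p (n mod K) = 0") auto
    then have "poly (p (n mod K)) (of_nat n) = (\<Sum>k\<le>D. coeff (p (n mod K)) k * of_nat n ^ k)"
      by (rule poly_eq_sum_atMost)
    also have "\<dots> = (\<Sum>k\<le>D. of_nat n ^ D * (coeff (p (n mod K)) k * (1 / of_nat n) ^ (D - k)))"
    proof (rule sum.cong[OF refl])
      fix k assume "k \<in> {..D}"
      then have "(of_nat n ^ D :: rat) = of_nat n ^ k * of_nat n ^ (D - k)" by (simp flip: power_add)
      then show "coeff (p (n mod K)) k * of_nat n ^ k = of_nat n ^ D * (coeff (p (n mod K)) k * (1 / of_nat n) ^ (D - k))"
        using n by (simp add: power_divide)
    qed
    also have "\<dots> = of_nat n ^ D * poly (R (n mod K)) (1 / of_nat n)"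
      unfolding R_def by (simp add: poly_sum poly_monom sum_distrib_left)
    finally show "f n = of_nat n ^ D * poly (R (n mod K)) (1 / of_nat n)" using p[OF n] by simp
  next
    fix i show "degree (R i) \<le> D" by (rule degree_le) (simp add: coeffR)
  next
    fix i r assume r: "r < c"
    show "coeff (R i) r = 0"
    proof (cases "p (i mod K) = 0")
      case False
      then have "degree (p (i mod K)) < D - r" if "r \<le> D" using deg[of "i mod K"] K r that by simp
      then show ?thesis unfolding coeffR by (auto intro: coeff_eq_0)
    qed (simp add: coeffR)
  qed
qed

definition polynomial_in_index :: "(nat \<Rightarrow> rat) \<Rightarrow> bool" where
  "polynomial_in_index h \<longleftrightarrow> (\<exists>\<phi>. \<forall>q. h q = poly \<phi> (of_nat q))"

lemma polynomial_in_index_const: "polynomial_in_index (\<lambda>q. a)"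
  unfolding polynomial_in_index_def by (intro exI[of _ "[:a:]"]) simp

lemma polynomial_in_index_mult:
  assumes "polynomial_in_index h" "polynomial_in_index h'"
  shows "polynomial_in_index (\<lambda>q. h q * h' q)"
proof -
  obtain \<phi> \<psi> where "\<forall>q. h q = poly \<phi> (of_nat q)" "\<forall>q. h' q = poly \<psi> (of_nat q)"
    using assms unfolding polynomial_in_index_def by blast
  then have "\<forall>q. h q * h' q = poly (\<phi> * \<psi>) (of_nat q)" by simp
  then show ?thesis unfolding polynomial_in_index_def by (rule exI)
qed

lemma polynomial_in_index_sum:
  assumes "\<And>i. i \<in> A \<Longrightarrow> polynomial_in_index (h i)"
  shows "polynomial_in_index (\<lambda>q. \<Sum>i\<in>A. h i q)"
proof -
  obtain \<phi> where "\<And>i q. i \<in> A \<Longrightarrow> h i q = poly (\<phi> i) (of_nat q)"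
    using assms unfolding polynomial_in_index_def by metis
  then show ?thesis unfolding polynomial_in_index_def
    by (intro exI[of _ "\<Sum>i\<in>A. \<phi> i"]) (simp add: poly_sum)
qed

text \<open>For \<open>q < k\<close> the truncated subtraction does no harm because the first factor is zero.\<close>

lemma polynomial_in_index_choose_choose:
  "polynomial_in_index (\<lambda>q. of_nat (q choose k) * of_nat ((q - k) choose j))"
proof -
  define B where "B k = smult (1 / fact k) (\<Prod>l\<in>{0..<k}. [:- of_nat l, 1::rat:])" for k
  have B: "poly (B k) (of_nat q) = of_nat (q choose k)" for k q
    unfolding B_def binomial_gbinomial gbinomial_prod_rev by (simp add: poly_prod)
  have "of_nat (q choose k) * of_nat ((q - k) choose j) = poly (B k * pcompose (B j) [:- of_nat k, 1:]) (of_nat q)" for q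
  proof (cases "k \<le> q")
    case True
    then have k: "poly [:- of_nat k, 1:] (of_nat q :: rat) = of_nat (q - k)" by (simp add: of_nat_diff)
    show ?thesis unfolding poly_mult poly_pcompose k B ..
  next
    case False
    then have "q choose k = 0" by simp
    then show ?thesis unfolding poly_mult B by simp
  qed
  then show ?thesis unfolding polynomial_in_index_def by blast
qed

lemma coeff_mult_eq_0_low:
  fixes p q :: "'a::comm_semiring_0 poly"
  assumes "\<And>s. s \<le> r \<Longrightarrow> coeff p s = 0"
  shows "coeff (p * q) r = 0"
  unfolding coeff_mult
proof (rule sum.neutral, rule ballI)
  fix i assume "i \<in> {..r}"
  then have "coeff p i = 0" by (intro assms) simp
  then show "coeff p i * coeff q (r - i) = 0" by simp
qed

lemma coeff_power_eq_0_low: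
  fixes G :: "rat poly"
  assumes "coeff G 0 = 0" "s < j"
  shows "coeff (G ^ j) s = 0"
  using assms(2)
proof (induction j arbitrary: s)
  case (Suc j)
  have "coeff G i * coeff (G ^ j) (s - i) = 0" if "i \<le> s" for i
    using Suc assms(1) that by (cases "i = 0") auto
  then show ?case unfolding power_Suc coeff_mult by (intro sum.neutral) auto
qed simp

text \<open>The binomial theorem; \<open>G ^ j\<close> does not contribute below degree \<open>j\<close>. The number of terms does not
depend on the exponent \<open>m\<close>, so each coefficient is a polynomial in \<open>m\<close>.\<close>

lemma coeff_power_one_plus:
  fixes G :: "rat poly"
  assumes "coeff G 0 = 0"
  shows "coeff ((1 + G) ^ m) s = (\<Sum>j\<le>s. of_nat (m choose j) * coeff (G ^ j) s)"
proof -
  have "(1 + G) ^ m = (\<Sum>j\<le>m. of_nat (m choose j) * G ^ j)"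
    using binomial_ring[of G 1 m] by (simp add: add.commute)
  then have "coeff ((1 + G) ^ m) s = (\<Sum>j\<le>m. of_nat (m choose j) * coeff (G ^ j) s)"
    by (simp add: coeff_sum of_nat_poly)
  also have "\<dots> = (\<Sum>j\<le>max m s. of_nat (m choose j) * coeff (G ^ j) s)"
    by (intro sum.mono_neutral_left) auto
  also have "\<dots> = (\<Sum>j\<le>s. of_nat (m choose j) * coeff (G ^ j) s)"
    using coeff_power_eq_0_low[OF assms] by (intro sum.mono_neutral_right) auto
  finally show ?thesis .
qed

lemma polynomial_in_index_coeff_binomial_expansion:
  fixes A :: "nat \<Rightarrow> rat poly" and G :: "rat poly"
  assumes G: "coeff G 0 = 0" and A: "\<And>k s. k > b * r \<Longrightarrow> s \<le> r \<Longrightarrow> coeff (A k) s = 0"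
  shows "polynomial_in_index (\<lambda>q. coeff (\<Sum>k\<le>q. smult (of_nat (q choose k)) (A k * (1 + G) ^ (q - k))) r)"
proof -
  have "coeff (\<Sum>k\<le>q. smult (of_nat (q choose k)) (A k * (1 + G) ^ (q - k))) r =
      (\<Sum>k\<le>b * r. \<Sum>s\<le>r. \<Sum>j\<le>r - s.
        (of_nat (q choose k) * of_nat ((q - k) choose j)) * (coeff (A k) s * coeff (G ^ j) (r - s)))" for q
  proof -
    have "coeff (\<Sum>k\<le>q. smult (of_nat (q choose k)) (A k * (1 + G) ^ (q - k))) r =
      (\<Sum>k\<le>q. of_nat (q choose k) * coeff (A k * (1 + G) ^ (q - k)) r)"
      by (simp add: coeff_sum)
    also have "\<dots> = (\<Sum>k\<le>max q (b * r). of_nat (q choose k) * coeff (A k * (1 + G) ^ (q - k)) r)"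
      by (intro sum.mono_neutral_left) auto
    also have "\<dots> = (\<Sum>k\<le>b * r. of_nat (q choose k) * coeff (A k * (1 + G) ^ (q - k)) r)"
      by (intro sum.mono_neutral_right) (auto intro!: coeff_mult_eq_0_low A)
    also have "\<dots> = (\<Sum>k\<le>b * r. \<Sum>s\<le>r. \<Sum>j\<le>r - s.
        (of_nat (q choose k) * of_nat ((q - k) choose j)) * (coeff (A k) s * coeff (G ^ j) (r - s)))"
      unfolding coeff_mult coeff_power_one_plus[OF G] sum_distrib_left
      by (intro sum.cong refl) (simp add: mult_ac)
    finally show ?thesis .
  qed
  then show ?thesis
    by (simp only:) (intro polynomial_in_index_sum polynomial_in_index_mult
        polynomial_in_index_choose_choose polynomial_in_index_const)
qed

text \<open>With \<open>FH q\<close> the normalised expansion in \<open>1 / n\<close>, the coefficient of \<open>n ^ (d q - r)\<close> is the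
\<open>r\<close>-th coefficient of \<open>FH q\<close>. The degree of \<open>FH q\<close> is at most \<open>d q\<close>, so the coefficients with
\<open>r > d q\<close> vanish on their own and the polynomials in \<open>q\<close> vanish there too; this is what permits
infinite depth. The period \<open>p r\<close> is the product of the periods of \<open>E\<close> and of the \<open>A k\<close> with
\<open>k \<le> b r\<close>, hence divides \<open>p (Suc r)\<close>.\<close>

theorem two_level_of_binomial_expansion:
  fixes E :: "nat \<Rightarrow> rat" and A :: "nat \<Rightarrow> nat \<Rightarrow> rat"
  assumes b: "b \<ge> 1"
    and E: "quasi_polynomial E" "\<And>n. n \<ge> 1 \<Longrightarrow> \<bar>E n\<bar> \<le> C * of_nat n ^ d"
    and lim: "(\<lambda>n. real_of_rat (E n) / real n ^ d) \<longlonglongrightarrow> v" and v: "v \<noteq> 0"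
    and A: "\<And>k. quasi_polynomial (A k)" "\<And>n. n \<ge> 1 \<Longrightarrow> A 0 n = 1"
    and growth: "\<And>k c. c * b < k + b \<Longrightarrow> \<exists>C. \<forall>n\<ge>1. \<bar>A k n\<bar> * of_nat n ^ c \<le> C * of_nat n ^ (d * k)"
  shows "\<exists>g e p f V. two_level_quasi_polynomial g e p f \<and> infinite_depth g e \<and> v = of_rat V \<and>
    (\<forall>q n. n \<ge> 1 \<longrightarrow> f q n = (1 / V ^ q) * (\<Sum>k\<le>q. of_nat (q choose k) * (E n ^ (q - k) * A k n)))"
proof -
  \<comment> \<open>The least integer that is at least \<open>k / b\<close>.\<close>
  define cd where "cd k = (k + b - 1) div b" for k
  have cd: "cd k * b < k + b" for k
  proof -
    have "cd k * b \<le> k + b - 1" unfolding cd_def by (rule div_times_less_eq_dividend)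
    then show ?thesis using b by simp
  qed
  have cd_gt: "cd k > r" if "k > b * r" for k r
  proof -
    have "(r + 1) * b \<le> k + b - 1" using that b by (simp add: algebra_simps)
    then have "r + 1 \<le> cd k" unfolding cd_def using b by (simp add: less_eq_div_iff_mult_less_eq)
    then show ?thesis by simp
  qed
  obtain KE RE where KE: "KE > 0" and RE: "\<And>n. n \<ge> 1 \<Longrightarrow> E n = of_nat n ^ d * poly (RE (n mod KE)) (1 / of_nat n)"
    and degE: "\<And>i. degree (RE i) \<le> d"
    using quasi_polynomial_reversed[OF E(1), of 0 C d] E(2) by auto
  have "\<exists>K R. K > 0 \<and> (\<forall>n\<ge>1. A k n = of_nat n ^ (d * k) * poly (R (n mod K)) (1 / of_nat n)) \<and>
    (\<forall>i. degree (R i) \<le> d * k) \<and> (\<forall>i r. r < cd k \<longrightarrow> coeff (R i) r = 0)" for k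
    using growth[OF cd, of k] quasi_polynomial_reversed[OF A(1)] by blast
  then obtain KA RA where "\<forall>k. KA k > 0 \<and> (\<forall>n\<ge>1. A k n = of_nat n ^ (d * k) * poly (RA k (n mod KA k)) (1 / of_nat n)) \<and>
    (\<forall>i. degree (RA k i) \<le> d * k) \<and> (\<forall>i r. r < cd k \<longrightarrow> coeff (RA k i) r = 0)"
    by metis
  then have KA: "KA k > 0" and RA: "n \<ge> 1 \<Longrightarrow> A k n = of_nat n ^ (d * k) * poly (RA k (n mod KA k)) (1 / of_nat n)"
    and degA: "degree (RA k i) \<le> d * k" and lowA: "r < cd k \<Longrightarrow> coeff (RA k i) r = 0" for k n i r
    by blast+
  have lead: "of_rat (coeff (RE (i mod KE)) 0) = v" for i
  proof -
    let ?p = "RE (i mod KE)"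
    \<comment> \<open>Along a residue class the limit is the value of the reversed polynomial at \<open>0\<close>.\<close>
    define s where "s m = i + KE * Suc m" for m
    have s1: "s m \<ge> 1" for m unfolding s_def using KE by simp
    have smono: "strict_mono s" unfolding s_def using KE by (intro strict_monoI) simp
    have "(\<lambda>m. real_of_rat (E (s m)) / real (s m) ^ d) \<longlonglongrightarrow> v"
      using LIMSEQ_subseq_LIMSEQ[OF lim smono] by (simp add: o_def)
    moreover have "real_of_rat (E (s m)) / real (s m) ^ d = (\<Sum>k\<le>degree ?p. real_of_rat (coeff ?p k) * (1 / real (s m)) ^ k)" for m
    proof -
      have "s m mod KE = i mod KE" unfolding s_def by (rule mod_mult_self2)
      then have "E (s m) = of_nat (s m) ^ d * poly ?p (1 / of_nat (s m))" using RE[OF s1] by simp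
      then have "real_of_rat (E (s m)) = real (s m) ^ d * real_of_rat (poly ?p (1 / of_nat (s m)))"
        by (simp add: of_rat_mult of_rat_power)
      then have "real_of_rat (E (s m)) / real (s m) ^ d = real_of_rat (poly ?p (1 / of_nat (s m)))"
        using s1[of m] by simp
      then show ?thesis unfolding poly_altdef
        by (simp add: of_rat_sum of_rat_mult of_rat_power of_rat_divide)
    qed
    moreover have "(\<lambda>m. \<Sum>k\<le>degree ?p. real_of_rat (coeff ?p k) * (1 / real (s m)) ^ k) \<longlonglongrightarrow>
        (\<Sum>k\<le>degree ?p. real_of_rat (coeff ?p k) * 0 ^ k)"
    proof -
      have "(\<lambda>m. 1 / real (s m)) \<longlonglongrightarrow> 0"
        using LIMSEQ_subseq_LIMSEQ[OF lim_1_over_n smono] by (simp add: o_def)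
      then show ?thesis by (intro tendsto_intros)
    qed
    ultimately have "(\<Sum>k\<le>degree ?p. real_of_rat (coeff ?p k) * 0 ^ k) = v"
      using LIMSEQ_unique by simp
    moreover have "(\<Sum>k\<le>degree ?p. real_of_rat (coeff ?p k) * 0 ^ k) = real_of_rat (coeff ?p 0)"
      by (simp add: power_0_left if_distrib[of "\<lambda>z. _ * z"] cong: if_cong)
    ultimately show ?thesis by simp
  qed
  define V where "V = coeff (RE 0) 0"
  have vV: "v = of_rat V" using lead[of 0] unfolding V_def by simp
  have V: "V \<noteq> 0" using v vV by auto
  have leadV: "coeff (RE (n mod KE)) 0 = V" for n
    using lead[of n] vV by (simp add: of_rat_eq_iff)
  define EH where "EH n = smult (1 / V) (RE (n mod KE))" for n
  define AH where "AH k n = smult (1 / V ^ k) (RA k (n mod KA k))" for k n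
  define FH where "FH q n = (\<Sum>k\<le>q. smult (of_nat (q choose k)) (AH k n * EH n ^ (q - k)))" for q n
  define c where "c r q n = coeff (FH q n) r" for r q n
  define p where "p r = KE * (\<Prod>k\<le>b * r. KA k)" for r
  \<comment> \<open>The value at \<open>n = 0\<close> is the one that the coefficients prescribe, not a count.\<close>
  define f where "f q n = (\<Sum>r\<le>d * q. c r q n * of_nat n ^ (d * q - r))" for q n
  define g where "g = [:0, of_nat d :: rat:]"
  have EH0: "coeff (EH n) 0 = 1" for n unfolding EH_def using leadV V by simp
  have AHlow: "coeff (AH k n) s = 0" if "k > b * r" "s \<le> r" for k n s r
    unfolding AH_def using lowA cd_gt[OF that(1)] that(2) by simp
  have degFH: "degree (FH q n) \<le> d * q" for q n
    unfolding FH_def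
  proof (rule degree_sum_le)
    fix k assume k: "k \<in> {..q}"
    have "degree (EH n ^ (q - k)) \<le> degree (EH n) * (q - k)" by (rule degree_power_le)
    also have "\<dots> \<le> d * (q - k)"
      unfolding EH_def using order_trans[OF degree_smult_le degE] by (rule mult_le_mono1)
    finally have "degree (AH k n * EH n ^ (q - k)) \<le> d * k + d * (q - k)"
      using order_trans[OF degree_smult_le degA] unfolding AH_def
      by (intro order_trans[OF degree_mult_le] add_mono)
    also have "\<dots> = d * q" using k by (simp flip: distrib_left)
    finally show "degree (smult (of_nat (q choose k)) (AH k n * EH n ^ (q - k))) \<le> d * q"
      using order_trans[OF degree_smult_le] by blast
  qed simp
  have fval: "f q n = (1 / V ^ q) * (\<Sum>k\<le>q. of_nat (q choose k) * (E n ^ (q - k) * A k n))" if n: "n \<ge> 1" for q n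
  proof -
    have "f q n = (\<Sum>r\<le>d * q. of_nat n ^ (d * q) * (coeff (FH q n) r * (1 / of_nat n) ^ r))"
      unfolding f_def c_def
    proof (rule sum.cong[OF refl])
      fix r assume "r \<in> {..d * q}"
      then have "(of_nat n ^ (d * q) :: rat) = of_nat n ^ r * of_nat n ^ (d * q - r)" by (simp flip: power_add)
      then show "coeff (FH q n) r * of_nat n ^ (d * q - r) = of_nat n ^ (d * q) * (coeff (FH q n) r * (1 / of_nat n) ^ r)"
        using n by (simp add: power_divide)
    qed
    also have "\<dots> = of_nat n ^ (d * q) * poly (FH q n) (1 / of_nat n)"
      unfolding poly_eq_sum_atMost[OF degFH] sum_distrib_left ..
    also have "\<dots> = (\<Sum>k\<le>q. of_nat (q choose k) *
        (of_nat n ^ (d * q) * (poly (AH k n) (1 / of_nat n) * poly (EH n) (1 / of_nat n) ^ (q - k))))"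
      unfolding FH_def by (simp add: poly_sum sum_distrib_left mult_ac)
    also have "\<dots> = (\<Sum>k\<le>q. of_nat (q choose k) * ((1 / V ^ q) * (E n ^ (q - k) * A k n)))"
    proof (rule sum.cong[OF refl])
      fix k assume "k \<in> {..q}"
      then have k: "k + (q - k) = q" by simp
      have "d * q = d * k + d * (q - k)" using k by (metis distrib_left)
      then have "(of_nat n ^ (d * q) :: rat) = of_nat n ^ (d * k) * (of_nat n ^ d) ^ (q - k)"
        by (simp add: power_add power_mult)
      moreover have "V ^ q = V ^ k * V ^ (q - k)" using k by (metis power_add)
      ultimately show "of_nat (q choose k) * (of_nat n ^ (d * q) * (poly (AH k n) (1 / of_nat n) * poly (EH n) (1 / of_nat n) ^ (q - k)))
        = of_nat (q choose k) * ((1 / V ^ q) * (E n ^ (q - k) * A k n))"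
        unfolding AH_def EH_def RE[OF n] RA[OF n] using V
        by (simp add: power_mult_distrib power_divide)
    qed
    also have "\<dots> = (1 / V ^ q) * (\<Sum>k\<le>q. of_nat (q choose k) * (E n ^ (q - k) * A k n))"
      unfolding sum_distrib_left by (intro sum.cong) (auto simp: mult_ac)
    finally show ?thesis .
  qed
  have c0: "c 0 q n = 1" for q n
  proof -
    have A00: "coeff (AH 0 n) 0 = 1"
    proof -
      have "degree (RA 0 (n mod KA 0)) = 0" using degA[of 0] by simp
      then obtain a where a: "RA 0 (n mod KA 0) = [:a:]" by (rule degree_eq_zeroE)
      have "A 0 (n + KA 0) = 1" using A(2) KA[of 0] by simp
      moreover have "A 0 (n + KA 0) = poly (RA 0 (n mod KA 0)) (1 / of_nat (n + KA 0))"
        using RA[of "n + KA 0" 0] KA[of 0] by simp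
      ultimately show ?thesis unfolding AH_def a by simp
    qed
    have E0: "coeff (EH n ^ m) 0 = 1" for m by (simp add: coeff_0_power EH0)
    have "c 0 q n = (\<Sum>k\<le>q. of_nat (q choose k) * (coeff (AH k n) 0 * coeff (EH n ^ (q - k)) 0))"
      unfolding c_def FH_def by (simp add: coeff_sum coeff_mult)
    also have "\<dots> = (\<Sum>k\<in>{0}. of_nat (q choose k) * (coeff (AH k n) 0 * coeff (EH n ^ (q - k)) 0))"
      using AHlow[of 0] by (intro sum.mono_neutral_right) auto
    also have "\<dots> = 1" using A00 E0 by simp
    finally show ?thesis .
  qed
  have p0: "p r > 0" for r unfolding p_def using KE KA by (simp add: prod_pos)
  have pdvd: "p r dvd p (Suc r)" for r
    unfolding p_def by (intro mult_dvd_mono dvd_refl prod_dvd_prod_subset) auto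
  have cmod: "c r q (n mod p r) = c r q n" for r q n
  proof -
    have EHm: "EH (n mod p r) = EH n" unfolding EH_def p_def by (simp add: mod_mod_cancel)
    have AHm: "AH k (n mod p r) = AH k n" if "k \<le> b * r" for k
    proof -
      have "KA k dvd p r" unfolding p_def using that by (intro dvd_mult dvd_prodI) auto
      then show ?thesis unfolding AH_def by (simp add: mod_mod_cancel)
    qed
    have "coeff (AH k (n mod p r) * EH n ^ (q - k)) r = coeff (AH k n * EH n ^ (q - k)) r" for k
    proof (cases "k \<le> b * r")
      case False
      then have "coeff (AH k m * EH n ^ (q - k)) r = 0" for m
        by (intro coeff_mult_eq_0_low AHlow[of r]) auto
      then show ?thesis by simp
    qed (simp add: AHm)
    then show ?thesis unfolding c_def FH_def coeff_sum coeff_smult EHm by simp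
  qed
  have "\<exists>\<phi>. \<forall>q. c r q i = poly \<phi> (of_nat q)" for r i
  proof -
    have "polynomial_in_index (\<lambda>q. coeff (\<Sum>k\<le>q. smult (of_nat (q choose k)) (AH k i * (1 + (EH i - 1)) ^ (q - k))) r)"
      by (rule polynomial_in_index_coeff_binomial_expansion[where b = b]) (simp_all add: EH0 AHlow)
    then show ?thesis unfolding c_def FH_def polynomial_in_index_def by simp
  qed
  then obtain \<phi> where \<phi>: "\<And>r i q. c r q i = poly (\<phi> r i) (of_nat q)" by metis
  have args: "nonneg_args g = UNIV" unfolding nonneg_args_def g_def by auto
  have val: "nat_value g q = d * q" for q
  proof -
    have "poly g (of_nat q) = of_nat (d * q)" unfolding g_def by (simp add: mult.commute)
    then show ?thesis unfolding nat_value_def by (simp only: floor_of_nat nat_int)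
  qed
  have "two_level_quasi_polynomial g (\<lambda>_. \<infinity>) p f"
    unfolding two_level_quasi_polynomial_def args val
  proof (intro conjI ballI allI exI[of _ c] exI[of _ \<phi>])
    show "numerical_poly g" unfolding numerical_poly_def g_def by simp
    show "p r > 0" "p r dvd p (Suc r)" for r by (fact p0, fact pdvd)
    show "quasi_poly_expansion (d * q) (\<lambda>r. c r q) (f q)" for q
      unfolding quasi_poly_expansion_def
    proof (intro conjI allI impI)
      show "periodic (c r q)" for r
        unfolding periodic_def
      proof (intro exI[of _ "p r"] conjI allI)
        fix n show "c r q (n + p r) = c r q n" using cmod[of r q "n + p r"] cmod[of r q n] by simp
      qed (rule p0)
      show "\<exists>n. c 0 q n \<noteq> 0" using c0 by simp
      show "f q n = (\<Sum>r\<le>d * q. c r q n * of_nat n ^ (d * q - r))" for n unfolding f_def ..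
    qed
    show "d * q < r \<longrightarrow> c r q n = 0" for q r n
      unfolding c_def using degFH[of q n] by (auto intro: coeff_eq_0)
    show "ereal (real r) \<le> \<infinity> \<longrightarrow> c r q n = poly (\<phi> r (n mod p r)) (of_nat q)" for q r n
      using \<phi>[of r q "n mod p r"] cmod by simp
  qed auto
  moreover have "infinite_depth g (\<lambda>_. \<infinity>)" unfolding infinite_depth_def by simp
  ultimately show ?thesis using vV fval by blast
qed

section \<open>Constraints of a hyperplane arrangement\<close>

definition coeff_support :: "nat \<Rightarrow> (nat \<Rightarrow> real ^ 'd) \<Rightarrow> nat set" where
  "coeff_support b a = {i \<in> {1..b}. a i \<noteq> 0}"

text \<open>Injections of the support, rather than of \<open>{1..b}\<close>, make \<open>T\<close> exactly the set of copies that the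
reindexed equation involves, and they exist even if there are fewer than \<open>b\<close> copies.\<close>

definition violated :: "nat \<Rightarrow> (nat \<Rightarrow> real ^ 'd) set \<Rightarrow> nat set \<Rightarrow> (nat \<Rightarrow> real ^ 'd) \<Rightarrow> bool" where
  "violated b \<A> T x \<longleftrightarrow> (\<exists>a\<in>\<A>. \<exists>\<sigma>. bij_betw \<sigma> (coeff_support b a) T \<and>
     (\<Sum>i\<in>coeff_support b a. a i \<bullet> x (\<sigma> i)) = 0)"

lemma finite_coeff_support: "finite (coeff_support b a)"
  and card_coeff_support_le: "card (coeff_support b a) \<le> b"
proof -
  have sub: "coeff_support b a \<subseteq> {1..b}" unfolding coeff_support_def by auto
  then show "finite (coeff_support b a)" by (rule finite_subset) simp
  show "card (coeff_support b a) \<le> b" using card_mono[OF _ sub] by simp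
qed

lemma violatedI:
  assumes "a \<in> \<A>" "inj_on \<sigma> (coeff_support b a)" "T = \<sigma> ` coeff_support b a"
    "(\<Sum>i\<in>coeff_support b a. a i \<bullet> x (\<sigma> i)) = 0"
  shows "violated b \<A> T x"
  unfolding violated_def bij_betw_def
  by (rule bexI[OF exI[where x = \<sigma>] assms(1)]) (use assms in simp)

lemma violatedE:
  assumes "violated b \<A> T x"
  obtains a \<sigma> where "a \<in> \<A>" "inj_on \<sigma> (coeff_support b a)" "T = \<sigma> ` coeff_support b a"
    "(\<Sum>i\<in>coeff_support b a. a i \<bullet> x (\<sigma> i)) = 0"
  using assms unfolding violated_def bij_betw_def
  by (elim bexE exE conjE) (rule that, assumption, assumption, erule sym, assumption)

lemma local_constraints_violated: "local_constraints (violated b \<A>)"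
proof -
  have imp: "violated b \<A> T y" if v: "violated b \<A> T x" and eq: "\<forall>i\<in>T. x i = y i" for T x y
  proof -
    obtain a \<sigma> where a: "a \<in> \<A>" "inj_on \<sigma> (coeff_support b a)" "T = \<sigma> ` coeff_support b a"
      "(\<Sum>i\<in>coeff_support b a. a i \<bullet> x (\<sigma> i)) = 0"
      using v by (rule violatedE)
    have "(\<Sum>i\<in>coeff_support b a. a i \<bullet> y (\<sigma> i)) = (\<Sum>i\<in>coeff_support b a. a i \<bullet> x (\<sigma> i))"
      using eq a(3) by (intro sum.cong) auto
    then show ?thesis using a(4) by (intro violatedI[OF a(1-3)]) simp
  qed
  show ?thesis
    unfolding local_constraints_def
  proof (intro allI impI)
    fix T :: "nat set" and x y :: "nat \<Rightarrow> real ^ 'a" assume "\<forall>i\<in>T. x i = y i"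
    then show "violated b \<A> T x = violated b \<A> T y" using imp[of T x y] imp[of T y x] by auto
  qed
qed

lemma violated_card_le: "violated b \<A> T x \<Longrightarrow> card T \<le> b"
  by (elim violatedE) (use card_coeff_support_le card_image in metis)

text \<open>Equations are reindexed along all injections, so renaming the copies permutes them.\<close>

lemma violated_image:
  assumes "inj_on \<pi> T"
  shows "violated b \<A> (\<pi> ` T) x = violated b \<A> T (\<lambda>i. x (\<pi> i))"
proof
  assume "violated b \<A> (\<pi> ` T) x"
  then obtain a \<sigma> where a: "a \<in> \<A>" "inj_on \<sigma> (coeff_support b a)" "\<pi> ` T = \<sigma> ` coeff_support b a"
    "(\<Sum>i\<in>coeff_support b a. a i \<bullet> x (\<sigma> i)) = 0"
    by (rule violatedE)
  define \<rho> where "\<rho> i = inv_into T \<pi> (\<sigma> i)" for i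
  have \<rho>: "\<pi> (\<rho> i) = \<sigma> i" "\<rho> i \<in> T" if "i \<in> coeff_support b a" for i
  proof -
    have "\<sigma> i \<in> \<pi> ` T" using that a(3) by auto
    then show "\<pi> (\<rho> i) = \<sigma> i" "\<rho> i \<in> T" unfolding \<rho>_def by (auto simp: f_inv_into_f inv_into_into)
  qed
  show "violated b \<A> T (\<lambda>i. x (\<pi> i))"
  proof (rule violatedI[OF a(1)])
    show "inj_on \<rho> (coeff_support b a)"
      using a(2) \<rho>(1) by (intro inj_onI) (metis inj_on_eq_iff)
    show "T = \<rho> ` coeff_support b a"
    proof
      show "\<rho> ` coeff_support b a \<subseteq> T" using \<rho>(2) by auto
      show "T \<subseteq> \<rho> ` coeff_support b a"
      proof
        fix t assume t: "t \<in> T"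
        then obtain i where i: "i \<in> coeff_support b a" "\<pi> t = \<sigma> i" using a(3) by blast
        then have "\<rho> i = t" unfolding \<rho>_def i(2)[symmetric] using assms t by simp
        then show "t \<in> \<rho> ` coeff_support b a" using i by blast
      qed
    qed
    show "(\<Sum>i\<in>coeff_support b a. a i \<bullet> x (\<pi> (\<rho> i))) = 0"
      using a(4) \<rho>(1) by simp
  qed
next
  assume "violated b \<A> T (\<lambda>i. x (\<pi> i))"
  then obtain a \<sigma> where a: "a \<in> \<A>" "inj_on \<sigma> (coeff_support b a)" "T = \<sigma> ` coeff_support b a"
    "(\<Sum>i\<in>coeff_support b a. a i \<bullet> x (\<pi> (\<sigma> i))) = 0"
    by (rule violatedE)
  show "violated b \<A> (\<pi> ` T) x"
    by (rule violatedI[OF a(1), of "\<pi> \<circ> \<sigma>"]) (use a assms in \<open>auto simp: comp_inj_on image_comp\<close>)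
qed

text \<open>Every equation that involves the copy \<open>i\<close> is, as a condition on the point in that copy, a
hyperplane. The sum bounds the number of pairs of an equation and an injection; it depends neither
on \<open>X\<close> nor on \<open>M\<close>.\<close>

lemma card_violated_le:
  fixes \<A> :: "(nat \<Rightarrow> real ^ 'd) set"
  assumes \<A>: "finite \<A>" and L: "finite L" and T: "T \<subseteq> L" "i \<in> T" and X: "X \<subseteq> int_box M"
  shows "card {v \<in> X. violated b \<A> T (z(i := v))} * (2 * M + 1)
    \<le> Suc (\<Sum>a\<in>\<A>. card (PiE (coeff_support b a) (\<lambda>_. L))) * (2 * M + 1) ^ CARD('d)"
proof -
  let ?F = "\<lambda>a. {\<sigma> \<in> PiE (coeff_support b a) (\<lambda>_. L). bij_betw \<sigma> (coeff_support b a) T}"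
  let ?I = "SIGMA a:\<A>. ?F a"
  let ?S = "\<lambda>(a, \<sigma>). {v \<in> int_box M. (\<Sum>k\<in>coeff_support b a. a k \<bullet> (z(i := v)) (\<sigma> k)) = 0}"
  have finF: "finite (?F a)" for a
    using finite_PiE[OF finite_coeff_support, of b a "\<lambda>_. L"] L by simp
  have finI: "finite ?I" using \<A> finF by auto
  have "{v \<in> X. violated b \<A> T (z(i := v))} \<subseteq> (\<Union>p\<in>?I. ?S p)"
  proof
    fix v assume v: "v \<in> {v \<in> X. violated b \<A> T (z(i := v))}"
    then have "violated b \<A> T (z(i := v))" by simp
    then obtain a \<sigma> where a: "a \<in> \<A>" "inj_on \<sigma> (coeff_support b a)" "T = \<sigma> ` coeff_support b a"
      "(\<Sum>k\<in>coeff_support b a. a k \<bullet> (z(i := v)) (\<sigma> k)) = 0"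
      by (rule violatedE)
    let ?\<sigma> = "restrict \<sigma> (coeff_support b a)"
    have "bij_betw ?\<sigma> (coeff_support b a) T"
      using a(2,3) unfolding bij_betw_def by (auto simp: inj_on_def)
    moreover have "?\<sigma> \<in> PiE (coeff_support b a) (\<lambda>_. L)" using a(3) T(1) by auto
    ultimately have "(a, ?\<sigma>) \<in> ?I" using a(1) by blast
    moreover have "v \<in> ?S (a, ?\<sigma>)"
    proof -
      have "(\<Sum>k\<in>coeff_support b a. a k \<bullet> (z(i := v)) (?\<sigma> k)) =
          (\<Sum>k\<in>coeff_support b a. a k \<bullet> (z(i := v)) (\<sigma> k))"
        by (intro sum.cong) auto
      then have "(\<Sum>k\<in>coeff_support b a. a k \<bullet> (z(i := v)) (?\<sigma> k)) = 0" using a(4) by (rule trans)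
      moreover have "v \<in> int_box M" using v X by blast
      ultimately show ?thesis unfolding prod.case mem_Collect_eq by (intro conjI)
    qed
    ultimately show "v \<in> (\<Union>p\<in>?I. ?S p)" by (rule UN_I)
  qed
  moreover have "finite (\<Union>p\<in>?I. ?S p)"
  proof (rule finite_UN_I[OF finI])
    show "finite (?S p)" for p
      by (cases p) (auto intro: finite_subset[OF _ finite_int_box])
  qed
  ultimately have "card {v \<in> X. violated b \<A> T (z(i := v))} \<le> card (\<Union>p\<in>?I. ?S p)"
    by (rule card_mono[rotated])
  also have "\<dots> \<le> (\<Sum>p\<in>?I. card (?S p))" by (rule card_UN_le[OF finI])
  finally have "card {v \<in> X. violated b \<A> T (z(i := v))} * (2 * M + 1) \<le> (\<Sum>p\<in>?I. card (?S p)) * (2 * M + 1)"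
    by (rule mult_le_mono1)
  also have "\<dots> = (\<Sum>p\<in>?I. card (?S p) * (2 * M + 1))" by (rule sum_distrib_right)
  also have "\<dots> \<le> (\<Sum>p\<in>?I. (2 * M + 1) ^ CARD('d))"
  proof (rule sum_mono)
    fix p assume "p \<in> ?I"
    then obtain a \<sigma> where p: "p = (a, \<sigma>)" "bij_betw \<sigma> (coeff_support b a) T" by blast
    then obtain k where k: "k \<in> coeff_support b a" "\<sigma> k = i"
      using T(2) unfolding bij_betw_def by blast
    define s where "s = - (\<Sum>l\<in>coeff_support b a - {k}. a l \<bullet> z (\<sigma> l))"
    have "(\<Sum>l\<in>coeff_support b a. a l \<bullet> (z(i := v)) (\<sigma> l)) = a k \<bullet> v - s" for v
    proof -
      have "\<sigma> l \<noteq> i" if "l \<in> coeff_support b a - {k}" for l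
        using that k p(2) unfolding bij_betw_def inj_on_def by blast
      then have "(\<Sum>l\<in>coeff_support b a - {k}. a l \<bullet> (z(i := v)) (\<sigma> l)) = - s"
        unfolding s_def by (simp)
      then show ?thesis
        using sum.remove[OF finite_coeff_support k(1), of "\<lambda>l. a l \<bullet> (z(i := v)) (\<sigma> l)"] k(2) by simp
    qed
    then have Sp: "?S p = {v \<in> int_box M. a k \<bullet> v = s}" unfolding p(1) by auto
    have ak: "a k \<noteq> 0" using k(1) unfolding coeff_support_def by simp
    show "card (?S p) * (2 * M + 1) \<le> (2 * M + 1) ^ CARD('d)"
      unfolding Sp by (rule card_int_box_hyperplane_le[OF ak])
  qed
  also have "\<dots> = card ?I * (2 * M + 1) ^ CARD('d)" by simp
  also have "\<dots> \<le> Suc (\<Sum>a\<in>\<A>. card (PiE (coeff_support b a) (\<lambda>_. L))) * (2 * M + 1) ^ CARD('d)"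
  proof (rule mult_le_mono1)
    have "card ?I = (\<Sum>a\<in>\<A>. card (?F a))" by (rule card_SigmaI[OF \<A>]) (rule ballI, rule finF)
    also have "\<dots> \<le> (\<Sum>a\<in>\<A>. card (PiE (coeff_support b a) (\<lambda>_. L)))"
      using L finite_coeff_support by (intro sum_mono card_mono finite_PiE) auto
    finally show "card ?I \<le> Suc (\<Sum>a\<in>\<A>. card (PiE (coeff_support b a) (\<lambda>_. L)))" by simp
  qed
  finally show ?thesis .
qed

lemma avoids_violated_iff_linear_forms:
  fixes \<A> :: "(nat \<Rightarrow> real ^ 'd) set"
  assumes \<A>: "finite \<A>" and K: "finite K" and M: "M \<subseteq> K"
  obtains Q where "finite Q"
    "\<And>x. avoids (violated b \<A>) M x \<longleftrightarrow> (\<forall>\<alpha>\<in>Q. (\<Sum>(i, j)\<in>K \<times> UNIV. \<alpha> (i, j) * x i $ j) \<noteq> 0)"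
proof -
  define \<alpha> where "\<alpha> a \<sigma> = (\<lambda>(i, j). \<Sum>k\<in>coeff_support b a. if \<sigma> k = i then a k $ j else 0)"
    for a :: "nat \<Rightarrow> real ^ 'd" and \<sigma> :: "nat \<Rightarrow> nat"
  let ?F = "\<lambda>a. {\<sigma> \<in> PiE (coeff_support b a) (\<lambda>_. M). inj_on \<sigma> (coeff_support b a)}"
  have form: "(\<Sum>(i, j)\<in>K \<times> UNIV. \<alpha> a \<sigma> (i, j) * x i $ j) = (\<Sum>k\<in>coeff_support b a. a k \<bullet> x (\<sigma> k))"
    if \<sigma>: "\<sigma> \<in> PiE (coeff_support b a) (\<lambda>_. M)" for a \<sigma> x
  proof -
    have "(\<Sum>(i, j)\<in>K \<times> UNIV. \<alpha> a \<sigma> (i, j) * x i $ j)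
        = (\<Sum>i\<in>K. \<Sum>j\<in>UNIV. \<Sum>k\<in>coeff_support b a. if \<sigma> k = i then a k $ j * x i $ j else 0)"
      unfolding \<alpha>_def sum.cartesian_product[symmetric]
      by (simp add: sum_distrib_right if_distrib[of "\<lambda>t. t * _"] cong: if_cong)
    also have "\<dots> = (\<Sum>i\<in>K. \<Sum>k\<in>coeff_support b a. \<Sum>j\<in>UNIV. if \<sigma> k = i then a k $ j * x i $ j else 0)"
      by (intro sum.cong refl sum.swap)
    also have "\<dots> = (\<Sum>k\<in>coeff_support b a. \<Sum>i\<in>K. \<Sum>j\<in>UNIV. if \<sigma> k = i then a k $ j * x i $ j else 0)"
      by (rule sum.swap)
    also have "\<dots> = (\<Sum>k\<in>coeff_support b a. a k \<bullet> x (\<sigma> k))"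
    proof (rule sum.cong[OF refl])
      fix k assume "k \<in> coeff_support b a"
      then have "\<sigma> k \<in> K" using \<sigma> M by auto
      have "(\<Sum>i\<in>K. \<Sum>j\<in>UNIV. if \<sigma> k = i then a k $ j * x i $ j else 0)
          = (\<Sum>i\<in>K. if \<sigma> k = i then \<Sum>j\<in>UNIV. a k $ j * x i $ j else 0)"
        by (intro sum.cong) auto
      also have "\<dots> = (\<Sum>j\<in>UNIV. a k $ j * x (\<sigma> k) $ j)" using K \<open>\<sigma> k \<in> K\<close> by simp
      finally show "(\<Sum>i\<in>K. \<Sum>j\<in>UNIV. if \<sigma> k = i then a k $ j * x i $ j else 0) = a k \<bullet> x (\<sigma> k)"
        by (simp add: inner_vec_def)
    qed
    finally show ?thesis .
  qed
  show thesis
  proof (rule that[of "\<Union>a\<in>\<A>. \<alpha> a ` ?F a"])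
    have "finite (?F a)" for a
      using finite_PiE[OF finite_coeff_support, of b a "\<lambda>_. M"] finite_subset[OF M K] by simp
    then show "finite (\<Union>a\<in>\<A>. \<alpha> a ` ?F a)" using \<A> by blast
    fix x :: "nat \<Rightarrow> real ^ 'd"
    have "avoids (violated b \<A>) M x \<longleftrightarrow> (\<forall>a\<in>\<A>. \<forall>\<sigma>\<in>?F a. (\<Sum>k\<in>coeff_support b a. a k \<bullet> x (\<sigma> k)) \<noteq> 0)"
    proof
      assume av: "avoids (violated b \<A>) M x"
      show "\<forall>a\<in>\<A>. \<forall>\<sigma>\<in>?F a. (\<Sum>k\<in>coeff_support b a. a k \<bullet> x (\<sigma> k)) \<noteq> 0"
      proof (intro ballI notI)
        fix a \<sigma> assume "a \<in> \<A>" "\<sigma> \<in> ?F a" "(\<Sum>k\<in>coeff_support b a. a k \<bullet> x (\<sigma> k)) = 0"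
        then have "violated b \<A> (\<sigma> ` coeff_support b a) x" by (intro violatedI[of a]) auto
        moreover have "\<sigma> ` coeff_support b a \<subseteq> M" using \<open>\<sigma> \<in> ?F a\<close> by auto
        ultimately show False using av unfolding avoids_def by blast
      qed
    next
      assume r: "\<forall>a\<in>\<A>. \<forall>\<sigma>\<in>?F a. (\<Sum>k\<in>coeff_support b a. a k \<bullet> x (\<sigma> k)) \<noteq> 0"
      show "avoids (violated b \<A>) M x"
        unfolding avoids_def
      proof (intro allI impI notI)
        fix T assume T: "T \<subseteq> M" "violated b \<A> T x"
        from T(2) obtain a \<sigma> where a: "a \<in> \<A>" "inj_on \<sigma> (coeff_support b a)" "T = \<sigma> ` coeff_support b a"
          "(\<Sum>k\<in>coeff_support b a. a k \<bullet> x (\<sigma> k)) = 0"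
          by (rule violatedE)
        let ?\<sigma> = "restrict \<sigma> (coeff_support b a)"
        have "?\<sigma> \<in> ?F a" using a(2,3) T(1) by (auto simp: inj_on_def)
        then have "(\<Sum>k\<in>coeff_support b a. a k \<bullet> x (?\<sigma> k)) \<noteq> 0" using r a(1) by blast
        then show False using a(4) by simp
      qed
    qed
    also have "\<dots> \<longleftrightarrow> (\<forall>\<beta>\<in>(\<Union>a\<in>\<A>. \<alpha> a ` ?F a). (\<Sum>(i, j)\<in>K \<times> UNIV. \<beta> (i, j) * x i $ j) \<noteq> 0)"
      using form by auto
    finally show "avoids (violated b \<A>) M x \<longleftrightarrow>
      (\<forall>\<beta>\<in>(\<Union>a\<in>\<A>. \<alpha> a ` ?F a). (\<Sum>(i, j)\<in>K \<times> UNIV. \<beta> (i, j) * x i $ j) \<noteq> 0)" .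
  qed
qed

lemma interior_lattice_points_iff:
  fixes P :: "(real ^ 'd) set"
  assumes int: "interior P = {x. \<forall>(c, e)\<in>G. rat_vec c \<bullet> x < of_rat e}" and n: "n \<ge> 1"
  shows "v \<in> interior_lattice_points P n \<longleftrightarrow>
    (\<forall>j. v $ j \<in> \<int>) \<and> (\<forall>(c, e)\<in>G. rat_vec c \<bullet> v < of_rat e * real n)"
proof -
  have "v \<in> (*\<^sub>R) (real n) ` interior P \<longleftrightarrow> (1 / real n) *\<^sub>R v \<in> interior P"
    using n by (force simp: image_iff)
  also have "\<dots> \<longleftrightarrow> (\<forall>(c, e)\<in>G. rat_vec c \<bullet> v < of_rat e * real n)"
    unfolding int using n by (simp add: divide_less_eq)
  finally show ?thesis unfolding interior_lattice_points_def by blast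
qed

text \<open>A tuple of points of \<open>D\<close> is a rational vector indexed by \<open>K \<times> UNIV\<close>. Membership in the dilated
polytope and avoidance are determined by the signs of rational forms in this vector and \<open>n\<close>: those of
the facets in each copy, and the rational components of the equations.\<close>

theorem quasi_polynomial_card_avoiding_interior_lattice_points:
  fixes P :: "(real ^ 'd) set" and \<A> :: "(nat \<Rightarrow> real ^ 'd) set"
  assumes P: "rational_polytope P" "aff_dim P = int CARD('d)"
    and \<A>: "finite \<A>" and K: "finite K" and M: "M \<subseteq> K"
  shows "quasi_polynomial (\<lambda>n. of_nat (card {x \<in> PiE K (\<lambda>_. interior_lattice_points P n). avoids (violated b \<A>) M x}))"
proof -
  let ?J = "K \<times> (UNIV :: 'd set)"
  have J: "finite ?J" using K by simp
  obtain G where G: "finite G" and int: "interior P = {x. \<forall>(c, e)\<in>G. rat_vec c \<bullet> x < of_rat e}"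
    by (rule interior_rational_polytope[OF P])
  have bdd: "bounded P" using P(1) unfolding rational_polytope_def by (auto intro: polytope_imp_bounded)
  obtain C :: nat where C: "\<forall>n. interior_lattice_points P n \<subseteq> int_box (C * n)"
    using interior_lattice_points_subset_int_box[OF bdd] by (rule exE)
  obtain Q where Q: "finite Q" and av: "\<And>x. avoids (violated b \<A>) M x \<longleftrightarrow>
      (\<forall>\<alpha>\<in>Q. (\<Sum>(i, j)\<in>?J. \<alpha> (i, j) * x i $ j) \<noteq> 0)"
    by (rule avoids_violated_iff_linear_forms[OF \<A> K M, where b = b]) (rule that, assumption)
  have "\<forall>\<alpha>. \<exists>m c. \<forall>y. (\<Sum>j\<in>?J. \<alpha> j * of_rat (y j)) = (0::real) \<longleftrightarrow> (\<forall>t<(m::nat). dot ?J (c t) y = 0)"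
    using rational_decomposition[OF J] by blast
  then have "\<exists>m. \<forall>\<alpha>. \<exists>c. \<forall>y. (\<Sum>j\<in>?J. \<alpha> j * of_rat (y j)) = (0::real) \<longleftrightarrow> (\<forall>t<(m \<alpha>::nat). dot ?J (c t) y = 0)"
    by (rule choice)
  then obtain m :: "(nat \<times> 'd \<Rightarrow> real) \<Rightarrow> nat" where
    "\<forall>\<alpha>. \<exists>c. \<forall>y. (\<Sum>j\<in>?J. \<alpha> j * of_rat (y j)) = (0::real) \<longleftrightarrow> (\<forall>t<m \<alpha>. dot ?J (c t) y = 0)"
    by (rule exE)
  then have "\<exists>c. \<forall>\<alpha>. \<forall>y. (\<Sum>j\<in>?J. \<alpha> j * of_rat (y j)) = (0::real) \<longleftrightarrow> (\<forall>t<m \<alpha>. dot ?J (c \<alpha> t) y = 0)"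
    by (rule choice)
  then obtain c where mc':
    "\<forall>\<alpha>. \<forall>y. (\<Sum>j\<in>?J. \<alpha> j * of_rat (y j)) = (0::real) \<longleftrightarrow> (\<forall>t<m \<alpha>. dot ?J (c \<alpha> t) y = 0)"
    by (rule exE)
  have mc: "(\<Sum>j\<in>?J. \<alpha> j * of_rat (y j)) = (0::real) \<longleftrightarrow> (\<forall>t<m \<alpha>. dot ?J (c \<alpha> t) y = 0)" for \<alpha> y
    using mc' by (elim allE)
  define pt where "pt y i = rat_vec (\<lambda>j. y (i, j))" for y :: "nat \<times> 'd \<Rightarrow> rat" and i
  have av_rat: "avoids (violated b \<A>) M (pt y) \<longleftrightarrow> (\<forall>\<alpha>\<in>Q. \<exists>t<m \<alpha>. dot ?J (c \<alpha> t) y \<noteq> 0)" for y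
  proof -
    have eq: "(\<Sum>(i, j)\<in>?J. \<alpha> (i, j) * pt y i $ j) = (\<Sum>j\<in>?J. \<alpha> j * of_rat (y j))" for \<alpha>
      unfolding pt_def rat_vec_def by (intro sum.cong) auto
    show ?thesis unfolding av eq mc by simp
  qed
  define facet where "facet i h = (\<lambda>(i', j). if i' = i then h j else 0)" for i :: nat and h :: "'d \<Rightarrow> rat"
  have dot_facet: "dot ?J (facet i h) y = (\<Sum>j\<in>UNIV. h j * y (i, j))" if "i \<in> K" for i h y
  proof -
    have "dot ?J (facet i h) y = (\<Sum>i'\<in>K. \<Sum>j\<in>UNIV. if i' = i then h j * y (i', j) else 0)"
      unfolding dot_def facet_def sum.cartesian_product by (intro sum.cong) auto
    also have "\<dots> = (\<Sum>i'\<in>K. if i' = i then \<Sum>j\<in>UNIV. h j * y (i', j) else 0)"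
      by (intro sum.cong) auto
    also have "\<dots> = (\<Sum>j\<in>UNIV. h j * y (i, j))" using K that by simp
    finally show ?thesis .
  qed
  define R where "R y s \<longleftrightarrow> (\<forall>i\<in>K. \<forall>(h, e)\<in>G. dot ?J (facet i h) y + (- e) * s < 0) \<and>
    (\<forall>\<alpha>\<in>Q. \<exists>t<m \<alpha>. dot ?J (c \<alpha> t) y + 0 * s \<noteq> 0)" for y and s :: rat
  define Ls where "Ls = (\<lambda>(i, (h, e)). (facet i h, - e)) ` (K \<times> G) \<union> (\<Union>\<alpha>\<in>Q. (\<lambda>t. (c \<alpha> t, 0)) ` {..<m \<alpha>})"
  have facets: "(\<forall>(h, e)\<in>G. dot ?J (facet i h) y + (- e) * of_nat n < 0) \<longleftrightarrow>
      (\<forall>(h, e)\<in>G. rat_vec h \<bullet> pt y i < of_rat e * real n)" if "i \<in> K" for i y n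
  proof -
    have "dot ?J (facet i h) y + (- e) * of_nat n < 0 \<longleftrightarrow> rat_vec h \<bullet> pt y i < of_rat e * real n" for h e
    proof -
      have "dot ?J (facet i h) y + (- e) * of_nat n < 0 \<longleftrightarrow> (\<Sum>j\<in>UNIV. h j * y (i, j)) < e * of_nat n"
        unfolding dot_facet[OF that] by simp
      also have "\<dots> \<longleftrightarrow> real_of_rat (\<Sum>j\<in>UNIV. h j * y (i, j)) < real_of_rat (e * of_nat n)"
        by (simp only: of_rat_less)
      also have "real_of_rat (\<Sum>j\<in>UNIV. h j * y (i, j)) = rat_vec h \<bullet> pt y i"
        unfolding pt_def rat_vec_def inner_vec_def by (simp add: of_rat_sum of_rat_mult)
      also have "real_of_rat (e * of_nat n) = of_rat e * real n" by (simp add: of_rat_mult)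
      finally show ?thesis .
    qed
    then show ?thesis by simp
  qed
  have R_iff: "R y (of_nat n) \<longleftrightarrow> (\<forall>i\<in>K. pt y i \<in> interior_lattice_points P n) \<and> avoids (violated b \<A>) M (pt y)"
    if iv: "integral_vec y" and n: "n \<ge> 1" for y n
  proof -
    have "\<forall>j. pt y i $ j \<in> \<int>" for i
    proof
      fix j
      obtain z where "y (i, j) = of_int z" using iv unfolding integral_vec_def by (blast elim: Ints_cases)
      then show "pt y i $ j \<in> \<int>" unfolding pt_def rat_vec_def by simp
    qed
    then show ?thesis
      unfolding R_def av_rat interior_lattice_points_iff[OF int n] using facets by simp
  qed
  have quasi_polynomial: "quasi_polynomial (\<lambda>n. of_nat (card {y. integral_vec y \<and> (\<forall>k. k \<notin> ?J \<longrightarrow> y k = 0) \<and> R y (of_nat n)}))"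
  proof (rule quasi_polynomial_lattice_count[OF J, where Ls = Ls and C = C])
    show "finite Ls" unfolding Ls_def using K G Q by auto
    fix x y :: "nat \<times> 'd \<Rightarrow> rat" and r s :: rat
    assume sg: "\<forall>(l, d)\<in>Ls. sgn (dot ?J l x + d * r) = sgn (dot ?J l y + d * s)"
    have 1: "dot ?J (facet i h) x + (- e) * r < 0 \<longleftrightarrow> dot ?J (facet i h) y + (- e) * s < 0"
      if "i \<in> K" "(h, e) \<in> G" for i h e
    proof -
      have "(facet i h, - e) \<in> Ls" unfolding Ls_def using that by force
      then have "sgn (dot ?J (facet i h) x + (- e) * r) = sgn (dot ?J (facet i h) y + (- e) * s)"
        using sg by blast
      then show ?thesis by (metis sgn_less)
    qed
    have 2: "dot ?J (c \<alpha> t) x + 0 * r \<noteq> 0 \<longleftrightarrow> dot ?J (c \<alpha> t) y + 0 * s \<noteq> 0"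
      if "\<alpha> \<in> Q" "t < m \<alpha>" for \<alpha> t
    proof -
      have "(c \<alpha> t, 0) \<in> Ls" unfolding Ls_def using that by blast
      then have "sgn (dot ?J (c \<alpha> t) x + 0 * r) = sgn (dot ?J (c \<alpha> t) y + 0 * s)"
        using sg by blast
      then show ?thesis by (metis sgn_0_0)
    qed
    show "R x r \<longleftrightarrow> R y s"
    proof
      assume "R x r"
      then show "R y s" unfolding R_def using 1 2 by fast
    next
      assume "R y s"
      then show "R x r" unfolding R_def using 1 2 by fast
    qed
  next
    fix n :: nat and y k
    assume n: "n \<ge> 1" and y: "integral_vec y" "R y (of_nat n)" and k: "k \<in> ?J"
    obtain i j where ij: "k = (i, j)" "i \<in> K" using k by auto
    have "pt y i \<in> interior_lattice_points P n" using R_iff[OF y(1) n] y(2) ij by blast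
    then have "pt y i \<in> int_box (C * n)" using C by blast
    then have "\<bar>real_of_rat (y k)\<bar> \<le> real (C * n)"
      unfolding int_box_def pt_def rat_vec_def ij by simp
    then have "real_of_rat \<bar>y k\<bar> \<le> real_of_rat (of_nat C * of_nat n)"
      by (simp add: of_rat_mult)
    then show "\<bar>y k\<bar> \<le> of_nat C * of_nat n" by (simp only: of_rat_less_eq)
  qed
  show ?thesis
  proof (rule quasi_polynomial_cong[OF quasi_polynomial])
    fix n :: nat assume n: "n \<ge> 1"
    let ?X = "{x \<in> PiE K (\<lambda>_. interior_lattice_points P n). avoids (violated b \<A>) M x}"
    let ?Y = "{y. integral_vec y \<and> (\<forall>k. k \<notin> ?J \<longrightarrow> y k = 0) \<and> R y (of_nat n)}"
    let ?f = "\<lambda>x (i, j). if i \<in> K then of_int \<lfloor>x i $ j\<rfloor> else (0::rat)"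
    let ?g = "\<lambda>y. restrict (pt y) K"
    have ptf: "pt (?f x) i = x i" if "x \<in> ?X" "i \<in> K" for x i
    proof -
      have "x i \<in> interior_lattice_points P n" using that by auto
      then have "\<forall>j. x i $ j \<in> \<int>" unfolding interior_lattice_points_def by blast
      then show ?thesis using that(2) unfolding pt_def rat_vec_def by (simp add: vec_eq_iff)
    qed
    have av_cong: "avoids (violated b \<A>) M x = avoids (violated b \<A>) M x'"
      if "\<And>i. i \<in> K \<Longrightarrow> x i = x' i" for x x'
      using that M by (intro avoids_cong[OF local_constraints_violated]) auto
    have "bij_betw ?f ?X ?Y"
    proof (rule bij_betw_byWitness[where f' = ?g])
      show "\<forall>x\<in>?X. ?g (?f x) = x"
      proof
        fix x assume x: "x \<in> ?X"
        show "?g (?f x) = x"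
        proof
          fix i show "?g (?f x) i = x i" using ptf[OF x, of i] x by (cases "i \<in> K") (auto simp: PiE_iff extensional_def)
        qed
      qed
      show "\<forall>y\<in>?Y. ?f (?g y) = y"
      proof
        fix y assume y: "y \<in> ?Y"
        show "?f (?g y) = y"
        proof
          fix k :: "nat \<times> 'd"
          obtain i j where k: "k = (i, j)" by fastforce
          obtain z where z: "y k = of_int z" using y unfolding integral_vec_def by (blast elim: Ints_cases)
          show "?f (?g y) k = y k"
          proof (cases "i \<in> K")
            case True
            then show ?thesis using z unfolding k pt_def rat_vec_def by simp
          next
            case False
            then have "k \<notin> ?J" unfolding k by simp
            then have "y k = 0" using y by blast
            then show ?thesis using False unfolding k by simp
          qed
        qed
      qed
      show "?f ` ?X \<subseteq> ?Y"
      proof (rule image_subsetI)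
        fix x assume x: "x \<in> ?X"
        have iv: "integral_vec (?f x)" unfolding integral_vec_def by auto
        moreover have "\<forall>k. k \<notin> ?J \<longrightarrow> ?f x k = 0" by auto
        moreover have "R (?f x) (of_nat n)"
          unfolding R_iff[OF iv n]
        proof
          show "\<forall>i\<in>K. pt (?f x) i \<in> interior_lattice_points P n" using ptf[OF x] x by auto
          show "avoids (violated b \<A>) M (pt (?f x))" using av_cong[of "pt (?f x)" x] ptf[OF x] x by blast
        qed
        ultimately show "?f x \<in> ?Y" by blast
      qed
      show "?g ` ?Y \<subseteq> ?X"
      proof (rule image_subsetI)
        fix y assume y: "y \<in> ?Y"
        then have "R y (of_nat n)" "integral_vec y" by auto
        then have "(\<forall>i\<in>K. pt y i \<in> interior_lattice_points P n) \<and> avoids (violated b \<A>) M (pt y)"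
          using R_iff n by blast
        moreover have "avoids (violated b \<A>) M (?g y) = avoids (violated b \<A>) M (pt y)"
          by (rule av_cong) simp
        ultimately show "?g y \<in> ?X" by auto
      qed
    qed
    then show "(of_nat (card ?X) :: rat) = of_nat (card ?Y)"
      unfolding of_nat_eq_iff by (rule bij_betw_same_card)
  qed
qed

section \<open>Avoiding a power of an arrangement\<close>

lemma quasi_polynomial_weight_sum:
  fixes P :: "(real ^ 'd) set"
  assumes P: "rational_polytope P" "aff_dim P = int CARD('d)" and \<A>: "finite \<A>" and L: "finite L"
  shows "quasi_polynomial (\<lambda>n. weight_sum (violated b \<A>) (interior_lattice_points P n) L)"
proof -
  let ?V = "violated b \<A>" and ?X = "interior_lattice_points P"
  have bdd: "bounded P" using P(1) unfolding rational_polytope_def by (auto intro: polytope_imp_bounded)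
  obtain C :: nat where C: "\<forall>n. ?X n \<subseteq> int_box (C * n)"
    using interior_lattice_points_subset_int_box[OF bdd] by (rule exE)
  have fin: "finite (PiE L (\<lambda>_. ?X n))" for n
    using L finite_subset[OF C[rule_format] finite_int_box] by (intro finite_PiE) auto
  have "weight_sum ?V (?X n) L = (\<Sum>M\<in>Pow L. (-1) ^ card (L - M) *
      of_nat (card {x \<in> PiE L (\<lambda>_. ?X n). avoids ?V M x}))" for n
  proof -
    have "weight_sum ?V (?X n) L = (\<Sum>M\<in>Pow L. \<Sum>x\<in>PiE L (\<lambda>_. ?X n). (-1) ^ card (L - M) * of_bool (avoids ?V M x))"
      unfolding weight_sum_def mobius_weight_def by (rule sum.swap)
    also have "\<dots> = (\<Sum>M\<in>Pow L. (-1) ^ card (L - M) * (\<Sum>x\<in>PiE L (\<lambda>_. ?X n). of_bool (avoids ?V M x)))"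
      by (simp only: sum_distrib_left)
    also have "\<dots> = (\<Sum>M\<in>Pow L. (-1) ^ card (L - M) * of_nat (card {x \<in> PiE L (\<lambda>_. ?X n). avoids ?V M x}))"
      using fin by (simp add: Int_def)
    finally show ?thesis .
  qed
  moreover have "quasi_polynomial (\<lambda>n. \<Sum>M\<in>Pow L. (-1) ^ card (L - M) *
      of_nat (card {x \<in> PiE L (\<lambda>_. ?X n). avoids ?V M x}))"
    by (intro quasi_polynomial_sum quasi_polynomial_mult quasi_polynomial_const quasi_polynomial_card_avoiding_interior_lattice_points[OF P \<A> L]) auto
  ultimately show ?thesis by (intro quasi_polynomial_cong[where g = "\<lambda>n. weight_sum ?V (?X n) L"]) auto
qed

text \<open>The interior is a nonempty open set.\<close>

lemma measure_full_dim_polytope_pos: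
  fixes P :: "(real ^ 'd) set"
  assumes "polytope P" "aff_dim P = int CARD('d)"
  shows "measure lebesgue P \<noteq> 0"
proof
  assume 0: "measure lebesgue P = 0"
  have conv: "convex P" and bdd: "bounded P"
    using assms(1) by (auto intro: polytope_imp_convex polytope_imp_bounded)
  have hull: "affine hull P = UNIV" using assms(2) aff_dim_eq_full[of P] by simp
  have "P \<noteq> {}" using assms(2) by auto
  then have "interior P \<noteq> {}"
    using rel_interior_eq_empty[OF conv] rel_interior_interior[OF hull] by simp
  then have "\<not> negligible (interior P)" by (intro open_not_negligible) auto
  moreover have "P \<in> lmeasurable"
    by (rule lmeasurable_compact) (rule polytope_imp_compact[OF assms(1)])
  then have "negligible P" using 0 by (simp add: negligible_iff_measure)
  ultimately show False using interior_subset negligible_subset by blast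
qed

lemma extend_injection:
  assumes "finite B" "A \<subseteq> B" "finite Y" "inj_on \<sigma> A" "\<sigma> ` A \<subseteq> Y" "card B \<le> card Y"
  obtains \<tau> where "inj_on \<tau> B" "\<tau> ` B \<subseteq> Y" "\<And>i. i \<in> A \<Longrightarrow> \<tau> i = \<sigma> i"
proof -
  have finA: "finite A" using assms(1,2) by (rule finite_subset[rotated])
  have "card (B - A) \<le> card (Y - \<sigma> ` A)"
    using assms finA by (simp add: card_Diff_subset card_image)
  then obtain \<rho> where \<rho>: "inj_on \<rho> (B - A)" "\<rho> ` (B - A) \<subseteq> Y - \<sigma> ` A"
    using assms by (metis card_le_inj finite_Diff)
  let ?\<tau> = "\<lambda>i. if i \<in> A then \<sigma> i else \<rho> i"
  show thesis
  proof (rule that)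
    have "inj_on ?\<tau> (A \<union> (B - A))" using assms(4) \<rho> by (intro inj_on_disjoint_Un) auto
    then show "inj_on ?\<tau> B" using assms(2) by (simp add: Un_absorb1)
    show "?\<tau> ` B \<subseteq> Y" using assms(5) \<rho>(2) by auto
  qed simp
qed

text \<open>From an injection of the support of an equation to one of \<open>{1..b}\<close>: it extends if \<open>q \<ge> b\<close>, and
otherwise the support has more than \<open>q\<close> elements, so that there is no injection.\<close>

lemma mem_arrangement_power_iff_violated:
  fixes \<H> :: "(nat \<Rightarrow> real ^ 'd) set set"
  assumes a: "\<And>H. H \<in> \<H> \<Longrightarrow> H = {x \<in> copies b. (\<Sum>i\<in>{1..b}. a H i \<bullet> x i) = 0}"
    and q: "q \<ge> b \<or> (\<forall>H\<in>\<H>. q < card (involved_copies b H))"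
    and x: "x \<in> copies q"
  shows "x \<in> \<Union> (arrangement_power b \<H> q) \<longleftrightarrow> \<not> avoids (violated b (a ` \<H>)) {1..q} x"
proof -
  have supp: "(\<Sum>i\<in>{1..b}. a H i \<bullet> y i) = (\<Sum>i\<in>coeff_support b (a H). a H i \<bullet> y i)" for H y
    unfolding coeff_support_def by (intro sum.mono_neutral_right) auto
  have re: "x \<in> reindex b q \<sigma> H \<longleftrightarrow> (\<Sum>i\<in>coeff_support b (a H). a H i \<bullet> x (\<sigma> i)) = 0" if H: "H \<in> \<H>" for \<sigma> H
  proof -
    have "reindex b q \<sigma> H = {x \<in> copies q. (\<Sum>i\<in>{1..b}. a H i \<bullet> x (\<sigma> i)) = 0}"
      by (subst a[OF H]) (rule reindex_equation)
    then show ?thesis using x supp[of H "\<lambda>i. x (\<sigma> i)"] by simp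
  qed
  have sub: "coeff_support b (a H) \<subseteq> {1..b}" for H unfolding coeff_support_def by auto
  show ?thesis
  proof
    assume "x \<in> \<Union> (arrangement_power b \<H> q)"
    then obtain \<sigma> H where H: "H \<in> \<H>" "inj_on \<sigma> {1..b}" "\<sigma> ` {1..b} \<subseteq> {1..q}" "x \<in> reindex b q \<sigma> H"
      unfolding arrangement_power_def by blast
    have "violated b (a ` \<H>) (\<sigma> ` coeff_support b (a H)) x"
      using H re[OF H(1)] inj_on_subset[OF H(2) sub] by (intro violatedI[of "a H"]) auto
    moreover have "\<sigma> ` coeff_support b (a H) \<subseteq> {1..q}" using H(3) sub[of H] by blast
    ultimately show "\<not> avoids (violated b (a ` \<H>)) {1..q} x" unfolding avoids_def by blast
  next
    assume "\<not> avoids (violated b (a ` \<H>)) {1..q} x"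
    then obtain T where T: "T \<subseteq> {1..q}" "violated b (a ` \<H>) T x" unfolding avoids_def by blast
    from T(2) obtain a' \<sigma> where a': "a' \<in> a ` \<H>" "inj_on \<sigma> (coeff_support b a')" "T = \<sigma> ` coeff_support b a'"
      "(\<Sum>i\<in>coeff_support b a'. a' i \<bullet> x (\<sigma> i)) = 0"
      by (rule violatedE)
    then obtain H where H: "H \<in> \<H>" "a' = a H" by blast
    have "card (coeff_support b a') = card T" using a'(2,3) by (simp add: card_image)
    also have "\<dots> \<le> q" using card_mono[OF _ T(1)] by simp
    finally have "card (coeff_support b a') \<le> q" .
    moreover have "involved_copies b H = coeff_support b a'"
      unfolding H(2) coeff_support_def
      using arg_cong[OF a[OF H(1)], of "involved_copies b"] involved_copies_equation[of b "a H" 0]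
      by (rule trans)
    ultimately have "\<not> q < card (involved_copies b H)" by simp
    then have "b \<le> q" using q H(1) by blast
    obtain \<tau> where \<tau>: "inj_on \<tau> {1..b}" "\<tau> ` {1..b} \<subseteq> {1..q}" "\<And>i. i \<in> coeff_support b a' \<Longrightarrow> \<tau> i = \<sigma> i"
      by (rule extend_injection[of "{1..b}" "coeff_support b a'" "{1..q}" \<sigma>])
        (use sub a' T(1) H \<open>b \<le> q\<close> in auto)
    have "(\<Sum>i\<in>coeff_support b (a H). a H i \<bullet> x (\<tau> i)) = 0"
      using a'(4) \<tau>(3) unfolding H(2) by simp
    then have "x \<in> reindex b q \<tau> H" using re[OF H(1)] by blast
    then show "x \<in> \<Union> (arrangement_power b \<H> q)"
      using H(1) \<tau>(1,2) unfolding arrangement_power_def by blast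
  qed
qed

lemma avoiding_count_eq_card_avoids:
  fixes \<H> :: "(nat \<Rightarrow> real ^ 'd) set set"
  assumes "\<And>H. H \<in> \<H> \<Longrightarrow> H = {x \<in> copies b. (\<Sum>i\<in>{1..b}. a H i \<bullet> x i) = 0}"
    and "q \<ge> b \<or> (\<forall>H\<in>\<H>. q < card (involved_copies b H))" and n: "n \<ge> 1"
  shows "avoiding_count P b \<H> q n =
    card {x \<in> PiE {1..q} (\<lambda>_. interior_lattice_points P n). avoids (violated b (a ` \<H>)) {1..q} x}"
proof -
  have "PiE {1..q} (\<lambda>_. interior_lattice_points P n) - \<Union> (arrangement_power b \<H> q) =
    {x \<in> PiE {1..q} (\<lambda>_. interior_lattice_points P n). avoids (violated b (a ` \<H>)) {1..q} x}"
  proof -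
    have "x \<in> copies q" if "x \<in> PiE {1..q} (\<lambda>_. interior_lattice_points P n)" for x
      using that unfolding copies_def by auto
    then show ?thesis using mem_arrangement_power_iff_violated[OF assms(1,2)] by blast
  qed
  then show ?thesis unfolding avoiding_count_def lattice_points_interior_dilate[OF n] by simp
qed

text \<open>The general bound with \<open>B = N ^ d\<close>, where \<open>N = 2 M + 1\<close> is the number of values of a
coordinate and is linear in \<open>n\<close>.\<close>

lemma abs_weight_sum_violated_growth:
  fixes P :: "(real ^ 'd) set"
  assumes bdd: "bounded P" and \<A>: "finite \<A>" and L: "finite L" and c: "c * b < card L + b"
  shows "\<exists>C. \<forall>n\<ge>1. \<bar>weight_sum (violated b \<A>) (interior_lattice_points P n) L\<bar> * of_nat n ^ c
    \<le> C * of_nat n ^ (CARD('d) * card L)"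
proof -
  let ?V = "violated b \<A>" and ?X = "interior_lattice_points P" and ?d = "CARD('d)"
  obtain C0 :: nat where C0: "\<forall>n. ?X n \<subseteq> int_box (C0 * n)"
    using interior_lattice_points_subset_int_box[OF bdd] by (rule exE)
  define W where "W = Suc (\<Sum>a\<in>\<A>. card (PiE (coeff_support b a) (\<lambda>_. L)))"
  define D :: nat where "D = 2 ^ card L * (2 ^ card L * W) ^ card L"
  show ?thesis
  proof (intro exI[of _ "of_nat (D * (2 * (C0 + 1) + 1) ^ (?d * card L))"] allI impI)
    fix n :: nat assume n: "1 \<le> n"
    \<comment> \<open>The factor \<open>C0 + 1\<close> ensures \<open>n \<le> 2 M + 1\<close> even if \<open>C0 = 0\<close>.\<close>
    define M where "M = (C0 + 1) * n"
    have X: "?X n \<subseteq> int_box M"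
    proof -
      have "int_box (C0 * n) \<subseteq> (int_box M :: (real ^ 'd) set)"
        unfolding int_box_def M_def by (auto intro: order_trans) 
      then show ?thesis using C0 by blast
    qed
    have finX: "finite (?X n)" by (rule finite_subset[OF X finite_int_box])
    have cardX: "card (?X n) \<le> (2 * M + 1) ^ ?d"
      using card_mono[OF finite_int_box X] card_int_box_le[of M, where 'd = 'd] by linarith
    have "\<bar>weight_sum ?V (?X n) L\<bar> * of_nat (2 * M + 1) ^ c \<le> of_nat D * of_nat ((2 * M + 1) ^ ?d) ^ card L"
      unfolding D_def
    proof (rule abs_weight_sum_le[OF local_constraints_violated L finX cardX _ _ _ c])
      show "1 \<le> W" unfolding W_def by simp
      show "card T \<le> b" if "?V T x" for T x using violated_card_le[OF that] .
      show "card {v \<in> ?X n. ?V T (z(i := v))} * (2 * M + 1) \<le> W * (2 * M + 1) ^ ?d"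
        if "T \<subseteq> L" "i \<in> T" for T i z
        unfolding W_def by (rule card_violated_le[OF \<A> L that X])
    qed
    moreover have "(of_nat n :: rat) ^ c \<le> of_nat (2 * M + 1) ^ c"
      unfolding M_def by (intro power_mono) (simp_all only: of_nat_le_iff of_nat_0_le_iff, simp)
    then have "\<bar>weight_sum ?V (?X n) L\<bar> * of_nat n ^ c \<le> \<bar>weight_sum ?V (?X n) L\<bar> * of_nat (2 * M + 1) ^ c"
      by (rule mult_left_mono) simp
    moreover have "(of_nat D * of_nat ((2 * M + 1) ^ ?d) ^ card L :: rat)
        \<le> of_nat (D * (2 * (C0 + 1) + 1) ^ (?d * card L)) * of_nat n ^ (?d * card L)"
    proof -
      have "2 * M + 1 \<le> (2 * (C0 + 1) + 1) * n" unfolding M_def using n by (simp add: algebra_simps)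
      then have "((2 * M + 1) ^ ?d) ^ card L \<le> ((2 * (C0 + 1) + 1) * n) ^ (?d * card L)"
        unfolding power_mult[symmetric] by (rule power_mono) simp
      then have "D * ((2 * M + 1) ^ ?d) ^ card L \<le> D * (2 * (C0 + 1) + 1) ^ (?d * card L) * n ^ (?d * card L)"
        unfolding power_mult_distrib mult.assoc by (rule mult_le_mono2)
      then have "(of_nat (D * ((2 * M + 1) ^ ?d) ^ card L) :: rat)
          \<le> of_nat (D * (2 * (C0 + 1) + 1) ^ (?d * card L) * n ^ (?d * card L))"
        by (simp only: of_nat_le_iff)
      then show ?thesis by (simp only: of_nat_mult of_nat_power)
    qed
    ultimately show "\<bar>weight_sum ?V (?X n) L\<bar> * of_nat n ^ c
        \<le> of_nat (D * (2 * (C0 + 1) + 1) ^ (?d * card L)) * of_nat n ^ (?d * card L)"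
      by linarith
  qed
qed

theorem theorem38:
  fixes P :: "(real ^ 'd) set" and b :: nat and \<H> :: "(nat \<Rightarrow> real ^ 'd) set set"
  assumes "rational_polytope P"
    and "aff_dim P = int CARD('d)"
    and "b \<ge> 1"
    and "linear_arrangement b \<H>"
  shows "\<exists>g e p f.
           two_level_quasi_polynomial g e p f \<and> infinite_depth g e \<and>
           (\<forall>q n. n \<ge> 1 \<and> (q \<ge> b \<or> (\<forall>H\<in>\<H>. q < card (involved_copies b H))) \<longrightarrow>
              of_rat (f q n) = 1 / measure lebesgue P ^ q * real (avoiding_count P b \<H> q n))"
proof -
  have poly: "polytope P" using assms(1) unfolding rational_polytope_def by blast
  have bdd: "bounded P" and conv: "convex P"
    using poly by (auto intro: polytope_imp_bounded polytope_imp_convex)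
  have fin: "finite \<H>" using assms(4) unfolding linear_arrangement_def by blast
  have "\<exists>a. (\<exists>i\<in>{1..b}. a i \<noteq> 0) \<and> H = {x \<in> copies b. (\<Sum>i\<in>{1..b}. a i \<bullet> x i) = 0}" if H: "H \<in> \<H>" for H
  proof -
    have "hyperplane b H" "origin b \<in> H" using assms(4) H unfolding linear_arrangement_def by auto
    then obtain a c where a: "\<exists>i\<in>{1..b}. a i \<noteq> 0" "H = {x \<in> copies b. (\<Sum>i\<in>{1..b}. a i \<bullet> x i) = c}"
      unfolding hyperplane_def by blast
    have "(\<Sum>i\<in>{1..b}. a i \<bullet> origin b i) = c" using \<open>origin b \<in> H\<close> a(2) by blast
    then have "c = 0" unfolding origin_def by simp
    then show ?thesis using a by blast
  qed
  then have "\<forall>H\<in>\<H>. \<exists>a. (\<exists>i\<in>{1..b}. a i \<noteq> 0) \<and> H = {x \<in> copies b. (\<Sum>i\<in>{1..b}. a i \<bullet> x i) = 0}"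
    by (rule ballI)
  from bchoice[OF this] obtain a where a_all: "\<forall>H\<in>\<H>. (\<exists>i\<in>{1..b}. a H i \<noteq> 0) \<and>
      H = {x \<in> copies b. (\<Sum>i\<in>{1..b}. a H i \<bullet> x i) = 0}"
    by (rule exE)
  have a_ne: "\<exists>i\<in>{1..b}. a H i \<noteq> 0"
    and a: "H = {x \<in> copies b. (\<Sum>i\<in>{1..b}. a H i \<bullet> x i) = 0}" if "H \<in> \<H>" for H
    by (rule bspec[OF a_all that, THEN conjunct1], rule bspec[OF a_all that, THEN conjunct2])
  let ?V = "violated b (a ` \<H>)" and ?X = "interior_lattice_points P" and ?d = "CARD('d)"
  have finA: "finite (a ` \<H>)" using fin by simp
  have nonempty: "\<not> ?V {} x" for x
  proof
    assume "?V {} x"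
    then show False
    proof (rule violatedE)
      fix a' and \<sigma> :: "nat \<Rightarrow> nat" assume "a' \<in> a ` \<H>" and empty: "{} = \<sigma> ` coeff_support b a'"
      then obtain H where H: "H \<in> \<H>" "a' = a H" by blast
      have "coeff_support b (a H) = {}" using empty unfolding H(2) by simp
      then show False using a_ne[OF H(1)] unfolding coeff_support_def by blast
    qed
  qed
  then have av0: "avoids ?V {} x" for x unfolding avoids_def by simp
  obtain C :: nat where C: "\<forall>n. ?X n \<subseteq> int_box (C * n)"
    using interior_lattice_points_subset_int_box[OF bdd] by (rule exE)
  have finX: "finite (?X n)" for n using C[rule_format] finite_int_box by (rule finite_subset)
  define E where "E n = (of_nat (card (?X n)) :: rat)" for n
  define A where "A k n = weight_sum ?V (?X n) {1..k}" for k n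
  \<comment> \<open>The case of one copy and no condition: the empty set of copies is always avoided.\<close>
  have "quasi_polynomial (\<lambda>n. of_nat (card {x \<in> PiE {1..1} (\<lambda>_. ?X n). avoids ?V {} x}))"
    by (rule quasi_polynomial_card_avoiding_interior_lattice_points[OF assms(1,2) finA]) auto
  then have qE: "quasi_polynomial E"
    unfolding E_def using av0 by (simp add: card_PiE)
  have growE: "\<bar>E n\<bar> \<le> of_nat ((2 * C + 1) ^ ?d) * of_nat n ^ ?d" if "n \<ge> 1" for n
  proof -
    have "card (?X n) \<le> (2 * (C * n) + 1) ^ ?d"
      using card_mono[OF finite_int_box C[rule_format]] card_int_box_le[of "C * n", where 'd = 'd]
      by (rule order_trans)
    also have "\<dots> \<le> ((2 * C + 1) * n) ^ ?d" using that by (intro power_mono) (auto simp: algebra_simps)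
    also have "\<dots> = (2 * C + 1) ^ ?d * n ^ ?d" by (rule power_mult_distrib)
    finally have "(of_nat (card (?X n)) :: rat) \<le> of_nat ((2 * C + 1) ^ ?d * n ^ ?d)" by (simp only: of_nat_le_iff)
    then show ?thesis unfolding E_def by (simp only: abs_of_nat of_nat_mult of_nat_power)
  qed
  have lim: "(\<lambda>n. real_of_rat (E n) / real n ^ ?d) \<longlonglongrightarrow> measure lebesgue P"
    unfolding E_def of_rat_of_nat_eq by (rule interior_lattice_points_asymptotics[OF bdd conv])
  have qA: "quasi_polynomial (A k)" for k
    unfolding A_def by (rule quasi_polynomial_weight_sum[OF assms(1,2) finA]) simp
  have A0: "A 0 n = 1" for n
    unfolding A_def weight_sum_def mobius_weight_def using av0 by simp
  have growA: "\<exists>C. \<forall>n\<ge>1. \<bar>A k n\<bar> * of_nat n ^ c \<le> C * of_nat n ^ (?d * k)" if "c * b < k + b" for k c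
    using abs_weight_sum_violated_growth[OF bdd finA, of "{1..k}" c b] that unfolding A_def by simp
  obtain g e p f V where two: "two_level_quasi_polynomial g e p f" "infinite_depth g e"
    and V: "measure lebesgue P = of_rat V"
    and f: "\<forall>q n. n \<ge> 1 \<longrightarrow> f q n = (1 / V ^ q) * (\<Sum>k\<le>q. of_nat (q choose k) * (E n ^ (q - k) * A k n))"
    using two_level_of_binomial_expansion[OF assms(3) qE growE lim
        measure_full_dim_polytope_pos[OF poly assms(2)] qA A0 growA] by blast
  have "of_rat (f q n) = 1 / measure lebesgue P ^ q * real (avoiding_count P b \<H> q n)"
    if n: "n \<ge> 1" and q: "q \<ge> b \<or> (\<forall>H\<in>\<H>. q < card (involved_copies b H))" for q n
  proof -
    have "avoiding_count P b \<H> q n =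
        card {x \<in> PiE {1..q} (\<lambda>_. ?X n). avoids ?V {1..q} x}"
      by (rule avoiding_count_eq_card_avoids[where a = a]) (rule a, assumption, rule q, rule n)
    moreover have "of_nat (card {x \<in> PiE {1..q} (\<lambda>_. ?X n). avoids ?V {1..q} x}) =
        (\<Sum>k\<le>q. of_nat (q choose k) * (E n ^ (q - k) * A k n))"
      unfolding E_def A_def
      by (rule card_avoids_binomial[OF local_constraints_violated finX violated_image])
    ultimately have "f q n = (1 / V ^ q) * of_nat (avoiding_count P b \<H> q n)" using f n by simp
    then show ?thesis unfolding V by (simp add: of_rat_mult of_rat_divide of_rat_power)
  qed
  then show ?thesis using two by blast
qed

end
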